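(* Consider a sequence of problem instances indexed by $n\to\infty$ (with $m,\mu_0,K$ depending on $n$, $\sigma\in(0,\infty)$ fixed), where $K\subset\mathbb{R}^n$ is a closed convex cone, $\mu_0\in K$, and $Y=X\mu_0+\xi$ as in the context. Let $$\mathcal{E}_K(\mu_0)=\inf_{1\le k\le n}\ \inf_{\mu\in K_S\cap K\in\mathscr{K}_k,\ S=\{S_\ell\}_{\ell=1}^k}\bigg(\frac{\|\mu-\mu_0\|^2}{n}+\frac{\sigma^2}{m}\sum_{\ell=1}^k\delta_{K|_{S_\ell}}\bigg),$$ where the inner infimum is over all members $K_S\cap K$ of the class $\mathscr{K}_k$ defined in the context and all $\mu\in K_S\cap K$. If $m/\mathfrak{L}_n\to\infty$, $\mathcal{E}_K(\mu_0)=\mathfrak{o}(1)$ and $\inf_{\nu\in L(K)}\|\mu_0-\nu\|/\sqrt n=\mathcal{O}(1)$, then for any sequence of near minimizers $\hat\mu(\sigma)\in K$, as $n\to\infty$, $$n^{-1}\|\hat\mu(\sigma)-\mu_0\|^2\le(1+\mathfrak{o}_{\mathbf P}(1))\,\mathcal{E}_K(\mu_0)+\mathcal{O}_{\mathbf P}(\mathfrak{L}_n/m).$$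
   Context: Model: $X\in\mathbb{R}^{m\times n}$ has i.i.d. $\mathcal{N}(0,1/n)$ entries; $\xi\in\mathbb{R}^m$ is independent of $X$ with i.i.d. coordinates of mean $0$ and variance $\sigma^2$, with common law not depending on $n$. $\|\cdot\|$ is Euclidean. For $S'\subset\{1,\dots,n\}$, $\nu|_{S'}\in\mathbb{R}^{S'}$ is the restriction of $\nu\in\mathbb{R}^n$ and $K|_{S'}=\{\nu|_{S'}:\nu\in K\}$. For $1\le k\le n$, $\mathscr{K}_k$ is the class of all sets $K_S\cap K$, where $S=\{S_\ell\}_{\ell=1}^k$ is a partition of $\{1,\dots,n\}$ into $k$ blocks and $K_S=\{\nu\in\mathbb{R}^n:\nu|_{S_\ell}\in K_{S_\ell}\ \forall\ell\}$ for some closed convex cones $K_{S_\ell}\subset\mathbb{R}^{S_\ell}$ with $K|_{S_\ell}-K_{S_\ell}\subset K|_{S_\ell}$ (Minkowski difference $\{a-b\}$). For a convex cone $C\subset\mathbb{R}^d$, $\delta_C=\mathbb{E}\|\Pi_{\bar C}(h)\|^2$ with $h\sim\mathcal{N}(0,I_d)$, $\bar C$ the closure of $C$, and $\Pi$ the metric projection. $L(K)$ is the maximal linear subspace contained in $K$. $T_K(\mu_0)=\mathrm{cl}\{\alpha(\nu-\mu_0):\alpha\ge0,\nu\in K\}$ and $\mathfrak{L}_n=\log(1+\delta_{T_K(\mu_0)})+\log\log(16n)$. Near minimizers: $\hat\mu(\sigma)\in K$ with $m^{-1}\|Y-X\hat\mu(\sigma)\|^2\le\min_{\mu\in K}m^{-1}\|Y-X\mu\|^2+\mathfrak{o}_{\mathbf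 P}(r_n^2)$, where $r_n\in(0,\infty)$ is the solution (existing uniquely for all large $n$ under the stated conditions, if $K\neq\{\mu_0\}$) of $n^{-1}\mathbb{E}\|\Pi_K(\mu_0+\omega_{m/n}(r)h)-\mu_0\|^2=r^2$, with $h\sim\mathcal{N}(0,I_n)$ and $\omega_{m/n}(r)=\sqrt{(r^2+\sigma^2)/(m/n)}$. *)

theory Defs
  imports "HOL-Probability.Probability" "HOL-Library.Function_Algebras"
begin

text \<open>
  Vectors of \<open>\<real>\<^sup>I\<close>, for a finite set \<open>I\<close> of natural numbers, are functions of type
  \<open>nat \<Rightarrow> real\<close> vanishing outside \<open>I\<close>, with pointwise operations; this lets the dimension
  vary inside one statement. The library's \<open>convex_cone\<close>, \<open>subspace\<close>, \<open>closed\<close> and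
  \<open>closure\<close> apply directly: the topology on \<open>nat \<Rightarrow> real\<close> is the product topology, in which
  \<open>\<real>\<^sup>I\<close> is a closed subset carrying the Euclidean topology. The Euclidean norm on
  \<open>\<real>\<^sup>I\<close> is \<open>\<lambda>x. L2_set x I\<close>; the library's \<open>dist\<close> on functions is a different
  metric and is not used here.
\<close>

instantiation "fun" :: (type, real_vector) real_vector
begin

definition scaleR_fun :: "real \<Rightarrow> ('a \<Rightarrow> 'b) \<Rightarrow> 'a \<Rightarrow> 'b"
  where "scaleR_fun c f = (\<lambda>x. c *\<^sub>R f x)"

instance
  by standard (simp_all add: scaleR_fun_def plus_fun_def fun_eq_iff scaleR_add_right scaleR_add_left)

end

definition coord_space :: "nat set \<Rightarrow> (nat \<Rightarrow> real) set"
  where "coord_space I = {x. \<forall>i. i \<notin> I \<longrightarrow> x i = 0}"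

definition coord_restrict :: "nat set \<Rightarrow> (nat \<Rightarrow> real) \<Rightarrow> (nat \<Rightarrow> real)"
  where "coord_restrict S x = (\<lambda>i. if i \<in> S then x i else 0)"

section \<open>Cones\<close>

text \<open>
  Metric projection in \<open>\<real>\<^sup>I\<close> onto \<open>C \<subseteq> \<real>\<^sup>I\<close>. Only the coordinates of \<open>h\<close> in \<open>I\<close> matter,
  so it may be applied to samples of a product measure over \<open>I\<close>, which are not zero but
  \<open>undefined\<close> outside \<open>I\<close>.
\<close>

definition metric_proj :: "nat set \<Rightarrow> (nat \<Rightarrow> real) set \<Rightarrow> (nat \<Rightarrow> real) \<Rightarrow> (nat \<Rightarrow> real)"
  where "metric_proj I C h =
    (THE x. x \<in> C \<and> (\<forall>y\<in>C. L2_set (h - x) I \<le> L2_set (h - y) I))"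

definition std_gaussian :: "nat set \<Rightarrow> (nat \<Rightarrow> real) measure"
  where "std_gaussian I = Pi\<^sub>M I (\<lambda>_. density lborel std_normal_density)"

text \<open>The statistical dimension \<open>\<delta>\<^sub>C\<close> of a convex cone \<open>C \<subseteq> \<real>\<^sup>I\<close>.\<close>

definition stat_dim :: "nat set \<Rightarrow> (nat \<Rightarrow> real) set \<Rightarrow> real"
  where "stat_dim I C =
    (\<integral>h. (L2_set (metric_proj I (closure C) h) I)\<^sup>2 \<partial>std_gaussian I)"

definition tangent_cone :: "(nat \<Rightarrow> real) set \<Rightarrow> (nat \<Rightarrow> real) \<Rightarrow> (nat \<Rightarrow> real) set"
  where "tangent_cone K \<mu>\<^sub>0 = closure {\<alpha> *\<^sub>R (\<nu> - \<mu>\<^sub>0) |\<alpha> \<nu>. 0 \<le> \<alpha> \<and> \<nu> \<in> K}"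

definition lineality :: "(nat \<Rightarrow> real) set \<Rightarrow> (nat \<Rightarrow> real) set"
  where "lineality K = (GREATEST V. subspace V \<and> V \<subseteq> K)"

definition block_cone :: "nat \<Rightarrow> nat set set \<Rightarrow> (nat set \<Rightarrow> (nat \<Rightarrow> real) set) \<Rightarrow> (nat \<Rightarrow> real) set"
  where "block_cone n S C = {\<nu> \<in> coord_space {1..n}. \<forall>B\<in>S. coord_restrict B \<nu> \<in> C B}"

text \<open>
  The class \<open>\<K>\<^sub>k\<close>. Each member is recorded together with the partition that produces it,
  since the statistical dimension term below depends on that partition.
\<close>

definition block_class ::
    "nat \<Rightarrow> (nat \<Rightarrow> real) set \<Rightarrow> nat \<Rightarrow> (nat set set \<times> (nat \<Rightarrow> real) set) set"
  where "block_class n K k =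
    {(S, block_cone n S C \<inter> K) |S C.
       partition_on {1..n} S \<and> card S = k \<and>
       (\<forall>B\<in>S. C B \<subseteq> coord_space B \<and> closed (C B) \<and> convex_cone (C B) \<and>
          {a - b |a b. a \<in> coord_restrict B ` K \<and> b \<in> C B} \<subseteq> coord_restrict B ` K)}"

definition oracle_risk ::
    "nat \<Rightarrow> nat \<Rightarrow> real \<Rightarrow> (nat \<Rightarrow> real) set \<Rightarrow> (nat \<Rightarrow> real) \<Rightarrow> real"
  where "oracle_risk m n \<sigma> K \<mu>\<^sub>0 =
    (INF k\<in>{1..n}.
       Inf {(L2_set (\<mu> - \<mu>\<^sub>0) {1..n})\<^sup>2 / real n
              + \<sigma>\<^sup>2 / real m * (\<Sum>B\<in>S. stat_dim B (coord_restrict B ` K)) |\<mu> S F.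
            (S, F) \<in> block_class n K k \<and> \<mu> \<in> F})"

definition log_dim :: "nat \<Rightarrow> (nat \<Rightarrow> real) set \<Rightarrow> (nat \<Rightarrow> real) \<Rightarrow> real"
  where "log_dim n K \<mu>\<^sub>0 =
    ln (1 + stat_dim {1..n} (tangent_cone K \<mu>\<^sub>0)) + ln (ln (16 * real n))"

section \<open>The regression model\<close>

text \<open>
  The last conjunct says that \<open>X\<close> and \<open>\<xi>\<close> are independent, via the sigma-algebras they
  generate: the library's \<open>indep_var\<close> needs both variables to have the same value type.
\<close>

definition linear_model ::
    "'a measure \<Rightarrow> nat \<Rightarrow> nat \<Rightarrow> real measure \<Rightarrow> ('a \<Rightarrow> nat \<Rightarrow> nat \<Rightarrow> real) \<Rightarrow> ('a \<Rightarrow> nat \<Rightarrow> real) \<Rightarrow> bool"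
  where "linear_model M m n D X \<xi> \<longleftrightarrow>
    prob_space M \<and>
    prob_space.indep_vars M (\<lambda>_. borel) (\<lambda>(i, j) \<omega>. X \<omega> i j) ({1..m} \<times> {1..n}) \<and>
    (\<forall>i\<in>{1..m}. \<forall>j\<in>{1..n}.
       distributed M lborel (\<lambda>\<omega>. X \<omega> i j) (normal_density 0 (sqrt (1 / real n)))) \<and>
    prob_space.indep_vars M (\<lambda>_. borel) (\<lambda>i \<omega>. \<xi> \<omega> i) {1..m} \<and>
    (\<forall>i\<in>{1..m}. distr M borel (\<lambda>\<omega>. \<xi> \<omega> i) = D) \<and>
    prob_space.indep_set M
      (sets (vimage_algebra (space M) (\<lambda>\<omega>. \<lambda>(i, j)\<in>{1..m} \<times> {1..n}. X \<omega> i j)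
               (Pi\<^sub>M ({1..m} \<times> {1..n}) (\<lambda>_. borel))))
      (sets (vimage_algebra (space M) (\<lambda>\<omega>. \<lambda>i\<in>{1..m}. \<xi> \<omega> i) (Pi\<^sub>M {1..m} (\<lambda>_. borel))))"

definition mat_vec :: "nat \<Rightarrow> nat \<Rightarrow> (nat \<Rightarrow> nat \<Rightarrow> real) \<Rightarrow> (nat \<Rightarrow> real) \<Rightarrow> (nat \<Rightarrow> real)"
  where "mat_vec m n A x = (\<lambda>i. if i \<in> {1..m} then \<Sum>j\<in>{1..n}. A i j * x j else 0)"

definition sq_loss ::
    "nat \<Rightarrow> nat \<Rightarrow> (nat \<Rightarrow> nat \<Rightarrow> real) \<Rightarrow> (nat \<Rightarrow> real) \<Rightarrow> (nat \<Rightarrow> real) \<Rightarrow> real"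
  where "sq_loss m n A y \<mu> = (L2_set (y - mat_vec m n A \<mu>) {1..m})\<^sup>2 / real m"

section \<open>Stochastic order symbols and near minimizers\<close>

definition small_o_prob :: "(nat \<Rightarrow> 'a measure) \<Rightarrow> (nat \<Rightarrow> 'a \<Rightarrow> real) \<Rightarrow> (nat \<Rightarrow> real) \<Rightarrow> bool"
  where "small_o_prob M Z a \<longleftrightarrow>
    (\<forall>n\<ge>1. Z n \<in> borel_measurable (M n)) \<and>
    (\<forall>\<epsilon>>0. (\<lambda>n. measure (M n) {\<omega> \<in> space (M n). \<bar>Z n \<omega>\<bar> > \<epsilon> * a n}) \<longlonglongrightarrow> 0)"

definition big_O_prob :: "(nat \<Rightarrow> 'a measure) \<Rightarrow> (nat \<Rightarrow> 'a \<Rightarrow> real) \<Rightarrow> (nat \<Rightarrow> real) \<Rightarrow> bool"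
  where "big_O_prob M Z a \<longleftrightarrow>
    (\<forall>n\<ge>1. Z n \<in> borel_measurable (M n)) \<and>
    (\<forall>\<epsilon>>0. \<exists>c>0. \<forall>\<^sub>F n in sequentially.
       measure (M n) {\<omega> \<in> space (M n). \<bar>Z n \<omega>\<bar> > c * a n} \<le> \<epsilon>)"

definition eff_noise :: "real \<Rightarrow> real \<Rightarrow> real \<Rightarrow> real"
  where "eff_noise \<sigma> \<kappa> r = sqrt ((r\<^sup>2 + \<sigma>\<^sup>2) / \<kappa>)"

text \<open>
  The solution \<open>r\<^sub>n\<close> of the fixed point equation. If \<open>K = {\<mu>\<^sub>0}\<close> there is no positive
  solution and the value is unspecified; this is harmless, because then \<open>\<mu>\<^sub>0\<close> is the only
  element of \<open>K\<close> and is a near minimizer with slack zero whatever the value is.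
\<close>

definition fixed_point_radius ::
    "nat \<Rightarrow> nat \<Rightarrow> real \<Rightarrow> (nat \<Rightarrow> real) set \<Rightarrow> (nat \<Rightarrow> real) \<Rightarrow> real"
  where "fixed_point_radius m n \<sigma> K \<mu>\<^sub>0 =
    (THE r. 0 < r \<and>
       (\<integral>h. (L2_set (metric_proj {1..n} K (\<mu>\<^sub>0 + eff_noise \<sigma> (real m / real n) r *\<^sub>R h) - \<mu>\<^sub>0) {1..n})\<^sup>2
          \<partial>std_gaussian {1..n}) / real n = r\<^sup>2)"

text \<open>
  A sequence of near minimizers: random vectors in \<open>K n\<close> whose loss exceeds the minimal one
  by at most a random slack \<open>e n\<close> of order \<open>o\<^sub>P(r\<^sub>n\<^sup>2)\<close>. The minimum over \<open>K n\<close> is written as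
  an infimum, which is the same number whenever the minimum is attained.
\<close>

definition near_minimizers ::
    "(nat \<Rightarrow> 'a measure) \<Rightarrow> (nat \<Rightarrow> nat) \<Rightarrow> real \<Rightarrow> (nat \<Rightarrow> (nat \<Rightarrow> real) set) \<Rightarrow> (nat \<Rightarrow> nat \<Rightarrow> real) \<Rightarrow>
     (nat \<Rightarrow> 'a \<Rightarrow> nat \<Rightarrow> nat \<Rightarrow> real) \<Rightarrow> (nat \<Rightarrow> 'a \<Rightarrow> nat \<Rightarrow> real) \<Rightarrow> (nat \<Rightarrow> 'a \<Rightarrow> nat \<Rightarrow> real) \<Rightarrow> bool"
  where "near_minimizers M m \<sigma> K \<mu>\<^sub>0 X Y \<mu>h \<longleftrightarrow>
    (\<forall>n\<ge>1. \<forall>i\<in>{1..n}. (\<lambda>\<omega>. \<mu>h n \<omega> i) \<in> borel_measurable (M n)) \<and>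
    (\<forall>n\<ge>1. \<forall>\<omega>\<in>space (M n). \<mu>h n \<omega> \<in> K n) \<and>
    (\<exists>e. small_o_prob M e (\<lambda>n. (fixed_point_radius (m n) n \<sigma> (K n) (\<mu>\<^sub>0 n))\<^sup>2) \<and>
       (\<forall>n\<ge>1. \<forall>\<omega>\<in>space (M n).
          sq_loss (m n) n (X n \<omega>) (Y n \<omega>) (\<mu>h n \<omega>)
            \<le> (INF \<mu>\<in>K n. sq_loss (m n) n (X n \<omega>) (Y n \<omega>) \<mu>) + e n \<omega>))"

end

theory Submission
  imports Defs "HOL-Real_Asymp.Real_Asymp"
begin

text \<open>
  Choose a member \<open>K\<^sub>S \<inter> K\<close> of the class and a point \<open>\<mu>\<close> in it almost attaining the oracle risk,
  and put \<open>b = \<mu> - \<mu>\<^sub>0\<close>. Then \<open>K - \<mu>\<close> lies in the product \<open>C\<close> of the closures of the \<open>K|\<^sub>B\<close>, whose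
  statistical dimension \<open>d\<close> is the sum of those of the blocks and is \<open>o(m)\<close>. With \<open>v = \<mu>h - \<mu> \<in> C\<close>,
  strong convexity of the loss gives, up to the slack,
  \<open>|X(b + v)|\<^sup>2 + |X v|\<^sup>2 - |X b|\<^sup>2 \<le> 2 \<langle>\<xi>, X v\<rangle>\<close>.
  Uniformly in \<open>v\<close>, the left-hand side is at least
  \<open>(m/n) (|b + v|\<^sup>2 + |v|\<^sup>2 - |b|\<^sup>2)\<close> minus a small multiple of \<open>(m/n) (|b|\<^sup>2 + |v|\<^sup>2)\<close>:
  truncate the squares, symmetrize, contract, and compare with the Gaussian width of \<open>C\<close>, which is
  at most \<open>sqrt d = o(sqrt m)\<close>. The right-hand side is at most \<open>2 |\<xi>| |\<Pi>\<^sub>C g| |v| / sqrt n\<close> with \<open>g\<close>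
  standard Gaussian given \<open>\<xi>\<close>, and a Gaussian Poincare inequality bounds the variance of
  \<open>|\<Pi>\<^sub>C g|\<^sup>2\<close> by a multiple of its mean \<open>d\<close>. Completing the square in \<open>|v|\<close> leaves the constant one
  in front of \<open>|b|\<^sup>2 / n + \<sigma>\<^sup>2 d / m\<close>; the fluctuations are a small multiple of this plus \<open>O(1/m)\<close>,
  which \<open>L\<^sub>n / m\<close> dominates because \<open>L\<^sub>n \<ge> log log (16 n) \<rightarrow> \<infinity>\<close>. The same comparison in the
  Gaussian sequence model bounds \<open>r\<^sub>n\<^sup>2\<close> by a multiple of the oracle risk plus \<open>1/m\<close>, so the
  slack is negligible.
\<close>

section \<open>Projections onto closed convex cones\<close>

text \<open>The constant one dictates the shape. The terms \<open>|X(b + v)|^2\<close> and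
  \<open>|X v|^2\<close> are bounded below uniformly over the cone, whereas \<open>|X b|^2\<close>
  is bounded above for one fixed vector b only, where the weak law for Gaussian squares gives it.
  Without the gain \<open>|X v|^2\<close>, completing the square would cost a factor 4 before
  \<open>\<sigma>\<^sup>2 * d / m\<close>, already for b = 0. Convergence is claimed in probability
  only, so Markov and Chebyshev replace exponential concentration. The noise has just a variance:
  its norm is controlled by a truncated weak law, and given the noise \<open>X\<^sup>T \<xi>\<close>
  is Gaussian whatever the law of \<xi>. The Chebyshev bound for the projection norm becomes uniform
  in d by allowing an excess \<open>\<eta> * d + \<tau>\<close>: its square is at least
  \<open>4 * \<eta> * \<tau> * d\<close>, against a variance of order d. The part
  \<open>\<eta> * d\<close> goes into the relative error, \<tau> into \<open>\<tau> / m\<close>. All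
  estimates are made for fixed \<eta> and failure probability \<delta>; the random factors of the
  conclusion are built at the end from the resulting tail bounds.\<close>

definition inner_on :: "nat set \<Rightarrow> (nat \<Rightarrow> real) \<Rightarrow> (nat \<Rightarrow> real) \<Rightarrow> real"
  where "inner_on I x y = (\<Sum>i\<in>I. x i * y i)"

lemma fun_apply_simps [simp]:
  "(x + y) i = x i + (y i :: real)" "(x - y) i = x i - (y i :: real)"
  "(- x) i = - (x i :: real)" "(c *\<^sub>R x) i = c * x i" "(0 :: _ \<Rightarrow> real) i = 0"
  by (simp_all add: scaleR_fun_def)

lemma inner_on_simps:
  "inner_on I (x + y) z = inner_on I x z + inner_on I y z"
  "inner_on I (x - y) z = inner_on I x z - inner_on I y z"
  "inner_on I (c *\<^sub>R x) z = c * inner_on I x z"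
  "inner_on I (- x) z = - inner_on I x z"
  "inner_on I 0 z = 0"
  "inner_on I z (x + y) = inner_on I z x + inner_on I z y"
  "inner_on I z (x - y) = inner_on I z x - inner_on I z y"
  "inner_on I z (c *\<^sub>R x) = c * inner_on I z x"
  "inner_on I z (- x) = - inner_on I z x"
  "inner_on I z 0 = 0"
  unfolding inner_on_def
  by (simp_all add: algebra_simps sum.distrib sum_subtractf sum_distrib_left sum_negf)

lemma inner_on_commute: "inner_on I x y = inner_on I y x"
  by (simp add: inner_on_def mult.commute)

lemma inner_on_self_nonneg [simp]: "0 \<le> inner_on I x x"
  by (simp add: inner_on_def sum_nonneg)

lemma L2_set_sq: "(L2_set x I)\<^sup>2 = inner_on I x x"
  by (simp add: L2_set_def inner_on_def sum_nonneg power2_eq_square)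

lemma L2_set_eq_sqrt_inner: "L2_set x I = sqrt (inner_on I x x)"
  by (simp add: L2_set_def inner_on_def power2_eq_square)

lemma inner_on_le_L2: "inner_on I x y \<le> L2_set x I * L2_set y I"
proof -
  have "inner_on I x y \<le> (\<Sum>i\<in>I. \<bar>x i\<bar> * \<bar>y i\<bar>)"
    unfolding inner_on_def by (intro sum_mono) (metis abs_ge_self abs_mult)
  then show ?thesis using L2_set_mult_ineq[of x y I] by linarith
qed

lemma L2_set_scaleR:
  fixes x :: "nat \<Rightarrow> real"
  shows "L2_set (c *\<^sub>R x) I = \<bar>c\<bar> * L2_set x I"
proof -
  have "inner_on I (c *\<^sub>R x) (c *\<^sub>R x) = c\<^sup>2 * inner_on I x x"
    by (simp only: inner_on_simps) (simp add: power2_eq_square)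
  then show ?thesis by (simp add: L2_set_eq_sqrt_inner real_sqrt_mult)
qed

lemma L2_set_triangle_add: "L2_set (x + y) I \<le> L2_set x I + L2_set y I"
  using L2_set_triangle_ineq[of x y I] by (simp add: plus_fun_def)

lemma L2_set_minus_commute: "L2_set (x - y) I = L2_set (y - x) I"
  by (simp add: L2_set_def power2_commute)

lemma L2_set_reverse_triangle: "\<bar>L2_set x I - L2_set y I\<bar> \<le> L2_set (x - y) I"
  using L2_set_triangle_add[of "x - y" y I] L2_set_triangle_add[of "y - x" x I]
  by (simp add: L2_set_minus_commute[of y x])

lemma inner_on_diff_scaleR_sq:
  "inner_on I (u - t *\<^sub>R w) (u - t *\<^sub>R w) = inner_on I u u - 2 * t * inner_on I u w + t * t * inner_on I w w"
  by (simp add: inner_on_simps inner_on_commute[of I w u] algebra_simps)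

lemma L2_set_le_iff_inner: "L2_set x I \<le> L2_set y I \<longleftrightarrow> inner_on I x x \<le> inner_on I y y"
  by (simp add: L2_set_eq_sqrt_inner)

lemma L2_set_zero_fun [simp]: "L2_set 0 I = 0"
  by (simp add: L2_set_def)

lemma coord_space_eqI:
  assumes "x \<in> coord_space I" "y \<in> coord_space I" "finite I" "L2_set (x - y) I = 0"
  shows "x = y"
proof
  fix i show "x i = y i"
  proof (cases "i \<in> I")
    case True
    then show ?thesis using assms(3,4) by (simp add: L2_set_eq_0_iff)
  qed (use assms in \<open>simp add: coord_space_def\<close>)
qed

section \<open>Topology of coordinate subspaces\<close>

lemma continuous_L2_set [continuous_intros]:
  assumes "continuous_on S f" "finite I"
  shows "continuous_on S (\<lambda>x. L2_set (f x) I)"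
proof -
  have "continuous_on S (\<lambda>x. f x i)" for i
    using assms(1) by (rule continuous_on_product_then_coordinatewise)
  then show ?thesis unfolding L2_set_def using assms(2) by (intro continuous_intros) auto
qed

lemma continuous_fun_plus [continuous_intros]:
  fixes f g :: "'a::topological_space \<Rightarrow> nat \<Rightarrow> real"
  assumes "continuous_on S f" "continuous_on S g"
  shows "continuous_on S (\<lambda>x. f x + g x)" "continuous_on S (\<lambda>x. f x - g x)"
  by (rule continuous_on_coordinatewise_then_product,
      simp add: continuous_on_add continuous_on_diff continuous_on_product_then_coordinatewise assms)+

lemma continuous_fun_scaleR [continuous_intros]:
  fixes g :: "'a::topological_space \<Rightarrow> nat \<Rightarrow> real"
  assumes "continuous_on S f" "continuous_on S g"
  shows "continuous_on S (\<lambda>x. f x *\<^sub>R g x)"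
  by (rule continuous_on_coordinatewise_then_product)
     (simp add: continuous_on_mult continuous_on_product_then_coordinatewise assms)

lemma continuous_coord_restrict [continuous_intros]:
  assumes "continuous_on S f"
  shows "continuous_on S (\<lambda>x. coord_restrict B (f x))"
  unfolding coord_restrict_def
proof (rule continuous_on_coordinatewise_then_product)
  fix i show "continuous_on S (\<lambda>x. if i \<in> B then f x i else 0)"
    by (cases "i \<in> B") (simp_all add: continuous_on_product_then_coordinatewise assms)
qed

lemma closed_coord_space: "closed (coord_space I)"
proof -
  have "coord_space I = (\<Inter>i\<in>-I. (\<lambda>x. x i) -` {0})"
    by (auto simp: coord_space_def)
  moreover have "closed ((\<lambda>x::nat \<Rightarrow> real. x i) -` {0})" for i
    by (intro closed_vimage) auto
  ultimately show ?thesis by auto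
qed

lemma coord_space_convex:
  "x \<in> coord_space I \<Longrightarrow> y \<in> coord_space I \<Longrightarrow> x + y \<in> coord_space I"
  "x \<in> coord_space I \<Longrightarrow> y \<in> coord_space I \<Longrightarrow> x - y \<in> coord_space I"
  "x \<in> coord_space I \<Longrightarrow> c *\<^sub>R x \<in> coord_space I"
  "0 \<in> coord_space I"
  by (auto simp: coord_space_def)

text \<open>Tychonoff's theorem. With \<open>a i = b i = 0\<close> off a finite set it supplies
  compactness inside \<open>coord_space\<close> for the product topology.\<close>

lemma compact_box:
  fixes a b :: "nat \<Rightarrow> real"
  shows "compact {x. \<forall>i. x i \<in> {a i..b i}}"
proof -
  have "{x. \<forall>i. x i \<in> {a i..b i}} = PiE UNIV (\<lambda>i. {a i..b i})"
    by (auto simp: PiE_def Pi_def)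
  moreover have "compactin (product_topology (\<lambda>_. euclidean) UNIV) (PiE UNIV (\<lambda>i. {a i..b i}))"
    by (simp add: compactin_PiE)
  ultimately show ?thesis
    by (simp add: euclidean_product_topology)
qed

section \<open>Metric projection onto a closed convex set\<close>

locale closed_convex_on =
  fixes I :: "nat set" and C :: "(nat \<Rightarrow> real) set"
  assumes finI: "finite I" and sub: "C \<subseteq> coord_space I" and closedC: "closed C"
    and convexC: "convex C" and nonempty: "C \<noteq> {}"
begin

lemma nearest_exists: "\<exists>x\<in>C. \<forall>y\<in>C. L2_set (h - x) I \<le> L2_set (h - y) I"
proof -
  obtain z where z: "z \<in> C" using nonempty by blast
  define R where "R = L2_set (h - z) I"
  \<comment> \<open>A compact box containing every point of \<open>C\<close> at least as near to
    \<open>h\<close> as \<open>z\<close>. Off \<open>I\<close> its sides shrink to {0}, matching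
    \<open>C \<subseteq> coord_space I\<close>.\<close>
  define Q where "Q = {x. \<forall>i. x i \<in> {(if i \<in> I then h i - R else 0)..(if i \<in> I then h i + R else 0)}}"
  have "compact (Q \<inter> C)" unfolding Q_def by (intro compact_Int_closed compact_box closedC)
  moreover have in_Q: "x \<in> Q" if "x \<in> C" "L2_set (h - x) I \<le> R" for x
  proof -
    have "\<bar>h i - x i\<bar> \<le> R" if "i \<in> I" for i
    proof -
      have "\<bar>h i - x i\<bar> \<le> L2_set (\<lambda>i. \<bar>h i - x i\<bar>) I" using finI that by (intro member_le_L2_set)
      also have "\<dots> = L2_set (h - x) I" by (simp add: L2_set_def)
      finally show ?thesis using \<open>L2_set (h - x) I \<le> R\<close> by linarith
    qed
    moreover have "x i = 0" if "i \<notin> I" for i using that \<open>x \<in> C\<close> sub by (auto simp: coord_space_def)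
    ultimately show ?thesis by (fastforce simp: Q_def abs_le_iff)
  qed
  moreover have "continuous_on (Q \<inter> C) (\<lambda>x. L2_set (h - x) I)"
    by (intro continuous_intros finI)
  moreover have "z \<in> Q \<inter> C" using in_Q z by (simp add: R_def)
  ultimately obtain x where x: "x \<in> Q \<inter> C" "\<forall>y\<in>Q \<inter> C. L2_set (h - x) I \<le> L2_set (h - y) I"
    by (metis continuous_attains_inf empty_iff)
  have "L2_set (h - x) I \<le> L2_set (h - y) I" if "y \<in> C" for y
  proof (cases "L2_set (h - y) I \<le> R")
    case True then show ?thesis using x in_Q that by blast
  next
    case False
    have "L2_set (h - x) I \<le> R" using x \<open>z \<in> Q \<inter> C\<close> by (simp add: R_def)
    then show ?thesis using False by linarith
  qed
  then show ?thesis using x by blast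
qed

lemma nearest_imp_variational:
  assumes "x \<in> C" "\<And>y. y \<in> C \<Longrightarrow> L2_set (h - x) I \<le> L2_set (h - y) I" "y \<in> C"
  shows "inner_on I (h - x) (y - x) \<le> 0"
proof (rule ccontr)
  define a where "a = inner_on I (h - x) (y - x)"
  define q where "q = inner_on I (y - x) (y - x)"
  assume "\<not> inner_on I (h - x) (y - x) \<le> 0"
  then have a: "a > 0" by (simp add: a_def)
  have q: "q \<ge> 0" by (simp add: q_def)
  \<comment> \<open>Small enough that the linear gain \<open>2 * t * a\<close> beats the quadratic
    cost \<open>t * t * q\<close> on the segment from x to y; the 1 in the denominator covers
    \<open>q = 0\<close>.\<close>
  define t where "t = min 1 (a / (q + 1))"
  have t: "0 < t" "t \<le> 1" using a q by (auto simp: t_def)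
  have "t \<le> a / (q + 1)" by (simp add: t_def)
  then have "t * (q + 1) \<le> a" using q by (simp add: pos_le_divide_eq)
  then have tq: "t * q < 2 * a" using t a by (simp add: algebra_simps)
  define z where "z = (1 - t) *\<^sub>R x + t *\<^sub>R y"
  have "z \<in> C" unfolding z_def using t by (intro convexD_alt[OF convexC assms(1,3)]) auto
  then have "inner_on I (h - x) (h - x) \<le> inner_on I (h - z) (h - z)"
    using assms(2) by (simp add: L2_set_le_iff_inner)
  moreover have "h - z = (h - x) - t *\<^sub>R (y - x)"
    by (rule ext) (simp add: z_def algebra_simps)
  then have "inner_on I (h - z) (h - z) = inner_on I (h - x) (h - x) - 2 * t * a + t * t * q"
    unfolding a_def q_def by (simp only: inner_on_diff_scaleR_sq)
  ultimately have "2 * t * a \<le> t * (t * q)" by simp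
  then have "2 * a \<le> t * q" using t by simp
  then show False using tq by simp
qed

lemma variational_unique:
  assumes "x \<in> C" "z \<in> C" "inner_on I (h - x) (z - x) \<le> 0" "inner_on I (h - z) (x - z) \<le> 0"
  shows "x = z"
proof -
  have "inner_on I (x - z) (x - z) = inner_on I (h - x) (z - x) + inner_on I (h - z) (x - z)"
    by (simp add: inner_on_simps inner_on_commute algebra_simps)
  then have "inner_on I (x - z) (x - z) = 0"
    using assms(3,4) inner_on_self_nonneg[of I "x - z"] by linarith
  then show ?thesis
    using assms(1,2) sub finI by (intro coord_space_eqI) (auto simp: L2_set_eq_sqrt_inner)
qed

abbreviation proj :: "(nat \<Rightarrow> real) \<Rightarrow> nat \<Rightarrow> real"
  where "proj \<equiv> metric_proj I C"

lemma proj_nearest: "proj h \<in> C \<and> (\<forall>y\<in>C. L2_set (h - proj h) I \<le> L2_set (h - y) I)"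
proof -
  obtain x where x: "x \<in> C" "\<forall>y\<in>C. L2_set (h - x) I \<le> L2_set (h - y) I"
    using nearest_exists by blast
  have "\<exists>!x. x \<in> C \<and> (\<forall>y\<in>C. L2_set (h - x) I \<le> L2_set (h - y) I)"
  proof (rule ex1I)
    show "x \<in> C \<and> (\<forall>y\<in>C. L2_set (h - x) I \<le> L2_set (h - y) I)" using x by blast
    fix z assume "z \<in> C \<and> (\<forall>y\<in>C. L2_set (h - z) I \<le> L2_set (h - y) I)"
    then show "z = x" using x by (intro variational_unique[where h = h] nearest_imp_variational) auto
  qed
  from theI'[OF this] show ?thesis by (simp add: metric_proj_def)
qed

lemma proj_in [simp]: "proj h \<in> C"
  using proj_nearest by blast

lemma proj_in_coord_space [simp]: "proj h \<in> coord_space I"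
  using sub proj_in by blast

lemma proj_variational: "y \<in> C \<Longrightarrow> inner_on I (h - proj h) (y - proj h) \<le> 0"
  using proj_nearest by (intro nearest_imp_variational) auto

lemma proj_eqI:
  assumes "x \<in> C" "\<And>y. y \<in> C \<Longrightarrow> inner_on I (h - x) (y - x) \<le> 0"
  shows "proj h = x"
  using assms by (intro variational_unique[where h = h] proj_variational proj_in) auto

lemma proj_nonexpansive: "L2_set (proj x - proj y) I \<le> L2_set (x - y) I"
proof -
  have "inner_on I (x - proj x) (proj y - proj x) + inner_on I (y - proj y) (proj x - proj y) \<le> 0"
    using proj_variational[of "proj y" x] proj_variational[of "proj x" y] by simp
  then have "inner_on I (proj x - proj y) (proj x - proj y) \<le> inner_on I (x - y) (proj x - proj y)"
    by (simp add: inner_on_simps inner_on_commute algebra_simps)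
  also have "\<dots> \<le> L2_set (x - y) I * L2_set (proj x - proj y) I" by (rule inner_on_le_L2)
  finally have "L2_set (proj x - proj y) I * L2_set (proj x - proj y) I
      \<le> L2_set (x - y) I * L2_set (proj x - proj y) I"
    by (simp add: power2_eq_square flip: L2_set_sq)
  then show ?thesis
    using L2_set_nonneg[of "x - y" I] L2_set_nonneg[of "proj x - proj y" I]
    by (metis mult_le_cancel_right order_le_less not_le)
qed

text \<open>\<open>L2_set (y - x) I\<close> is only a seminorm on
  \<open>nat \<Rightarrow> real\<close>, so the 1-Lipschitz bound becomes continuity through a
  squeeze, one coordinate at a time; coordinates outside \<open>I\<close> are constantly
  zero.\<close>

lemma continuous_proj: "continuous_on UNIV proj"
proof (rule continuous_on_coordinatewise_then_product)
  fix i show "continuous_on UNIV (\<lambda>x. proj x i)"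
  proof (cases "i \<in> I")
    case True
    show ?thesis unfolding continuous_on_eq_continuous_at[OF open_UNIV]
    proof (intro ballI)
      fix x
      have "continuous_on UNIV (\<lambda>y. L2_set (y - x) I)" by (intro continuous_intros finI)
      then have "isCont (\<lambda>y. L2_set (y - x) I) x"
        by (metis UNIV_I continuous_on_eq_continuous_at open_UNIV)
      then have "((\<lambda>y. L2_set (y - x) I) \<longlongrightarrow> L2_set (x - x) I) (at x)"
        by (simp only: isCont_def)
      then have lim: "((\<lambda>y. L2_set (y - x) I) \<longlongrightarrow> 0) (at x)" by simp
      have bd: "norm (proj y i - proj x i) \<le> L2_set (y - x) I" for y
      proof -
        have "\<bar>proj y i - proj x i\<bar> \<le> L2_set (\<lambda>i. \<bar>proj y i - proj x i\<bar>) I"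
          using finI True by (intro member_le_L2_set)
        also have "\<dots> = L2_set (proj y - proj x) I" by (simp add: L2_set_def)
        also have "\<dots> \<le> L2_set (y - x) I" by (rule proj_nonexpansive)
        finally show ?thesis by simp
      qed
      have "((\<lambda>y. proj y i - proj x i) \<longlongrightarrow> 0) (at x)"
        by (rule Lim_null_comparison[OF always_eventually lim]) (use bd in blast)
      then show "isCont (\<lambda>y. proj y i) x" unfolding isCont_def by (rule LIM_zero_cancel)
    qed
  next
    case False
    then have "proj x i = 0" for x using proj_in_coord_space[of x] by (simp add: coord_space_def)
    then show ?thesis by simp
  qed
qed

lemma proj_cong: "(\<And>i. i \<in> I \<Longrightarrow> x i = y i) \<Longrightarrow> proj x = proj y"
  unfolding metric_proj_def
  by (rule arg_cong[where f = The]) (auto intro!: ext simp: L2_set_def)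

text \<open>A sample of a product measure over \<open>I\<close> is \<open>undefined\<close> outside
  \<open>I\<close>, so continuity on the full function space is applied to
  \<open>coord_restrict I\<close>, which \<open>proj\<close> cannot tell from the original
  vector.\<close>

lemma measurable_proj:
  assumes "\<And>i. i \<in> I \<Longrightarrow> (\<lambda>\<omega>. f \<omega> i) \<in> borel_measurable N"
  shows "(\<lambda>\<omega>. proj (f \<omega>) i) \<in> borel_measurable N"
proof -
  have "(\<lambda>\<omega>. coord_restrict I (f \<omega>)) \<in> borel_measurable N"
  proof (rule measurable_coordinatewise_then_product)
    fix i show "(\<lambda>\<omega>. coord_restrict I (f \<omega>) i) \<in> borel_measurable N"
      using assms by (cases "i \<in> I") (simp_all add: coord_restrict_def)
  qed
  moreover have "(\<lambda>x. proj x i) \<in> borel_measurable borel"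
    by (rule borel_measurable_continuous_onI, rule continuous_on_product_then_coordinatewise, rule continuous_proj)
  ultimately have "(\<lambda>\<omega>. proj (coord_restrict I (f \<omega>)) i) \<in> borel_measurable N"
    by (rule measurable_compose)
  moreover have "proj (coord_restrict I (f \<omega>)) = proj (f \<omega>)" for \<omega>
    by (rule proj_cong) (simp add: coord_restrict_def)
  ultimately show ?thesis by (simp only:)
qed

end

section \<open>Projection onto a closed convex cone\<close>

locale closed_cone_on = closed_convex_on +
  assumes coneC: "convex_cone C"
begin

lemma zero_in [simp]: "0 \<in> C" using coneC by (simp add: convex_cone_iff)

lemma proj_orthogonal: "inner_on I (h - proj h) (proj h) = 0"
proof (rule antisym)
  have "2 *\<^sub>R proj h \<in> C" using coneC by (intro convex_cone_scaleR) auto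
  from proj_variational[OF this, of h] have "inner_on I (h - proj h) (2 *\<^sub>R proj h - proj h) \<le> 0" .
  moreover have "2 *\<^sub>R proj h - proj h = proj h" by (rule ext) simp
  ultimately show "inner_on I (h - proj h) (proj h) \<le> 0" by simp
  have "inner_on I (h - proj h) (0 - proj h) \<le> 0" by (rule proj_variational) simp
  then show "0 \<le> inner_on I (h - proj h) (proj h)" by (simp add: inner_on_simps)
qed

text \<open>Half of Moreau's decomposition: \<open>h - proj h\<close> lies in the polar
  cone.\<close>

lemma inner_le_proj: "v \<in> C \<Longrightarrow> inner_on I h v \<le> inner_on I (proj h) v"
  using proj_variational[of v h] proj_orthogonal[of h] by (simp add: inner_on_simps)

lemma cone_proj_eqI:
  assumes "x \<in> C" "inner_on I (h - x) x = 0" "\<And>v. v \<in> C \<Longrightarrow> inner_on I (h - x) v \<le> 0"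
  shows "proj h = x"
  using assms by (intro proj_eqI) (auto simp: inner_on_simps)

text \<open>Its square root is the largest \<open>inner_on I h v\<close> over
  \<open>v \<in> C\<close> of norm at most one, so it serves as width functional of the cone; its
  Gaussian mean is \<open>stat_dim I C\<close>.\<close>

definition proj_sq :: "(nat \<Rightarrow> real) \<Rightarrow> real"
  where "proj_sq h = (L2_set (proj h) I)\<^sup>2"

lemma proj_sq_nonneg [simp]: "0 \<le> proj_sq h" by (simp add: proj_sq_def)

lemma inner_le_sqrt_proj_sq: "v \<in> C \<Longrightarrow> inner_on I h v \<le> sqrt (proj_sq h) * L2_set v I"
  using inner_le_proj[of v h] inner_on_le_L2[of I "proj h" v] by (simp add: proj_sq_def)

lemma proj_sq_eq: "proj_sq h = inner_on I h (proj h)"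
  using proj_orthogonal[of h] by (simp add: proj_sq_def L2_set_sq inner_on_simps)

lemma proj_sq_ge: "v \<in> C \<Longrightarrow> 2 * inner_on I h v - inner_on I v v \<le> proj_sq h"
proof -
  assume "v \<in> C"
  have "0 \<le> inner_on I (proj h - v) (proj h - v)" by simp
  then have "2 * inner_on I (proj h) v - inner_on I v v \<le> inner_on I (proj h) (proj h)"
    by (simp add: inner_on_simps inner_on_commute)
  then show ?thesis using inner_le_proj[OF \<open>v \<in> C\<close>, of h] by (simp add: proj_sq_def L2_set_sq)
qed

text \<open>\<open>proj_sq\<close> is convex with gradient twice \<open>proj\<close>, and that
  gradient is 2-Lipschitz. These two inequalities are the subgradient bound and the quadratic upper
  bound; they stand in for differentiation in the variance estimate.\<close>

lemma proj_sq_expansion: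
  "0 \<le> proj_sq y - proj_sq x - 2 * inner_on I (proj x) (y - x)"
  "proj_sq y - proj_sq x - 2 * inner_on I (proj x) (y - x) \<le> 2 * inner_on I (y - x) (y - x)"
proof -
  have *: "0 \<le> proj_sq y - proj_sq x - 2 * inner_on I (proj x) (y - x)" for x y
    using proj_sq_ge[OF proj_in, of y x] proj_sq_eq[of x]
    by (simp add: proj_sq_def L2_set_sq inner_on_simps inner_on_commute)
  show "0 \<le> proj_sq y - proj_sq x - 2 * inner_on I (proj x) (y - x)" by (rule *)
  have "inner_on I (proj y - proj x) (y - x) \<le> L2_set (proj y - proj x) I * L2_set (y - x) I"
    by (rule inner_on_le_L2)
  also have "\<dots> \<le> L2_set (y - x) I * L2_set (y - x) I"
    by (intro mult_right_mono proj_nonexpansive) simp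
  finally have "inner_on I (proj y - proj x) (y - x) \<le> inner_on I (y - x) (y - x)"
    by (simp add: power2_eq_square flip: L2_set_sq)
  then show "proj_sq y - proj_sq x - 2 * inner_on I (proj x) (y - x) \<le> 2 * inner_on I (y - x) (y - x)"
    using *[of x y] by (simp add: inner_on_simps algebra_simps)
qed

lemma proj_scaleR: "0 \<le> c \<Longrightarrow> proj (c *\<^sub>R h) = c *\<^sub>R proj h"
proof (rule cone_proj_eqI)
  assume c: "0 \<le> c"
  show "c *\<^sub>R proj h \<in> C" using coneC c by (intro convex_cone_scaleR) auto
  have *: "inner_on I (c *\<^sub>R h - c *\<^sub>R proj h) v = c * inner_on I (h - proj h) v" for v
    by (simp add: inner_on_simps algebra_simps)
  show "inner_on I (c *\<^sub>R h - c *\<^sub>R proj h) (c *\<^sub>R proj h) = 0"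
    using proj_orthogonal[of h] by (simp add: * inner_on_simps)
  fix v assume "v \<in> C"
  then show "inner_on I (c *\<^sub>R h - c *\<^sub>R proj h) v \<le> 0"
    using inner_le_proj[of v h] c unfolding * by (intro mult_nonneg_nonpos) (simp_all add: inner_on_simps)
qed

lemma proj_sq_scaleR: "0 \<le> c \<Longrightarrow> proj_sq (c *\<^sub>R h) = c\<^sup>2 * proj_sq h"
  by (simp add: proj_sq_def proj_scaleR L2_set_scaleR power_mult_distrib)

lemma proj_sq_le: "proj_sq h \<le> inner_on I h h"
proof -
  have "0 \<le> inner_on I (h - proj h) (h - proj h)" by simp
  then show ?thesis using proj_sq_eq[of h]
    by (simp add: inner_on_simps inner_on_commute proj_sq_def L2_set_sq)
qed

lemma proj_sq_cong: "(\<And>i. i \<in> I \<Longrightarrow> x i = y i) \<Longrightarrow> proj_sq x = proj_sq y"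
  unfolding proj_sq_def using proj_cong[of x y] by simp

lemma measurable_proj_sq:
  assumes "\<And>i. i \<in> I \<Longrightarrow> (\<lambda>\<omega>. f \<omega> i) \<in> borel_measurable N"
  shows "(\<lambda>\<omega>. proj_sq (f \<omega>)) \<in> borel_measurable N"
  unfolding proj_sq_def L2_set_def using measurable_proj[OF assms] by measurable

lemma stat_dim_eq: "stat_dim I C = (\<integral>h. proj_sq h \<partial>std_gaussian I)"
  by (simp add: stat_dim_def proj_sq_def closure_closed closedC)

end

section \<open>Restrictions and products of cones\<close>

lemma convex_cone_closure:
  fixes A :: "(nat \<Rightarrow> real) set"
  assumes "convex_cone A" shows "convex_cone (closure A)"
  unfolding convex_cone_iff
proof (intro conjI ballI allI impI)
  show "0 \<in> closure A" using assms closure_subset by (auto simp: convex_cone_iff)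
next
  fix x y assume xy: "x \<in> closure A" "y \<in> closure A"
  have "(\<lambda>p. fst p + snd p) ` closure (A \<times> A) \<subseteq> closure A"
  proof (rule image_closure_subset)
    show "continuous_on (closure (A \<times> A)) (\<lambda>p. fst p + snd p)" by (intro continuous_intros)
    show "(\<lambda>p. fst p + snd p) ` (A \<times> A) \<subseteq> closure A"
      using assms closure_subset by (force simp: convex_cone_iff)
  qed auto
  moreover have "(x, y) \<in> closure (A \<times> A)" using xy by (simp add: closure_Times)
  ultimately show "x + y \<in> closure A" by force
next
  fix x and c :: real assume x: "x \<in> closure A" and c: "0 \<le> c"
  have "(\<lambda>p. c *\<^sub>R p) ` closure A \<subseteq> closure A"
  proof (rule image_closure_subset)
    show "continuous_on (closure A) (\<lambda>p. c *\<^sub>R p)" by (intro continuous_intros)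
    show "(\<lambda>p. c *\<^sub>R p) ` A \<subseteq> closure A"
      using assms closure_subset c by (force simp: convex_cone_iff)
  qed auto
  then show "c *\<^sub>R x \<in> closure A" using x by blast
qed

lemma coord_restrict_simps:
  "coord_restrict B (x + y) = coord_restrict B x + coord_restrict B y"
  "coord_restrict B (x - y) = coord_restrict B x - coord_restrict B y"
  "coord_restrict B (c *\<^sub>R x) = c *\<^sub>R coord_restrict B x"
  "coord_restrict B 0 = 0"
  by (auto simp: coord_restrict_def fun_eq_iff)

lemma coord_restrict_in: "coord_restrict B x \<in> coord_space B"
  by (simp add: coord_restrict_def coord_space_def)

lemma inner_on_coord_restrict:
  "inner_on B (coord_restrict B x) y = inner_on B x y"
  "inner_on B y (coord_restrict B x) = inner_on B y x"
  by (simp_all add: inner_on_def coord_restrict_def)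

lemma closed_cone_onI:
  assumes "finite I" "C \<subseteq> coord_space I" "closed C" "convex_cone C"
  shows "closed_cone_on I C"
  using assms by unfold_locales (auto simp: convex_cone_def)

text \<open>A coordinate projection of a closed cone need not be closed, hence the closure;
  \<open>stat_dim\<close> takes the closure itself and does not see the difference.\<close>

lemma closed_cone_on_restrict_closure:
  assumes "finite B" "convex_cone K"
  shows "closed_cone_on B (closure (coord_restrict B ` K))"
proof (rule closed_cone_onI)
  show "closure (coord_restrict B ` K) \<subseteq> coord_space B"
    by (intro closure_minimal closed_coord_space) (auto simp: coord_restrict_in)
  have "convex_cone (coord_restrict B ` K)"
    using assms(2) unfolding convex_cone_iff
    by (auto simp flip: coord_restrict_simps intro: image_eqI[where x = 0])
  then show "convex_cone (closure (coord_restrict B ` K))" by (rule convex_cone_closure)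
qed (use assms in auto)

definition product_cone :: "nat set \<Rightarrow> nat set set \<Rightarrow> (nat set \<Rightarrow> (nat \<Rightarrow> real) set) \<Rightarrow> (nat \<Rightarrow> real) set"
  where "product_cone I S C = {v \<in> coord_space I. \<forall>B\<in>S. coord_restrict B v \<in> C B}"

lemma inner_on_partition:
  assumes "finite I" "partition_on I S"
  shows "inner_on I x y = (\<Sum>B\<in>S. inner_on B x y)"
proof -
  have S: "\<And>B. B \<in> S \<Longrightarrow> finite B" "\<Union>S = I" "disjoint S"
    using assms by (auto simp: partition_on_def intro: finite_subset[OF Union_upper])
  have "sum (\<lambda>i. x i * y i) (\<Union>S) = (sum \<circ> sum) (\<lambda>i. x i * y i) S"
    by (rule sum.Union_disjoint) (use S in \<open>auto simp: disjoint_def\<close>)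
  then show ?thesis by (simp add: inner_on_def S)
qed

lemma closed_cone_on_product:
  assumes "finite I" "partition_on I S" "\<And>B. B \<in> S \<Longrightarrow> closed_cone_on B (C B)"
  shows "closed_cone_on I (product_cone I S C)"
proof (rule closed_cone_onI)
  show "product_cone I S C \<subseteq> coord_space I" by (auto simp: product_cone_def)
  have "closed (coord_space I \<inter> (\<Inter>B\<in>S. coord_restrict B -` C B))"
  proof (intro closed_Int closed_INT ballI closed_coord_space closed_vimage)
    fix B assume "B \<in> S"
    then show "closed (C B)" using assms(3) closed_cone_on.axioms(1) closed_convex_on.closedC by blast
    show "continuous_on UNIV (coord_restrict B)"
      using continuous_coord_restrict[OF continuous_on_id] by simp
  qed
  also have "coord_space I \<inter> (\<Inter>B\<in>S. coord_restrict B -` C B) = product_cone I S C"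
    by (auto simp: product_cone_def)
  finally show "closed (product_cone I S C)" .
  have "convex_cone (C B)" if "B \<in> S" for B
    using assms(3)[OF that] by (simp add: closed_cone_on.coneC)
  then show "convex_cone (product_cone I S C)"
    unfolding convex_cone_iff product_cone_def
    by (auto simp: coord_restrict_simps coord_space_convex)
qed fact

lemma proj_sq_product:
  assumes "finite I" "partition_on I S" "\<And>B. B \<in> S \<Longrightarrow> closed_cone_on B (C B)"
  shows "closed_cone_on.proj_sq I (product_cone I S C) h
    = (\<Sum>B\<in>S. closed_cone_on.proj_sq B (C B) h)"
proof -
  interpret P: closed_cone_on I "product_cone I S C" by (rule closed_cone_on_product) fact+
  have S: "finite S" "\<And>B. B \<in> S \<Longrightarrow> finite B" "\<Union>S = I" "disjoint S"
    using assms(1,2) by (auto simp: partition_on_def intro: finite_subset[OF Union_upper] finite_UnionD)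
  \<comment> \<open>Each block projection vanishes off its block, so the sum glues them together.
    Both conditions of \<open>cone_proj_eqI\<close> split over the blocks.\<close>
  define q where "q = (\<lambda>i. \<Sum>B\<in>S. metric_proj B (C B) h i)"
  have pz: "metric_proj B (C B) h i = 0" if "B \<in> S" "i \<notin> B" for B i
  proof -
    interpret closed_cone_on B "C B" by (rule assms(3)) fact
    show ?thesis using proj_in_coord_space[of h] that by (simp add: coord_space_def)
  qed
  have qB: "q i = metric_proj B (C B) h i" if "B \<in> S" "i \<in> B" for B i
  proof -
    have "q i = (\<Sum>B'\<in>{B}. metric_proj B' (C B') h i)"
      unfolding q_def
    proof (rule sum.mono_neutral_right)
      show "\<forall>B'\<in>S - {B}. metric_proj B' (C B') h i = 0"
        using S(4) that by (auto intro!: pz simp: disjoint_def)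
    qed (use S that in auto)
    then show ?thesis by simp
  qed
  have qr: "coord_restrict B q = metric_proj B (C B) h" if "B \<in> S" for B
    using qB[OF that] pz[OF that] by (auto simp: coord_restrict_def)
  have qI: "inner_on B q v = inner_on B (metric_proj B (C B) h) v"
    "inner_on B v q = inner_on B v (metric_proj B (C B) h)" if "B \<in> S" for B v
    using qB[OF that] by (auto simp: inner_on_def)
  have "P.proj h = q"
  proof (rule P.cone_proj_eqI)
    have "q i = 0" if "i \<notin> I" for i
      unfolding q_def using that S(3) by (intro sum.neutral ballI pz) auto
    moreover have "metric_proj B (C B) h \<in> C B" if "B \<in> S" for B
      using closed_convex_on.proj_in closed_cone_on.axioms(1) assms(3)[OF that] by blast
    ultimately show "q \<in> product_cone I S C"
      by (auto simp: product_cone_def coord_space_def qr)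
    show "inner_on I (h - q) q = 0"
      unfolding inner_on_partition[OF assms(1,2)]
    proof (intro sum.neutral ballI)
      fix B assume B: "B \<in> S"
      interpret closed_cone_on B "C B" by (rule assms(3)) fact
      show "inner_on B (h - q) q = 0"
        using proj_orthogonal[of h] by (simp only: inner_on_simps qI[OF B])
    qed
    fix v assume v: "v \<in> product_cone I S C"
    show "inner_on I (h - q) v \<le> 0"
      unfolding inner_on_partition[OF assms(1,2)]
    proof (intro sum_nonpos)
      fix B assume B: "B \<in> S"
      interpret closed_cone_on B "C B" by (rule assms(3)) fact
      show "inner_on B (h - q) v \<le> 0"
      proof -
        have "coord_restrict B v \<in> C B" using v B by (simp add: product_cone_def)
        from inner_le_proj[OF this, of h] have "inner_on B h v \<le> inner_on B (metric_proj B (C B) h) v"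
          by (simp only: inner_on_coord_restrict)
        then show ?thesis by (simp only: inner_on_simps qI(1)[OF B])
      qed
    qed
  qed
  then have "P.proj_sq h = (\<Sum>B\<in>S. inner_on B q q)"
    by (simp add: P.proj_sq_def L2_set_sq inner_on_partition[OF assms(1,2)])
  also have "\<dots> = (\<Sum>B\<in>S. closed_cone_on.proj_sq B (C B) h)"
  proof (intro sum.cong refl)
    fix B assume B: "B \<in> S"
    interpret closed_cone_on B "C B" by (rule assms(3)) fact
    show "inner_on B q q = proj_sq h" by (simp only: proj_sq_def L2_set_sq qI[OF B])
  qed
  finally show ?thesis .
qed

section \<open>Gaussian product measures\<close>

lemma distr_PiM_map:
  assumes fin: "finite I" and M: "\<And>i. prob_space (M i)" and f: "\<And>i. f i \<in> measurable (M i) (N i)"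
  shows "distr (PiM I M) (PiM I N) (\<lambda>x. \<lambda>i\<in>I. f i (x i)) = PiM I (\<lambda>i. distr (M i) (N i) (f i))"
proof -
  note f[measurable]
  interpret M: product_prob_space M I by (rule product_prob_spaceI) (rule M)
  interpret D: product_prob_space "\<lambda>i. distr (M i) (N i) (f i)" I
    by (rule product_prob_spaceI) (rule prob_space.prob_space_distr[OF M f])
  have sets_eq: "sets (PiM I (\<lambda>i. distr (M i) (N i) (f i))) = sets (PiM I N)"
    by (intro sets_PiM_cong) auto
  have meas: "(\<lambda>x. \<lambda>i\<in>I. f i (x i)) \<in> measurable (PiM I M) (PiM I N)" by measurable
  show ?thesis
  proof (rule D.PiM_eqI[OF fin])
    show "sets (distr (PiM I M) (PiM I N) (\<lambda>x. \<lambda>i\<in>I. f i (x i))) = sets (PiM I (\<lambda>i. distr (M i) (N i) (f i)))"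
      by (simp add: sets_eq)
    fix A assume A: "\<And>i. i \<in> I \<Longrightarrow> A i \<in> sets (distr (M i) (N i) (f i))"
    then have A': "\<And>i. i \<in> I \<Longrightarrow> A i \<in> sets (N i)" by simp
    have "(\<lambda>x. \<lambda>i\<in>I. f i (x i)) -` Pi\<^sub>E I A \<inter> space (PiM I M)
        = Pi\<^sub>E I (\<lambda>i. f i -` A i \<inter> space (M i))"
      by (auto simp: space_PiM PiE_iff extensional_def)
    then have "emeasure (distr (PiM I M) (PiM I N) (\<lambda>x. \<lambda>i\<in>I. f i (x i))) (Pi\<^sub>E I A)
        = emeasure (PiM I M) (Pi\<^sub>E I (\<lambda>i. f i -` A i \<inter> space (M i)))"
      using A' fin meas by (subst emeasure_distr) (auto intro!: sets_PiM_I_finite)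
    also have "\<dots> = (\<Prod>i\<in>I. emeasure (M i) (f i -` A i \<inter> space (M i)))"
      using A' f by (intro M.emeasure_PiM fin) (auto intro: measurable_sets)
    also have "\<dots> = (\<Prod>i\<in>I. emeasure (distr (M i) (N i) (f i)) (A i))"
      using A' f by (intro prod.cong refl) (simp add: emeasure_distr)
    finally show "emeasure (distr (PiM I M) (PiM I N) (\<lambda>x. \<lambda>i\<in>I. f i (x i))) (Pi\<^sub>E I A)
        = (\<Prod>i\<in>I. emeasure (distr (M i) (N i) (f i)) (A i))" .
  qed
qed

text \<open>Passes between vectors of pairs and pairs of vectors, so that a map acting on each
  coordinate pair separately, a rotation or an exchange of two samples, can be studied factor by
  factor. The two laws agree on products of rectangles, a generator stable under
  intersection.\<close>

lemma distr_PiM_pair: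
  assumes fin: "finite I" and Q: "prob_space Q1" "prob_space Q2"
  shows "distr (PiM I (\<lambda>_. Q1 \<Otimes>\<^sub>M Q2)) (PiM I (\<lambda>_. Q1) \<Otimes>\<^sub>M PiM I (\<lambda>_. Q2))
      (\<lambda>x. (\<lambda>i\<in>I. fst (x i), \<lambda>i\<in>I. snd (x i))) = PiM I (\<lambda>_. Q1) \<Otimes>\<^sub>M PiM I (\<lambda>_. Q2)"
    (is "distr ?P ?R ?f = ?R")
proof -
  interpret Q1: prob_space Q1 by fact
  interpret Q2: prob_space Q2 by fact
  interpret Q: pair_prob_space Q1 Q2 ..
  interpret P: product_prob_space "\<lambda>_. Q1 \<Otimes>\<^sub>M Q2" I by (rule product_prob_spaceI) unfold_locales
  interpret P1: product_prob_space "\<lambda>_. Q1" I by (rule product_prob_spaceI) unfold_locales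
  interpret P2: product_prob_space "\<lambda>_. Q2" I by (rule product_prob_spaceI) unfold_locales
  have sf2: "sigma_finite_measure (PiM I (\<lambda>_. Q2))" by (intro prob_space_imp_sigma_finite prob_space_PiM Q)
  have meas: "?f \<in> measurable ?P ?R" by measurable
  let ?E1 = "prod_algebra I (\<lambda>_. Q1)" and ?E2 = "prod_algebra I (\<lambda>_. Q2)"
  let ?E = "{a \<times> b | a b. a \<in> ?E1 \<and> b \<in> ?E2}"
  have sub: "?E1 \<subseteq> Pow (space (PiM I (\<lambda>_. Q1)))" "?E2 \<subseteq> Pow (space (PiM I (\<lambda>_. Q2)))"
    using prod_algebra_sets_into_space[of I "\<lambda>_. Q1"] prod_algebra_sets_into_space[of I "\<lambda>_. Q2"]
    by (simp_all add: space_PiM)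
  have top: "space (PiM I (\<lambda>_. Q1)) \<in> ?E1" "space (PiM I (\<lambda>_. Q2)) \<in> ?E2"
    by (auto simp: prod_algebra_eq_finite[OF fin] space_PiM)
  have "sets ?R = sets (sigma (space (PiM I (\<lambda>_. Q1)) \<times> space (PiM I (\<lambda>_. Q2))) ?E)"
    by (rule sets_pair_eq[where Ca = "{space (PiM I (\<lambda>_. Q1))}" and Cb = "{space (PiM I (\<lambda>_. Q2))}"])
       (use sub top in \<open>auto simp: sets_PiM space_PiM\<close>)
  moreover have subE: "?E \<subseteq> Pow (space ?R)" using sub by (auto simp: space_pair_measure)
  ultimately have setsR: "sets ?R = sigma_sets (space ?R) ?E"
    by (simp add: space_pair_measure)
  show ?thesis
  proof (rule measure_eqI_generator_eq[where E = ?E and \<Omega> = "space ?R" and A = "\<lambda>_. space ?R"])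
    show "Int_stable ?E"
    proof (rule Int_stableI)
      fix x y assume "x \<in> ?E" "y \<in> ?E"
      then obtain a b a' b' where x: "x = a \<times> b" "a \<in> ?E1" "b \<in> ?E2"
        and y: "y = a' \<times> b'" "a' \<in> ?E1" "b' \<in> ?E2" by blast
      have "x \<inter> y = (a \<inter> a') \<times> (b \<inter> b')" by (simp add: x y Times_Int_Times)
      moreover have "a \<inter> a' \<in> ?E1" "b \<inter> b' \<in> ?E2"
        by (rule Int_stableD[OF Int_stable_prod_algebra]; fact)+
      ultimately show "x \<inter> y \<in> ?E" by blast
    qed
    show "range (\<lambda>_. space ?R) \<subseteq> ?E" using top by (auto simp: space_pair_measure)
    show "emeasure (distr ?P ?R ?f) (space ?R) \<noteq> \<infinity>"
      using prob_space.emeasure_le_1[OF P.prob_space_distr[OF meas], of "space ?R"]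
      by (auto simp: top_unique)
    fix X assume "X \<in> ?E"
    then obtain A B where X: "X = Pi\<^sub>E I A \<times> Pi\<^sub>E I B"
      and A: "\<And>i. i \<in> I \<Longrightarrow> A i \<in> sets Q1" and B: "\<And>i. i \<in> I \<Longrightarrow> B i \<in> sets Q2"
      by (auto simp: prod_algebra_eq_finite[OF fin])
    have XR: "X \<in> sets ?R" using X A B fin by (auto intro!: sets_PiM_I_finite)
    have "?f -` X \<inter> space ?P = Pi\<^sub>E I (\<lambda>i. A i \<times> B i)"
    proof (intro set_eqI iffI)
      fix x assume "x \<in> ?f -` X \<inter> space ?P"
      then show "x \<in> Pi\<^sub>E I (\<lambda>i. A i \<times> B i)"
        by (simp add: X space_PiM PiE_iff mem_Times_iff)
    next
      fix x assume x: "x \<in> Pi\<^sub>E I (\<lambda>i. A i \<times> B i)"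
      have "x i \<in> space (Q1 \<Otimes>\<^sub>M Q2)" if "i \<in> I" for i
        using PiE_mem[OF x that] A[OF that, THEN sets.sets_into_space] B[OF that, THEN sets.sets_into_space]
        by (auto simp: space_pair_measure mem_Times_iff)
      with x show "x \<in> ?f -` X \<inter> space ?P"
        by (simp add: X space_PiM PiE_iff mem_Times_iff)
    qed
    then have "emeasure (distr ?P ?R ?f) X = emeasure ?P (Pi\<^sub>E I (\<lambda>i. A i \<times> B i))"
      using XR meas by (simp add: emeasure_distr)
    also have "\<dots> = (\<Prod>i\<in>I. emeasure Q1 (A i) * emeasure Q2 (B i))"
      using A B by (subst P.emeasure_PiM[OF fin]) (auto simp: Q2.emeasure_pair_measure_Times)
    also have "\<dots> = emeasure (PiM I (\<lambda>_. Q1)) (Pi\<^sub>E I A) * emeasure (PiM I (\<lambda>_. Q2)) (Pi\<^sub>E I B)"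
      using A B by (simp add: P1.emeasure_PiM[OF fin] P2.emeasure_PiM[OF fin] prod.distrib)
    also have "\<dots> = emeasure ?R X"
      using A B fin by (simp add: X sigma_finite_measure.emeasure_pair_measure_Times[OF sf2] sets_PiM_I_finite)
    finally show "emeasure (distr ?P ?R ?f) X = emeasure ?R X" .
  qed (use setsR subE in auto)
qed

section \<open>The standard normal law in one and two dimensions\<close>

definition gauss1 :: "real measure"
  where "gauss1 = density lborel std_normal_density"

lemma std_gaussian_eq: "std_gaussian I = PiM I (\<lambda>_. gauss1)"
  by (simp add: std_gaussian_def gauss1_def)

lemma prob_space_gauss1: "prob_space gauss1"
  unfolding gauss1_def by (rule prob_space_normal_density) simp

lemma sets_gauss1 [measurable_cong, simp]: "sets gauss1 = sets borel"
  by (simp add: gauss1_def)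

lemma space_gauss1 [simp]: "space gauss1 = UNIV"
  by (simp add: gauss1_def)

lemma prob_space_std_gaussian: "prob_space (std_gaussian I)"
  unfolding std_gaussian_eq by (intro prob_space_PiM prob_space_gauss1)

definition rot :: "real \<Rightarrow> real \<times> real \<Rightarrow> real \<times> real"
  where "rot t = (\<lambda>(x, y). (cos t * x + sin t * y, cos t * y - sin t * x))"

lemma measurable_rot [measurable]: "rot t \<in> measurable (borel \<Otimes>\<^sub>M borel) (borel \<Otimes>\<^sub>M borel)"
  unfolding rot_def by measurable

text \<open>The rotation is performed as two one-dimensional affine substitutions: x is replaced by
  \<open>u = cos t * x + sin t * y\<close> at fixed y, then, after Fubini, y by
  \<open>v = (y - sin t * u) / cos t\<close> at fixed u. \<open>k\<close> is the integrand in the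
  mixed coordinates (u, y). The Jacobian factors \<open>1 / |cos t|\<close> and
  \<open>|cos t|\<close> cancel.\<close>

lemma nn_integral_lborel_rot:
  assumes [measurable]: "H \<in> borel_measurable (borel \<Otimes>\<^sub>M borel)" and c: "cos t \<noteq> 0"
  shows "(\<integral>\<^sup>+p. H (rot t p) \<partial>(lborel \<Otimes>\<^sub>M lborel)) = (\<integral>\<^sup>+p. H p \<partial>(lborel \<Otimes>\<^sub>M lborel))"
proof -
  define k where "k = (\<lambda>u y. H (u, (y - sin t * u) / cos t))"
  have [measurable]: "(\<lambda>(u, y). k u y) \<in> borel_measurable (borel \<Otimes>\<^sub>M borel)"
    unfolding k_def by measurable
  have [measurable]: "k u \<in> borel_measurable borel" for u unfolding k_def by measurable
  have [measurable]: "(\<lambda>u. k u y) \<in> borel_measurable borel" for y unfolding k_def by measurable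
  have sc: "sin t * sin t = 1 - cos t * cos t"
    using sin_cos_squared_add[of t] by (simp add: power2_eq_square algebra_simps)
  have rot_k: "H (rot t (x, y)) = k (sin t * y + cos t * x) y" for x y
  proof -
    have "y - sin t * (sin t * y + cos t * x) = cos t * (cos t * y - sin t * x)"
      using sc by algebra
    then show ?thesis using c by (simp add: k_def rot_def add.commute)
  qed
  have ac: "ennreal \<bar>1 / cos t\<bar> * ennreal \<bar>cos t\<bar> = 1"
    using c by (simp flip: ennreal_mult abs_mult)
  have "(\<integral>\<^sup>+p. H (rot t p) \<partial>(lborel \<Otimes>\<^sub>M lborel)) = (\<integral>\<^sup>+y. \<integral>\<^sup>+x. H (rot t (x, y)) \<partial>lborel \<partial>lborel)"
    by (subst lborel_pair.nn_integral_snd[symmetric]) (simp_all add: case_prod_unfold)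
  also have "\<dots> = (\<integral>\<^sup>+y. \<bar>1 / cos t\<bar> * (\<integral>\<^sup>+u. k u y \<partial>lborel) \<partial>lborel)"
  proof (intro nn_integral_cong)
    fix y
    have "(\<integral>\<^sup>+u. k u y \<partial>lborel) = \<bar>cos t\<bar> * (\<integral>\<^sup>+x. k (sin t * y + cos t * x) y \<partial>lborel)"
      by (rule nn_integral_real_affine) (use c in auto)
    then have "\<bar>1 / cos t\<bar> * (\<integral>\<^sup>+u. k u y \<partial>lborel)
        = (ennreal \<bar>1 / cos t\<bar> * ennreal \<bar>cos t\<bar>) * (\<integral>\<^sup>+x. H (rot t (x, y)) \<partial>lborel)"
      by (simp add: rot_k mult.assoc)
    then show "(\<integral>\<^sup>+x. H (rot t (x, y)) \<partial>lborel) = \<bar>1 / cos t\<bar> * (\<integral>\<^sup>+u. k u y \<partial>lborel)"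
      by (simp only: ac mult_1)
  qed
  also have "\<dots> = \<bar>1 / cos t\<bar> * (\<integral>\<^sup>+y. \<integral>\<^sup>+u. k u y \<partial>lborel \<partial>lborel)"
    by (rule nn_integral_cmult) measurable
  also have "(\<integral>\<^sup>+y. \<integral>\<^sup>+u. k u y \<partial>lborel \<partial>lborel) = (\<integral>\<^sup>+u. \<integral>\<^sup>+y. k u y \<partial>lborel \<partial>lborel)"
    by (rule lborel_pair.Fubini') measurable
  also have "\<dots> = (\<integral>\<^sup>+u. \<bar>cos t\<bar> * (\<integral>\<^sup>+v. H (u, v) \<partial>lborel) \<partial>lborel)"
  proof (intro nn_integral_cong)
    fix u
    have "(\<integral>\<^sup>+y. k u y \<partial>lborel) = \<bar>cos t\<bar> * (\<integral>\<^sup>+v. k u (sin t * u + cos t * v) \<partial>lborel)"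
      by (rule nn_integral_real_affine) (use c in auto)
    then show "(\<integral>\<^sup>+y. k u y \<partial>lborel) = \<bar>cos t\<bar> * (\<integral>\<^sup>+v. H (u, v) \<partial>lborel)"
      using c by (simp add: k_def)
  qed
  also have "\<dots> = \<bar>cos t\<bar> * (\<integral>\<^sup>+u. \<integral>\<^sup>+v. H (u, v) \<partial>lborel \<partial>lborel)"
    by (rule nn_integral_cmult) measurable
  also have "(\<integral>\<^sup>+u. \<integral>\<^sup>+v. H (u, v) \<partial>lborel \<partial>lborel) = (\<integral>\<^sup>+p. H p \<partial>(lborel \<Otimes>\<^sub>M lborel))"
    by (rule lborel.nn_integral_fst) simp
  also have "ennreal \<bar>1 / cos t\<bar> * (ennreal \<bar>cos t\<bar> * (\<integral>\<^sup>+p. H p \<partial>(lborel \<Otimes>\<^sub>M lborel)))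
      = (\<integral>\<^sup>+p. H p \<partial>(lborel \<Otimes>\<^sub>M lborel))"
    by (simp only: mult.assoc[symmetric] ac mult_1)
  finally show ?thesis .
qed

lemma gauss1_pair_density:
  "gauss1 \<Otimes>\<^sub>M gauss1
    = density (lborel \<Otimes>\<^sub>M lborel) (\<lambda>p. ennreal (exp (- ((fst p)\<^sup>2 + (snd p)\<^sup>2) / 2) / (2 * pi)))"
proof -
  have "gauss1 \<Otimes>\<^sub>M gauss1 = density (lborel \<Otimes>\<^sub>M lborel) (\<lambda>(x, y). ennreal (std_normal_density x) * ennreal (std_normal_density y))"
    unfolding gauss1_def
    by (rule pair_measure_density) (use prob_space_gauss1 in \<open>auto simp: gauss1_def prob_space_imp_sigma_finite\<close>,
        unfold_locales)
  also have "(\<lambda>(x, y). ennreal (std_normal_density x) * ennreal (std_normal_density y))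
      = (\<lambda>p. ennreal (exp (- ((fst p)\<^sup>2 + (snd p)\<^sup>2) / 2) / (2 * pi)))"
  proof -
    have "sqrt 2 * sqrt pi * (sqrt 2 * sqrt pi) = (sqrt 2 * sqrt 2) * (sqrt pi * sqrt pi)"
      by (simp only: mult_ac)
    then have "sqrt 2 * sqrt pi * (sqrt 2 * sqrt pi) = 2 * pi" by simp
    then show ?thesis
      by (auto simp: fun_eq_iff std_normal_density_def ennreal_mult[symmetric] real_sqrt_mult
        mult_exp_exp add_divide_distrib diff_divide_distrib split: prod.split)
  qed
  finally show ?thesis .
qed

lemma distr_gauss1_rot:
  assumes "cos t \<noteq> 0"
  shows "distr (gauss1 \<Otimes>\<^sub>M gauss1) (gauss1 \<Otimes>\<^sub>M gauss1) (rot t) = gauss1 \<Otimes>\<^sub>M gauss1"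
proof (rule measure_eqI)
  fix A assume "A \<in> sets (distr (gauss1 \<Otimes>\<^sub>M gauss1) (gauss1 \<Otimes>\<^sub>M gauss1) (rot t))"
  then have A: "A \<in> sets (gauss1 \<Otimes>\<^sub>M gauss1)" by simp
  have sets_eq: "sets (gauss1 \<Otimes>\<^sub>M gauss1) = sets (borel \<Otimes>\<^sub>M borel)"
    by (rule sets_pair_measure_cong) simp_all
  have A' [measurable]: "A \<in> sets (borel \<Otimes>\<^sub>M borel)" using A sets_eq by simp
  have [measurable]: "rot t \<in> measurable (gauss1 \<Otimes>\<^sub>M gauss1) (gauss1 \<Otimes>\<^sub>M gauss1)"
    using measurable_rot by (simp cong: measurable_cong_sets add: sets_eq)
  define f where "f = (\<lambda>p :: real \<times> real. ennreal (exp (- ((fst p)\<^sup>2 + (snd p)\<^sup>2) / 2) / (2 * pi)))"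
  have [measurable]: "f \<in> borel_measurable (borel \<Otimes>\<^sub>M borel)" unfolding f_def by measurable
  have f_rot: "f (rot t p) = f p" for p
  proof -
    obtain x y where p: "p = (x, y)" by (cases p)
    have "(cos t * x + sin t * y)\<^sup>2 + (cos t * y - sin t * x)\<^sup>2 = ((sin t)\<^sup>2 + (cos t)\<^sup>2) * (x\<^sup>2 + y\<^sup>2)"
      by (simp only: power2_eq_square) (simp only: algebra_simps)
    then show ?thesis by (simp add: f_def rot_def p)
  qed
  have space: "space (gauss1 \<Otimes>\<^sub>M gauss1) = UNIV" by (simp add: space_pair_measure)
  have "emeasure (distr (gauss1 \<Otimes>\<^sub>M gauss1) (gauss1 \<Otimes>\<^sub>M gauss1) (rot t)) A
      = (\<integral>\<^sup>+p. indicator A (rot t p) \<partial>(gauss1 \<Otimes>\<^sub>M gauss1))"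
    using A by (simp add: nn_integral_distr flip: nn_integral_indicator)
  also have "\<dots> = (\<integral>\<^sup>+p. f (rot t p) * indicator A (rot t p) \<partial>(lborel \<Otimes>\<^sub>M lborel))"
    unfolding gauss1_pair_density f_def[symmetric] f_rot by (rule nn_integral_density) measurable
  also have "\<dots> = (\<integral>\<^sup>+p. f p * indicator A p \<partial>(lborel \<Otimes>\<^sub>M lborel))"
    by (rule nn_integral_lborel_rot[where H = "\<lambda>p. f p * indicator A p"]) (use assms in measurable)
  also have "\<dots> = (\<integral>\<^sup>+p. indicator A p \<partial>(gauss1 \<Otimes>\<^sub>M gauss1))"
    unfolding gauss1_pair_density f_def[symmetric] by (rule nn_integral_density[symmetric]) measurable
  also have "\<dots> = emeasure (gauss1 \<Otimes>\<^sub>M gauss1) A" using A by simp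
  finally show "emeasure (distr (gauss1 \<Otimes>\<^sub>M gauss1) (gauss1 \<Otimes>\<^sub>M gauss1) (rot t)) A
      = emeasure (gauss1 \<Otimes>\<^sub>M gauss1) A" .
qed simp

lemma gauss1_moments:
  "integrable gauss1 (\<lambda>x. x ^ k)" "(\<integral>x. x \<partial>gauss1) = 0" "(\<integral>x. x\<^sup>2 \<partial>gauss1) = 1"
proof -
  show "integrable gauss1 (\<lambda>x. x ^ k)"
    using integrable_std_normal_moment[of k] unfolding gauss1_def by (subst integrable_density) auto
  show "(\<integral>x. x \<partial>gauss1) = 0"
    using integral_std_normal_moment_odd[of 0] unfolding gauss1_def by (subst integral_density) auto
  show "(\<integral>x. x\<^sup>2 \<partial>gauss1) = 1"
    using integral_std_normal_moment_even[of 1] unfolding gauss1_def by (subst integral_density) auto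
qed

text \<open>The pushforward form still makes sense at scale zero, where no density exists; the later
  laws of linear combinations are stated in that form for this reason.\<close>

lemma distributed_normal_iff_distr:
  assumes "prob_space M" "0 < s"
  shows "distributed M lborel Z (normal_density 0 s) \<longleftrightarrow>
    Z \<in> borel_measurable M \<and> distr M borel Z = distr gauss1 borel (\<lambda>x. s * x)"
proof -
  interpret prob_space M by fact
  interpret G: prob_space gauss1 by (rule prob_space_gauss1)
  have "distr gauss1 lborel (\<lambda>x. x) = density lborel std_normal_density"
    unfolding gauss1_def[symmetric] by (rule distr_id2) simp
  then have "distributed gauss1 lborel (\<lambda>x. x) std_normal_density"
    by (simp add: distributed_def gauss1_def)
  from G.normal_density_affine[OF this, of s 0]
  have "distributed gauss1 lborel (\<lambda>x. s * x) (normal_density 0 s)" using assms by simp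
  then have "distr gauss1 lborel (\<lambda>x. s * x) = density lborel (normal_density 0 s)"
    by (simp add: distributed_def)
  then have "density lborel (normal_density 0 s) = distr gauss1 borel (\<lambda>x. s * x)"
    by (metis distr_cong sets_lborel)
  moreover have "distr M lborel Z = distr M borel Z" by (rule distr_cong) auto
  ultimately show ?thesis unfolding distributed_def by auto
qed

lemma (in prob_space) distr_normal_linear_comb:
  assumes fin: "finite J" and ind: "indep_vars (\<lambda>_. borel) Z J" and s: "0 < s"
    and dist: "\<And>j. j \<in> J \<Longrightarrow> distr M borel (Z j) = distr gauss1 borel (\<lambda>x. s * x)"
  shows "distr M borel (\<lambda>\<omega>. \<Sum>j\<in>J. v j * Z j \<omega>) = distr gauss1 borel (\<lambda>x. s * L2_set v J * x)"
proof -
  have rv: "Z j \<in> borel_measurable M" if "j \<in> J" for j using ind that by (auto simp: indep_vars_def)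
  \<comment> \<open>Zero coefficients are dropped because the sum rule for independent normals
    demands positive standard deviations. If none remain, both laws are the point mass at 0.\<close>
  define J' where "J' = {j \<in> J. v j \<noteq> 0}"
  have J': "finite J'" "J' \<subseteq> J" using fin by (auto simp: J'_def)
  have sum_eq: "(\<Sum>j\<in>J. v j * Z j \<omega>) = (\<Sum>j\<in>J'. v j * Z j \<omega>)" for \<omega>
    by (rule sum.mono_neutral_right) (use fin in \<open>auto simp: J'_def\<close>)
  have sq_eq: "(\<Sum>j\<in>J. (v j)\<^sup>2) = (\<Sum>j\<in>J'. (v j)\<^sup>2)"
    by (rule sum.mono_neutral_right) (use fin in \<open>auto simp: J'_def\<close>)
  show ?thesis
  proof (cases "J' = {}")
    case True
    interpret G: prob_space gauss1 by (rule prob_space_gauss1)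
    have "L2_set v J = 0" using sq_eq True by (simp add: L2_set_def)
    then show ?thesis using True
      by (simp add: sum_eq distr_const G.distr_const)
  next
    case False
    have indJ: "indep_vars (\<lambda>_. borel) (\<lambda>j \<omega>. v j * Z j \<omega>) J'"
      by (rule indep_vars_compose2[OF indep_vars_subset[OF ind J'(2)]]) measurable
    have "distributed M lborel (\<lambda>\<omega>. v j * Z j \<omega>) (normal_density 0 (\<bar>v j\<bar> * s))" if "j \<in> J'" for j
    proof -
      have "distributed M lborel (Z j) (normal_density 0 s)"
        using that J' rv dist distributed_normal_iff_distr[OF prob_space_axioms s] by auto
      from normal_density_affine[OF this s, of "v j" 0] that show ?thesis by (simp add: J'_def)
    qed
    from sum_indep_normal[OF J'(1) False indJ _ this]
    have "distributed M lborel (\<lambda>\<omega>. \<Sum>j\<in>J'. v j * Z j \<omega>)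
        (normal_density 0 (sqrt (\<Sum>j\<in>J'. (\<bar>v j\<bar> * s)\<^sup>2)))"
      using s by (simp add: J'_def)
    moreover have "sqrt (\<Sum>j\<in>J'. (\<bar>v j\<bar> * s)\<^sup>2) = s * L2_set v J"
      using s by (simp add: L2_set_def sq_eq power_mult_distrib sum_distrib_right[symmetric] real_sqrt_mult)
    moreover have "0 < s * L2_set v J"
    proof -
      have "0 < (\<Sum>j\<in>J'. (v j)\<^sup>2)" using False J' by (intro sum_pos) (auto simp: J'_def)
      then show ?thesis using s by (simp add: L2_set_def sq_eq)
    qed
    ultimately show ?thesis
      using distributed_normal_iff_distr[OF prob_space_axioms, of "s * L2_set v J"] by (simp add: sum_eq)
  qed
qed

lemma indep_vars_PiM_components:
  assumes "finite I" "\<And>i. prob_space (Q i)"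
  shows "prob_space.indep_vars (PiM I Q) Q (\<lambda>i x. x i) I"
proof -
  interpret P: prob_space "PiM I Q" using assms by (intro prob_space_PiM) auto
  show ?thesis
  proof (cases "I = {}")
    case True
    then show ?thesis unfolding P.indep_vars_def P.indep_sets_def by simp
  next
    case False
    have "distr (PiM I Q) (PiM I Q) (\<lambda>x. \<lambda>i\<in>I. x i) = distr (PiM I Q) (PiM I Q) (\<lambda>x. x)"
      by (rule distr_cong) (auto simp: space_PiM PiE_def extensional_restrict)
    also have "\<dots> = PiM I Q" by (rule distr_id2) simp
    also have "\<dots> = PiM I (\<lambda>i. distr (PiM I Q) (Q i) (\<lambda>x. x i))"
      by (rule PiM_cong) (auto simp: distr_PiM_component assms)
    finally show ?thesis
      using False by (subst P.indep_vars_iff_distr_eq_PiM') auto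
  qed
qed

section \<open>Concentration of the projection norm\<close>

lemma distr_std_gaussian_inner:
  assumes "finite I"
  shows "distr (std_gaussian I) borel (\<lambda>y. inner_on I v y) = distr gauss1 borel (\<lambda>x. L2_set v I * x)"
proof -
  interpret S: prob_space "std_gaussian I" by (rule prob_space_std_gaussian)
  have "S.indep_vars (\<lambda>_. gauss1) (\<lambda>i x. x i) I"
    unfolding std_gaussian_eq by (rule indep_vars_PiM_components) (use assms prob_space_gauss1 in auto)
  then have "S.indep_vars (\<lambda>_. borel) (\<lambda>i x. x i) I"
    by (rule S.indep_vars_compose2[where Y = "\<lambda>_ x. x"]) simp
  moreover have "distr (std_gaussian I) borel (\<lambda>x. x j) = distr gauss1 borel (\<lambda>x. 1 * x)" if "j \<in> I" for j
  proof -
    have "distr (std_gaussian I) borel (\<lambda>x. x j) = distr (PiM I (\<lambda>_. gauss1)) gauss1 (\<lambda>x. x j)"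
      unfolding std_gaussian_eq by (rule distr_cong) simp_all
    also have "\<dots> = gauss1" by (rule distr_PiM_component[OF prob_space_gauss1 that])
    also have "\<dots> = distr gauss1 borel (\<lambda>x. 1 * x)"
      by (simp add: distr_id2)
    finally show ?thesis .
  qed
  ultimately show ?thesis
    using S.distr_normal_linear_comb[OF assms, where Z = "\<lambda>i x. x i" and s = 1] by (simp add: inner_on_def)
qed

lemma measurable_std_gaussian_component:
  assumes "f \<in> measurable N (std_gaussian I)" "i \<in> I"
  shows "(\<lambda>x. f x i) \<in> borel_measurable N"
proof -
  have "(\<lambda>x. f x i) \<in> measurable N gauss1"
    using assms unfolding std_gaussian_eq by measurable
  then show ?thesis by (simp cong: measurable_cong_sets)
qed

lemma measurable_std_gaussian_coord:
  "i \<in> I \<Longrightarrow> (\<lambda>x. x i) \<in> borel_measurable (std_gaussian I)"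
  by (rule measurable_std_gaussian_component[where f = "\<lambda>x. x"]) simp_all

lemma measurable_inner_on:
  assumes "\<And>i. i \<in> I \<Longrightarrow> (\<lambda>x. f x i) \<in> borel_measurable N"
    and "\<And>i. i \<in> I \<Longrightarrow> (\<lambda>x. g x i) \<in> borel_measurable N"
  shows "(\<lambda>x. inner_on I (f x) (g x)) \<in> borel_measurable N"
  unfolding inner_on_def using assms by measurable

lemma integral_std_gaussian_inner:
  fixes \<phi> :: "real \<Rightarrow> real"
  assumes "finite I" and [measurable]: "\<phi> \<in> borel_measurable borel"
  shows "(\<integral>y. \<phi> (inner_on I v y) \<partial>std_gaussian I) = (\<integral>x. \<phi> (L2_set v I * x) \<partial>gauss1)" (is ?eq)
    and "integrable (std_gaussian I) (\<lambda>y. \<phi> (inner_on I v y)) \<longleftrightarrow> integrable gauss1 (\<lambda>x. \<phi> (L2_set v I * x))" (is ?int)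
proof -
  have [measurable]: "(\<lambda>y. inner_on I v y) \<in> borel_measurable (std_gaussian I)"
    by (rule measurable_inner_on) (auto intro: measurable_std_gaussian_component measurable_std_gaussian_coord)
  have "(\<integral>y. \<phi> (inner_on I v y) \<partial>std_gaussian I) = (\<integral>z. \<phi> z \<partial>distr (std_gaussian I) borel (\<lambda>y. inner_on I v y))"
    by (rule integral_distr[where f = \<phi> and g = "inner_on I v", symmetric]) measurable
  also have "\<dots> = (\<integral>x. \<phi> (L2_set v I * x) \<partial>gauss1)"
    unfolding distr_std_gaussian_inner[OF assms(1)] by (rule integral_distr) measurable
  finally show ?eq .
  have "integrable (std_gaussian I) (\<lambda>y. \<phi> (inner_on I v y))
      \<longleftrightarrow> integrable (distr (std_gaussian I) borel (\<lambda>y. inner_on I v y)) \<phi>"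
    by (rule integrable_distr_eq[symmetric]) measurable
  also have "\<dots> \<longleftrightarrow> integrable gauss1 (\<lambda>x. \<phi> (L2_set v I * x))"
    unfolding distr_std_gaussian_inner[OF assms(1)] by (rule integrable_distr_eq) measurable
  finally show ?int .
qed

lemma integral_std_gaussian_inner_sq:
  assumes "finite I"
  shows "(\<integral>y. (inner_on I v y)\<^sup>2 \<partial>std_gaussian I) = inner_on I v v"
  using integral_std_gaussian_inner(1)[OF assms, of "\<lambda>z. z\<^sup>2" v] gauss1_moments(3)
  by (simp add: power_mult_distrib L2_set_sq)

section \<open>Rotation invariance of Gaussian vectors\<close>

definition gauss_rot :: "nat set \<Rightarrow> real \<Rightarrow> (nat \<Rightarrow> real) \<times> (nat \<Rightarrow> real) \<Rightarrow> (nat \<Rightarrow> real) \<times> (nat \<Rightarrow> real)"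
  where "gauss_rot I t = (\<lambda>(a, b). (\<lambda>i\<in>I. cos t * a i + sin t * b i, \<lambda>i\<in>I. cos t * b i - sin t * a i))"

lemma measurable_gauss_rot [measurable]:
  "gauss_rot I t \<in> measurable (std_gaussian I \<Otimes>\<^sub>M std_gaussian I) (std_gaussian I \<Otimes>\<^sub>M std_gaussian I)"
proof -
  have "(\<lambda>p. \<lambda>i\<in>I. cos t * fst p i + sin t * snd p i) \<in> measurable (std_gaussian I \<Otimes>\<^sub>M std_gaussian I) (std_gaussian I)"
    "(\<lambda>p. \<lambda>i\<in>I. cos t * snd p i - sin t * fst p i) \<in> measurable (std_gaussian I \<Otimes>\<^sub>M std_gaussian I) (std_gaussian I)"
    unfolding std_gaussian_eq[of I] by (rule measurable_restrict; simp add: measurable_cong_sets[OF refl sets_gauss1]; measurable)+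
  then show ?thesis unfolding gauss_rot_def by (simp add: case_prod_unfold)
qed

text \<open>Read on vectors of pairs, the map rotates every pair by the same angle, and each factor
  is invariant by \<open>distr_gauss1_rot\<close>; \<open>pm\<close> translates the result back to
  pairs of vectors.\<close>

lemma distr_gauss_rot:
  assumes "finite I" "cos t \<noteq> 0"
  shows "distr (std_gaussian I \<Otimes>\<^sub>M std_gaussian I) (std_gaussian I \<Otimes>\<^sub>M std_gaussian I) (gauss_rot I t)
    = std_gaussian I \<Otimes>\<^sub>M std_gaussian I" (is "distr ?R ?R _ = ?R")
proof -
  interpret G: prob_space gauss1 by (rule prob_space_gauss1)
  interpret G2: pair_prob_space gauss1 gauss1 ..
  let ?Q = "gauss1 \<Otimes>\<^sub>M gauss1"
  define P where "P = PiM I (\<lambda>_. ?Q)"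
  define pm where "pm = (\<lambda>x :: nat \<Rightarrow> real \<times> real. (\<lambda>i\<in>I. fst (x i), \<lambda>i\<in>I. snd (x i)))"
  define rm where "rm = (\<lambda>x. \<lambda>i\<in>I. rot t (x i))"
  have rotm: "rot t \<in> measurable ?Q ?Q"
    using measurable_rot by (simp cong: measurable_cong_sets add: sets_pair_measure_cong[OF sets_gauss1 sets_gauss1])
  have pm_m [measurable]: "pm \<in> measurable P ?R"
    unfolding pm_def P_def std_gaussian_eq by measurable
  have rm_m [measurable]: "rm \<in> measurable P P"
    unfolding rm_def P_def using rotm by measurable
  have pmR: "distr P ?R pm = ?R"
    unfolding P_def pm_def std_gaussian_eq
    by (rule distr_PiM_pair) (use assms prob_space_gauss1 in auto)
  have rmP: "distr P P rm = P"
    unfolding P_def rm_def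
    by (subst distr_PiM_map) (use assms rotm G2.prob_space_axioms in \<open>auto simp: distr_gauss1_rot\<close>)
  have "distr ?R ?R (gauss_rot I t) = distr (distr P ?R pm) ?R (gauss_rot I t)"
    by (simp only: pmR)
  also have "\<dots> = distr P ?R (gauss_rot I t \<circ> pm)"
    by (rule distr_distr) measurable
  also have "gauss_rot I t \<circ> pm = pm \<circ> rm"
    by (auto simp: fun_eq_iff gauss_rot_def pm_def rm_def rot_def split_beta)
  also have "distr P ?R (pm \<circ> rm) = distr (distr P P rm) ?R pm"
    by (rule distr_distr[symmetric]) measurable
  also have "\<dots> = ?R" by (simp only: rmP pmR)
  finally show ?thesis .
qed

text \<open>The single dominating function behind the integrability claims of the variance bound.
  The square of the sum is at most \<open>card I\<close> times the sum of the squares, which leaves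
  fourth moments of single coordinates.\<close>

lemma integrable_std_gaussian_norm_sq_sq:
  assumes "finite I"
  shows "integrable (std_gaussian I \<Otimes>\<^sub>M std_gaussian I) (\<lambda>p. (inner_on I (fst p) (fst p) + inner_on I (snd p) (snd p))\<^sup>2)"
    (is "integrable ?R ?f")
proof -
  interpret S: prob_space "std_gaussian I" by (rule prob_space_std_gaussian)
  interpret R: pair_prob_space "std_gaussian I" "std_gaussian I" ..
  have comp: "integrable (std_gaussian I) (\<lambda>x. (x i) ^ 4)" if "i \<in> I" for i
  proof -
    have "integrable (distr (std_gaussian I) gauss1 (\<lambda>x. x i)) (\<lambda>x. x ^ 4)"
      unfolding std_gaussian_eq distr_PiM_component[OF prob_space_gauss1 that] by (rule gauss1_moments)
    moreover have "(\<lambda>x :: real. x ^ 4) \<in> borel_measurable gauss1"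
      by (subst measurable_cong_sets[OF sets_gauss1 refl]) measurable
    ultimately show ?thesis
      by (subst (asm) integrable_distr_eq) (use that in \<open>auto simp: std_gaussian_eq\<close>)
  qed
  have fst4: "integrable ?R (\<lambda>p. (fst p i) ^ 4)" if "i \<in> I" for i
  proof -
    have "integrable (distr ?R (std_gaussian I) fst) (\<lambda>x. (x i) ^ 4)"
      unfolding S.distr_pair_fst using comp that by simp
    moreover have "(\<lambda>x. (x i) ^ 4) \<in> borel_measurable (std_gaussian I)"
      by (intro borel_measurable_power measurable_std_gaussian_coord that)
    ultimately show ?thesis by (subst (asm) integrable_distr_eq) auto
  qed
  have snd4: "integrable ?R (\<lambda>p. (snd p i) ^ 4)" if "i \<in> I" for i
    using R.integrable_product_swap[OF fst4[OF that]] by (simp add: case_prod_unfold)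
  define g where "g = (\<lambda>p :: (nat \<Rightarrow> real) \<times> (nat \<Rightarrow> real). real (card I) * (\<Sum>i\<in>I. 2 * (fst p i) ^ 4 + 2 * (snd p i) ^ 4))"
  show ?thesis
  proof (rule Bochner_Integration.integrable_bound)
    show "integrable ?R g"
      unfolding g_def using fst4 snd4 by (intro integrable_mult_right integrable_sum integrable_add) auto
    have "(\<lambda>p. inner_on I (fst p) (fst p)) \<in> borel_measurable ?R" "(\<lambda>p. inner_on I (snd p) (snd p)) \<in> borel_measurable ?R"
      by (rule measurable_inner_on; rule measurable_std_gaussian_component; simp)+
    then show "?f \<in> borel_measurable ?R" by measurable
    show "AE p in ?R. norm (?f p) \<le> norm (g p)"
    proof (rule AE_I2)
      fix p :: "(nat \<Rightarrow> real) \<times> (nat \<Rightarrow> real)"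
      have "?f p = (\<Sum>i\<in>I. (fst p i)\<^sup>2 + (snd p i)\<^sup>2)\<^sup>2"
        by (simp add: inner_on_def sum.distrib power2_eq_square)
      also have "\<dots> \<le> (\<Sum>i\<in>I. ((fst p i)\<^sup>2 + (snd p i)\<^sup>2)\<^sup>2) * real (card I)"
        by (rule sum_squared_le_sum_of_squares)
      also have "\<dots> \<le> (\<Sum>i\<in>I. 2 * (fst p i) ^ 4 + 2 * (snd p i) ^ 4) * real (card I)"
      proof (intro mult_right_mono sum_mono)
        fix i
        have "0 \<le> ((fst p i)\<^sup>2 - (snd p i)\<^sup>2)\<^sup>2" by simp
        then show "((fst p i)\<^sup>2 + (snd p i)\<^sup>2)\<^sup>2 \<le> 2 * (fst p i) ^ 4 + 2 * (snd p i) ^ 4"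
          by (simp add: power2_eq_square power4_eq_xxxx algebra_simps)
      qed simp
      finally show "norm (?f p) \<le> norm (g p)" by (simp add: g_def mult.commute)
    qed
  qed
qed

section \<open>A Gaussian Poincare inequality for the squared projection norm\<close>

context closed_cone_on
begin

lemma measurable_proj_sq_std [measurable]: "proj_sq \<in> borel_measurable (std_gaussian I)"
  by (rule measurable_proj_sq) (auto intro: measurable_std_gaussian_component measurable_std_gaussian_coord)

text \<open>A rotation by the small angle h moves a by \<open>z\<close>. The first-order part of the
  change in \<open>proj_sq\<close> is \<open>2 * sin h * inner_on I (proj a) b\<close>, whose square
  doubled gives the 8; all the rest is at most \<open>5 * h\<^sup>2 * s\<close>, whose square
  doubled gives 50, rounded up to 100. Only the power \<open>h ^ 4\<close> matters later.\<close>

lemma proj_sq_increment_bound: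
  assumes h: "0 \<le> h" "h \<le> 1"
    and G: "\<And>i. i \<in> I \<Longrightarrow> y i = cos h * a i + sin h * b i"
  shows "(proj_sq a - proj_sq y)\<^sup>2 \<le> 8 * h\<^sup>2 * (inner_on I (proj a) b)\<^sup>2
    + 100 * h ^ 4 * (inner_on I a a + inner_on I b b)\<^sup>2"
proof -
  define s where "s = inner_on I a a + inner_on I b b"
  define z where "z = (cos h - 1) *\<^sub>R a + sin h *\<^sub>R b"
  define y' where "y' = a + z"
  have yy: "proj_sq y = proj_sq y'"
    by (rule proj_sq_cong) (simp add: y'_def z_def G algebra_simps)
  have s0: "0 \<le> s" "inner_on I a a \<le> s" by (auto simp: s_def)
  have sh: "0 \<le> sin h" "sin h \<le> h"
    using h pi_gt3 by (auto intro!: sin_ge_zero sin_x_le_x)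
  have "cos h = 1 - 2 * (sin (h / 2))\<^sup>2" using cos_double_sin[of "h / 2"] by simp
  moreover have "(sin (h / 2))\<^sup>2 \<le> (h / 2)\<^sup>2"
    using h pi_gt3 by (intro power_mono sin_x_le_x sin_ge_zero) auto
  ultimately have ch: "0 \<le> 1 - cos h" "1 - cos h \<le> h\<^sup>2 / 2"
    by (simp_all add: power_divide)
  have ch': "1 - cos h \<le> h" 
  proof -
    have "h\<^sup>2 \<le> h" using h by (simp add: power2_eq_square mult_left_le)
    then show ?thesis using ch h by linarith
  qed
  have "(1 - cos h)\<^sup>2 \<le> h\<^sup>2" "(sin h)\<^sup>2 \<le> h\<^sup>2" using ch ch' sh by (auto intro: power_mono)
  define r where "r = proj_sq y' - proj_sq a - 2 * inner_on I (proj a) z"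
  have y'a: "y' - a = z" by (rule ext) (simp add: y'_def)
  have r: "0 \<le> r" "r \<le> 2 * inner_on I z z"
    using proj_sq_expansion[of y' a] unfolding r_def y'a by auto
  have "inner_on I z z \<le> 2 * h\<^sup>2 * s"
  proof -
    have "0 \<le> inner_on I ((cos h - 1) *\<^sub>R a - sin h *\<^sub>R b) ((cos h - 1) *\<^sub>R a - sin h *\<^sub>R b)" by simp
    then have "inner_on I z z \<le> 2 * (1 - cos h)\<^sup>2 * inner_on I a a + 2 * (sin h)\<^sup>2 * inner_on I b b"
      unfolding z_def by (simp add: inner_on_simps inner_on_commute[of I b a] power2_eq_square algebra_simps)
    also have "\<dots> \<le> 2 * h\<^sup>2 * inner_on I a a + 2 * h\<^sup>2 * inner_on I b b"
      using \<open>(1 - cos h)\<^sup>2 \<le> h\<^sup>2\<close> \<open>(sin h)\<^sup>2 \<le> h\<^sup>2\<close> by (intro add_mono mult_right_mono) auto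
    finally show ?thesis by (simp add: s_def algebra_simps)
  qed
  with r have r2: "r \<le> 4 * h\<^sup>2 * s" by linarith
  have pa: "0 \<le> proj_sq a" "proj_sq a \<le> s" using proj_sq_le[of a] s0 by auto
  have "inner_on I (proj a) z = sin h * inner_on I (proj a) b - (1 - cos h) * proj_sq a"
    using proj_sq_eq[of a] by (simp add: z_def inner_on_simps inner_on_commute algebra_simps)
  then have eq: "proj_sq y' - proj_sq a = 2 * sin h * inner_on I (proj a) b + (r - 2 * (1 - cos h) * proj_sq a)"
    by (simp add: r_def algebra_simps)
  have q: "\<bar>r - 2 * (1 - cos h) * proj_sq a\<bar> \<le> 5 * h\<^sup>2 * s"
  proof -
    have "0 \<le> 2 * (1 - cos h) * proj_sq a" using ch pa by simp
    moreover have "2 * (1 - cos h) * proj_sq a \<le> h\<^sup>2 * s"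
      using ch pa s0 by (intro mult_mono) auto
    moreover have "0 \<le> h\<^sup>2 * s" using s0 by simp
    ultimately show ?thesis using r(1) r2 unfolding abs_le_iff mult.assoc by linarith
  qed
  define A where "A = 2 * sin h * inner_on I (proj a) b"
  define B where "B = r - 2 * (1 - cos h) * proj_sq a"
  have "(A + B)\<^sup>2 \<le> 2 * A\<^sup>2 + 2 * B\<^sup>2"
    using zero_le_power2[of "A - B"] by (simp add: power2_eq_square algebra_simps)
  moreover have "B\<^sup>2 \<le> 25 * h ^ 4 * s\<^sup>2"
  proof -
    have "\<bar>B\<bar>\<^sup>2 \<le> (5 * h\<^sup>2 * s)\<^sup>2" using q by (intro power_mono) (auto simp: B_def)
    then show ?thesis by (simp add: power_mult_distrib)
  qed
  moreover have "A\<^sup>2 \<le> 4 * h\<^sup>2 * (inner_on I (proj a) b)\<^sup>2"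
    using \<open>(sin h)\<^sup>2 \<le> h\<^sup>2\<close> by (simp add: A_def power_mult_distrib mult_right_mono)
  moreover have "(proj_sq a - proj_sq y)\<^sup>2 = (A + B)\<^sup>2"
  proof -
    have "proj_sq y' - proj_sq a = A + B" using eq by (simp only: A_def B_def)
    then show ?thesis unfolding yy by (subst power2_commute) (simp only:)
  qed
  moreover have "0 \<le> h ^ 4 * s\<^sup>2" by simp
  ultimately show ?thesis
    unfolding s_def[symmetric] mult.assoc by linarith
qed

text \<open>A discrete version of the rotation proof of the Poincare inequality. The arc
  \<open>cos s * a + sin s * b\<close> joins two independent copies in k steps of angle h. By
  rotation invariance all squared increments have the same mean, Cauchy-Schwarz costs a factor k,
  and \<open>(k * h)\<^sup>2 = (pi / 2)\<^sup>2\<close> stays bounded while the error of order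
  \<open>h ^ 4\<close> disappears in the limit. The gradient term has mean d because, given a,
  \<open>inner_on I (proj a) b\<close> is normal with variance \<open>proj_sq a\<close>.\<close>

lemma proj_sq_variance:
  shows integrable_proj_sq: "integrable (std_gaussian I) proj_sq"
    and integrable_proj_sq_dev: "integrable (std_gaussian I) (\<lambda>a. (proj_sq a - stat_dim I C)\<^sup>2)"
    and variance_proj_sq: "(\<integral>a. (proj_sq a - stat_dim I C)\<^sup>2 \<partial>std_gaussian I) \<le> 2 * pi\<^sup>2 * stat_dim I C"
proof -
  interpret S: prob_space "std_gaussian I" by (rule prob_space_std_gaussian)
  interpret R: pair_prob_space "std_gaussian I" "std_gaussian I" ..
  let ?S = "std_gaussian I" and ?R = "std_gaussian I \<Otimes>\<^sub>M std_gaussian I"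
  define d where "d = stat_dim I C"
  define Q where "Q = (\<lambda>p :: (nat \<Rightarrow> real) \<times> (nat \<Rightarrow> real). inner_on I (fst p) (fst p) + inner_on I (snd p) (snd p))"
  have intQ: "integrable ?R (\<lambda>p. (Q p)\<^sup>2)"
    unfolding Q_def by (rule integrable_std_gaussian_norm_sq_sq) (rule finI)
  have Q0: "0 \<le> Q p" for p by (simp add: Q_def)
  define m4 where "m4 = (\<integral>p. (Q p)\<^sup>2 \<partial>?R)"
  have [measurable]: "(\<lambda>p. proj_sq (fst p)) \<in> borel_measurable ?R" "(\<lambda>p. proj_sq (snd p)) \<in> borel_measurable ?R"
    by measurable
  have pq: "proj_sq (fst p) \<le> Q p" "proj_sq (snd p) \<le> Q p" for p
    using proj_sq_le[of "fst p"] proj_sq_le[of "snd p"] inner_on_self_nonneg[of I "fst p"]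
      inner_on_self_nonneg[of I "snd p"] unfolding Q_def by linarith+
  have int_fst2: "integrable ?R (\<lambda>p. (proj_sq (fst p))\<^sup>2)"
    by (rule Bochner_Integration.integrable_bound[OF intQ]) (auto intro!: power_mono pq)
  have "integrable (distr ?R ?S fst) (\<lambda>a. (proj_sq a)\<^sup>2)"
    using int_fst2 by (subst integrable_distr_eq) auto
  then have int2: "integrable ?S (\<lambda>a. (proj_sq a)\<^sup>2)" by (simp only: S.distr_pair_fst)
  show int1: "integrable ?S proj_sq"
    by (rule S.square_integrable_imp_integrable[OF _ int2]) measurable
  have d_eq: "d = (\<integral>a. proj_sq a \<partial>?S)" by (simp add: d_def stat_dim_eq)
  have int_dev: "integrable ?S (\<lambda>a. (proj_sq a - d)\<^sup>2)"
    unfolding power2_diff using int1 int2 by (intro Bochner_Integration.integrable_add Bochner_Integration.integrable_diff) auto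
  then show "integrable ?S (\<lambda>a. (proj_sq a - stat_dim I C)\<^sup>2)" by (simp add: d_def)
  define X where "X = (\<lambda>p. (proj_sq (fst p) - proj_sq (snd p))\<^sup>2)"
  have Xm [measurable]: "X \<in> borel_measurable ?R" unfolding X_def by measurable
  have diff_bound: "(u - v)\<^sup>2 \<le> w\<^sup>2" if "0 \<le> u" "0 \<le> v" "u \<le> w" "v \<le> w" for u v w :: real
    using that by (intro abs_le_square_iff[THEN iffD1]) (simp add: abs_le_iff)
  have intX: "integrable ?R X"
    by (rule Bochner_Integration.integrable_bound[OF intQ])
       (auto simp: X_def intro!: diff_bound pq)
  define Z where "Z = (\<lambda>p. (inner_on I (proj (fst p)) (snd p))\<^sup>2)"
  have Zm [measurable]: "Z \<in> borel_measurable ?R"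
  proof -
    have "(\<lambda>p. inner_on I (proj (fst p)) (snd p)) \<in> borel_measurable ?R"
      by (rule measurable_inner_on[OF measurable_proj]) (auto intro: measurable_std_gaussian_component measurable_std_gaussian_coord)
    then show ?thesis unfolding Z_def by measurable
  qed
  have ZQ: "Z p \<le> (Q p)\<^sup>2" for p
  proof -
    have "Z p \<le> (L2_set (proj (fst p)) I * L2_set (snd p) I)\<^sup>2"
      unfolding Z_def using inner_on_le_L2[of I "proj (fst p)" "snd p"] inner_on_le_L2[of I "- proj (fst p)" "snd p"]
      by (intro abs_le_square_iff[THEN iffD1]) (simp add: inner_on_simps abs_le_iff L2_set_eq_sqrt_inner)
    also have "\<dots> = proj_sq (fst p) * inner_on I (snd p) (snd p)"
      by (simp add: power_mult_distrib proj_sq_def L2_set_sq)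
    also have "\<dots> \<le> Q p * Q p"
      by (intro mult_mono pq Q0) (auto simp: Q_def)
    finally show ?thesis by (simp add: power2_eq_square)
  qed
  have intZ: "integrable ?R Z"
    by (rule Bochner_Integration.integrable_bound[OF intQ Zm]) (use ZQ in \<open>auto simp: Z_def\<close>)
  have EZ: "(\<integral>p. Z p \<partial>?R) = d"
  proof -
    have "(\<integral>p. Z p \<partial>?R) = (\<integral>a. (\<integral>b. Z (a, b) \<partial>?S) \<partial>?S)"
      by (rule R.integral_fst'[symmetric]) (rule intZ)
    also have "\<dots> = (\<integral>a. proj_sq a \<partial>?S)"
      by (simp add: Z_def integral_std_gaussian_inner_sq[OF finI] proj_sq_def L2_set_sq)
    finally show ?thesis by (simp add: d_eq)
  qed
  \<comment> \<open>\<open>2 \<le> k\<close> makes the angle \<open>h\<close> at most 1. The leading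
    constant is \<open>8 * (pi / 2)\<^sup>2\<close>; the last summand vanishes as k grows.\<close>
  have key: "(\<integral>p. X p \<partial>?R) \<le> 2 * pi\<^sup>2 * d + 100 * (pi / 2) ^ 4 * m4 * (1 / (real k)\<^sup>2)" if k: "2 \<le> k" for k :: nat
  proof -
    define h where "h = pi / (2 * real k)"
    have h: "0 \<le> h" "h \<le> 1"
      using k pi_less_4 by (auto simp: h_def field_simps)
    have kh: "real k * h = pi / 2" using k by (simp add: h_def)
    define G where "G = (\<lambda>j :: nat. \<lambda>p. \<lambda>i\<in>I. cos (real j * h) * fst p i + sin (real j * h) * snd p i)"
    have G0: "proj_sq (G 0 p) = proj_sq (fst p)" for p by (rule proj_sq_cong) (simp add: G_def)
    have Gk: "proj_sq (G k p) = proj_sq (snd p)" for p by (rule proj_sq_cong) (simp add: G_def kh)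
    have Gm [measurable]: "(\<lambda>p. proj_sq (G j p)) \<in> borel_measurable ?R" for j
      by (rule measurable_proj_sq)
         (auto simp: G_def intro!: borel_measurable_add borel_measurable_times intro: measurable_std_gaussian_component measurable_std_gaussian_coord)
    define D where "D = (\<lambda>j p. proj_sq (G j p) - proj_sq (G (Suc j) p))"
    have Dm [measurable]: "D j \<in> borel_measurable ?R" for j unfolding D_def by measurable
    have GQ: "proj_sq (G j p) \<le> Q p" for j p
    proof -
      have "inner_on I (G j p) (G j p) \<le> (\<Sum>i\<in>I. fst p i * fst p i + snd p i * snd p i)"
        unfolding inner_on_def
      proof (rule sum_mono)
        fix i assume i: "i \<in> I"
        have e1: "0 \<le> (cos (real j * h) * snd p i - sin (real j * h) * fst p i)\<^sup>2" by simp
        have e2: "(cos (real j * h) * fst p i + sin (real j * h) * snd p i)\<^sup>2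
            + (cos (real j * h) * snd p i - sin (real j * h) * fst p i)\<^sup>2
            = ((sin (real j * h))\<^sup>2 + (cos (real j * h))\<^sup>2) * ((fst p i)\<^sup>2 + (snd p i)\<^sup>2)"
          by (simp only: power2_eq_square) (simp only: algebra_simps)
        have "(cos (real j * h) * fst p i + sin (real j * h) * snd p i)\<^sup>2 \<le> (fst p i)\<^sup>2 + (snd p i)\<^sup>2"
          using e1 e2 by (simp only: sin_cos_squared_add mult_1)
        then show "G j p i * G j p i \<le> fst p i * fst p i + snd p i * snd p i"
          using i by (simp add: G_def flip: power2_eq_square)
      qed
      then show ?thesis using proj_sq_le[of "G j p"] by (simp add: Q_def inner_on_def sum.distrib)
    qed
    have intD: "integrable ?R (\<lambda>p. (D j p)\<^sup>2)" for j
      by (rule Bochner_Integration.integrable_bound[OF intQ]) (auto simp: D_def intro!: diff_bound GQ)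
    have D0: "(\<integral>p. (D 0 p)\<^sup>2 \<partial>?R) \<le> 8 * h\<^sup>2 * d + 100 * h ^ 4 * m4"
    proof -
      have "(\<integral>p. (D 0 p)\<^sup>2 \<partial>?R) \<le> (\<integral>p. 8 * h\<^sup>2 * Z p + 100 * h ^ 4 * (Q p)\<^sup>2 \<partial>?R)"
      proof (rule integral_mono)
        show "integrable ?R (\<lambda>p. 8 * h\<^sup>2 * Z p + 100 * h ^ 4 * (Q p)\<^sup>2)" using intZ intQ by simp
        fix p
        show "(D 0 p)\<^sup>2 \<le> 8 * h\<^sup>2 * Z p + 100 * h ^ 4 * (Q p)\<^sup>2"
          unfolding D_def G0 Z_def Q_def
          by (rule proj_sq_increment_bound[OF h]) (simp add: G_def)
      qed (rule intD)
      also have "\<dots> = 8 * h\<^sup>2 * d + 100 * h ^ 4 * m4" using intZ intQ by (simp add: EZ m4_def)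
      finally show ?thesis .
    qed
    \<comment> \<open>Increment j is increment 0 after rotating by \<open>real j * h\<close>. For
      \<open>j < k\<close> this angle stays below \<open>pi / 2\<close>, so its cosine is
      nonzero.\<close>
    have Dj: "(\<integral>p. (D j p)\<^sup>2 \<partial>?R) = (\<integral>p. (D 0 p)\<^sup>2 \<partial>?R)" if j: "j < k" for j
    proof -
      have "real j * h < pi / 2"
        using j k unfolding kh[symmetric] by (intro mult_strict_right_mono) (auto simp: h_def)
      moreover have "0 \<le> real j * h" using h by simp
      ultimately have c: "cos (real j * h) \<noteq> 0" using cos_gt_zero_pi[of "real j * h"] by force
      have eq: "D 0 (gauss_rot I (real j * h) p) = D j p" for p
      proof -
        have "proj_sq (G 0 (gauss_rot I (real j * h) p)) = proj_sq (G j p)"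
          by (rule proj_sq_cong) (simp add: G_def gauss_rot_def split_beta)
        moreover have "proj_sq (G (Suc 0) (gauss_rot I (real j * h) p)) = proj_sq (G (Suc j) p)"
        proof (rule proj_sq_cong)
          fix i assume i: "i \<in> I"
          obtain a b where p: "p = (a, b)" by (cases p)
          have e: "real (Suc j) * h = real j * h + h" by (simp add: algebra_simps)
          have "G (Suc 0) (gauss_rot I (real j * h) p) i
              = cos h * (cos (real j * h) * a i + sin (real j * h) * b i)
                + sin h * (cos (real j * h) * b i - sin (real j * h) * a i)"
            using i by (simp add: G_def gauss_rot_def p)
          also have "\<dots> = cos (real j * h + h) * a i + sin (real j * h + h) * b i"
            unfolding cos_add sin_add by (simp only: algebra_simps)
          also have "\<dots> = G (Suc j) p i"
            unfolding G_def e p using i by simp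
          finally show "G (Suc 0) (gauss_rot I (real j * h) p) i = G (Suc j) p i" .
        qed
        ultimately show ?thesis by (simp add: D_def)
      qed
      have "(\<integral>p. (D 0 p)\<^sup>2 \<partial>?R) = (\<integral>p. (D 0 p)\<^sup>2 \<partial>distr ?R ?R (gauss_rot I (real j * h)))"
        by (simp only: distr_gauss_rot[OF finI c])
      also have "\<dots> = (\<integral>p. (D 0 (gauss_rot I (real j * h) p))\<^sup>2 \<partial>?R)"
        by (rule integral_distr) measurable
      finally show ?thesis by (simp add: eq)
    qed
    have "(\<integral>p. X p \<partial>?R) \<le> (\<integral>p. (\<Sum>j<k. (D j p)\<^sup>2) * real k \<partial>?R)"
    proof (rule integral_mono[OF intX])
      show "integrable ?R (\<lambda>p. (\<Sum>j<k. (D j p)\<^sup>2) * real k)" using intD by simp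
      fix p
      have "(\<Sum>j<k. D j p) = proj_sq (fst p) - proj_sq (snd p)"
        unfolding D_def using sum_lessThan_telescope'[of "\<lambda>j. proj_sq (G j p)" k] by (simp add: G0 Gk)
      then show "X p \<le> (\<Sum>j<k. (D j p)\<^sup>2) * real k"
        using sum_squared_le_sum_of_squares[of "\<lambda>j. D j p" "{..<k}"] by (simp add: X_def)
    qed
    also have "\<dots> = (\<Sum>j<k. (\<integral>p. (D j p)\<^sup>2 \<partial>?R)) * real k" using intD by simp
    also have "\<dots> = (real k)\<^sup>2 * (\<integral>p. (D 0 p)\<^sup>2 \<partial>?R)" 
    proof -
      have "(\<Sum>j<k. (\<integral>p. (D j p)\<^sup>2 \<partial>?R)) = (\<Sum>j<k. (\<integral>p. (D 0 p)\<^sup>2 \<partial>?R))"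
        by (rule sum.cong[OF refl], rule Dj) simp
      also have "\<dots> = real k * (\<integral>p. (D 0 p)\<^sup>2 \<partial>?R)" by simp
      finally show ?thesis by (simp only: power2_eq_square mult_ac)
    qed
    also have "\<dots> \<le> (real k)\<^sup>2 * (8 * h\<^sup>2 * d + 100 * h ^ 4 * m4)" by (intro mult_left_mono D0) simp
    also have "\<dots> = 2 * pi\<^sup>2 * d + 100 * (pi / 2) ^ 4 * m4 * (1 / (real k)\<^sup>2)"
    proof -
      have alg: "K\<^sup>2 * (8 * (P / K)\<^sup>2 * d + 100 * (P / K) ^ 4 * m4) = 8 * P\<^sup>2 * d + 100 * P ^ 4 * m4 * (1 / K\<^sup>2)"
        if "0 < K" for K P :: real
      proof -
        have "K\<^sup>2 * (P / K)\<^sup>2 = P\<^sup>2" "K\<^sup>2 * (P / K) ^ 4 = P ^ 4 * (1 / K\<^sup>2)"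
          using that by (simp_all add: power_divide power2_eq_square power4_eq_xxxx)
        then show ?thesis by algebra
      qed
      have hk: "h = (pi / 2) / real k" by (simp add: h_def)
      have "8 * (pi / 2)\<^sup>2 = 2 * pi\<^sup>2" by (simp add: power_divide)
      moreover have "0 < real k" using k by simp
      ultimately show ?thesis using alg[of "real k" "pi / 2"] unfolding hk by (simp only:)
    qed
    finally show ?thesis .
  qed
  have "(\<lambda>k. 1 / (real k)\<^sup>2) \<longlonglongrightarrow> 0" by real_asymp
  then have "(\<lambda>k. 2 * pi\<^sup>2 * d + 100 * (pi / 2) ^ 4 * m4 * (1 / (real k)\<^sup>2))
      \<longlonglongrightarrow> 2 * pi\<^sup>2 * d + 100 * (pi / 2) ^ 4 * m4 * 0"
    by (intro tendsto_add tendsto_mult tendsto_const)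
  from LIMSEQ_le_const[OF this] have EX: "(\<integral>p. X p \<partial>?R) \<le> 2 * pi\<^sup>2 * d"
    using key by fastforce
  \<comment> \<open>For fixed a the mean of \<open>X (a, b)\<close> over b is at least
    \<open>(proj_sq a - d)\<^sup>2\<close>: dropping \<open>(d - proj_sq b)\<^sup>2\<close> from the
    expanded square leaves a cross term of mean zero.\<close>
  have "(\<integral>a. (proj_sq a - d)\<^sup>2 \<partial>?S) \<le> (\<integral>a. (\<integral>b. X (a, b) \<partial>?S) \<partial>?S)"
  proof (rule integral_mono[OF int_dev])
    show "integrable ?S (\<lambda>a. \<integral>b. X (a, b) \<partial>?S)" by (rule R.integrable_fst'[OF intX])
    fix a
    have i1: "integrable ?S (\<lambda>b. (proj_sq a - d)\<^sup>2 + 2 * (proj_sq a - d) * (d - proj_sq b))"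
      using int1 by simp
    have i2: "integrable ?S (\<lambda>b. X (a, b))"
      unfolding X_def fst_conv snd_conv power2_diff using int1 int2 by simp
    have "(proj_sq a - d)\<^sup>2 = (\<integral>b. (proj_sq a - d)\<^sup>2 + 2 * (proj_sq a - d) * (d - proj_sq b) \<partial>?S)"
      using int1 by (simp add: d_eq S.prob_space)
    also have "\<dots> \<le> (\<integral>b. X (a, b) \<partial>?S)"
    proof (rule integral_mono[OF i1 i2])
      fix b
      have "0 \<le> (d - proj_sq b)\<^sup>2" by simp
      then show "(proj_sq a - d)\<^sup>2 + 2 * (proj_sq a - d) * (d - proj_sq b) \<le> X (a, b)"
        by (simp add: X_def power2_eq_square algebra_simps)
    qed
    finally show "(proj_sq a - d)\<^sup>2 \<le> (\<integral>b. X (a, b) \<partial>?S)" .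
  qed
  also have "\<dots> = (\<integral>p. X p \<partial>?R)" by (rule R.integral_fst'[OF intX])
  finally show "(\<integral>a. (proj_sq a - stat_dim I C)\<^sup>2 \<partial>std_gaussian I) \<le> 2 * pi\<^sup>2 * stat_dim I C"
    using EX by (simp add: d_def)
qed

lemma stat_dim_nonneg: "0 \<le> stat_dim I C"
  unfolding stat_dim_eq by (rule integral_nonneg_AE) simp

text \<open>Chebyshev's inequality with a threshold chosen so that d cancels:
  \<open>(\<eta> * d + \<tau>)\<^sup>2 \<ge> 4 * \<eta> * d * \<tau>\<close>, while the variance is
  at most \<open>2 * pi\<^sup>2 * d\<close>. The bound is the same for all cones and all
  dimensions.\<close>

lemma proj_sq_upper_tail:
  assumes "0 < \<eta>" "0 < \<tau>"
  shows "measure (std_gaussian I) {a \<in> space (std_gaussian I). (1 + \<eta>) * stat_dim I C + \<tau> < proj_sq a}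
    \<le> pi\<^sup>2 / (2 * \<eta> * \<tau>)"
proof -
  interpret S: prob_space "std_gaussian I" by (rule prob_space_std_gaussian)
  define d where "d = stat_dim I C"
  have d: "0 \<le> d" by (simp add: d_def stat_dim_nonneg)
  have sq: "4 * (\<eta> * d) * \<tau> \<le> (\<eta> * d + \<tau>)\<^sup>2"
    using zero_le_power2[of "\<eta> * d - \<tau>"] by (simp add: power2_eq_square algebra_simps)
  have pos: "0 < (\<eta> * d + \<tau>)\<^sup>2" using assms d by (intro zero_less_power add_nonneg_pos) auto
  have "{a \<in> space (std_gaussian I). (1 + \<eta>) * d + \<tau> < proj_sq a}
      \<subseteq> {a \<in> space (std_gaussian I). (\<eta> * d + \<tau>)\<^sup>2 \<le> (proj_sq a - d)\<^sup>2}"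
  proof safe
    fix a assume "(1 + \<eta>) * d + \<tau> < proj_sq a"
    then have "\<eta> * d + \<tau> \<le> proj_sq a - d" by (simp add: algebra_simps)
    then show "(\<eta> * d + \<tau>)\<^sup>2 \<le> (proj_sq a - d)\<^sup>2" using assms d by (intro power_mono) auto
  qed
  then have "measure (std_gaussian I) {a \<in> space (std_gaussian I). (1 + \<eta>) * d + \<tau> < proj_sq a}
      \<le> measure (std_gaussian I) {a \<in> space (std_gaussian I). (\<eta> * d + \<tau>)\<^sup>2 \<le> (proj_sq a - d)\<^sup>2}"
    by (intro S.finite_measure_mono) auto
  also have "\<dots> \<le> (\<integral>a. (proj_sq a - d)\<^sup>2 \<partial>std_gaussian I) / (\<eta> * d + \<tau>)\<^sup>2"
    by (rule integral_Markov_inequality_measure[where A = "{}"]) (use pos integrable_proj_sq_dev in \<open>auto simp: d_def\<close>)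
  also have "\<dots> \<le> (2 * pi\<^sup>2 * d) / (\<eta> * d + \<tau>)\<^sup>2"
    using variance_proj_sq by (intro divide_right_mono) (auto simp: d_def)
  also have "\<dots> \<le> pi\<^sup>2 / (2 * \<eta> * \<tau>)"
  proof -
    have "(2 * pi\<^sup>2 * d) * (2 * \<eta> * \<tau>) = pi\<^sup>2 * (4 * (\<eta> * d) * \<tau>)" by simp
    also have "\<dots> \<le> pi\<^sup>2 * (\<eta> * d + \<tau>)\<^sup>2" using sq by (intro mult_left_mono) auto
    finally show ?thesis using pos assms by (simp add: divide_simps)
  qed
  finally show ?thesis by (simp add: d_def)
qed

end

section \<open>Symmetrization and contraction\<close>

text \<open>
  \<open>rad T f is c\<close> is the Rademacher average, over the signs attached to the indices listed in
  \<open>is\<close>, of the maximum over \<open>t \<in> T\<close> of \<open>c t\<close> plus the signed sum of the \<open>f t i\<close>.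
\<close>

fun rad :: "'t set \<Rightarrow> ('t \<Rightarrow> 'i \<Rightarrow> real) \<Rightarrow> 'i list \<Rightarrow> ('t \<Rightarrow> real) \<Rightarrow> real" where
  "rad T f [] c = Max (c ` T)"
| "rad T f (i # is) c = (rad T f is (\<lambda>t. c t + f t i) + rad T f is (\<lambda>t. c t - f t i)) / 2"

lemma rad_cong:
  assumes "\<And>t i. t \<in> T \<Longrightarrow> i \<in> set is \<Longrightarrow> f t i = g t i" "\<And>t. t \<in> T \<Longrightarrow> c t = c' t"
  shows "rad T f is c = rad T g is c'"
  using assms
proof (induction "is" arbitrary: c c')
  case Nil
  then show ?case by (simp cong: image_cong_simp)
next
  case (Cons i "is")
  have "rad T f is (\<lambda>t. c t + f t i) = rad T g is (\<lambda>t. c' t + g t i)"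
    "rad T f is (\<lambda>t. c t - f t i) = rad T g is (\<lambda>t. c' t - g t i)"
    using Cons.prems by (auto intro!: Cons.IH)
  then show ?case by simp
qed

lemma rad_add:
  assumes "finite T" "T \<noteq> {}"
  shows "rad T (\<lambda>t i. f t i + g t i) is (\<lambda>t. c t + c' t) \<le> rad T f is c + rad T g is c'"
proof (induction "is" arbitrary: c c')
  case Nil
  show ?case using assms by (auto intro!: Max.boundedI add_mono Max_ge)
next
  case (Cons i "is")
  have "rad T (\<lambda>t i. f t i + g t i) is (\<lambda>t. (c t + f t i) + (c' t + g t i))
      \<le> rad T f is (\<lambda>t. c t + f t i) + rad T g is (\<lambda>t. c' t + g t i)"
    "rad T (\<lambda>t i. f t i + g t i) is (\<lambda>t. (c t - f t i) + (c' t - g t i))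
      \<le> rad T f is (\<lambda>t. c t - f t i) + rad T g is (\<lambda>t. c' t - g t i)"
    by (rule Cons.IH)+
  moreover have "(\<lambda>t. c t + c' t + (f t i + g t i)) = (\<lambda>t. (c t + f t i) + (c' t + g t i))"
    "(\<lambda>t. c t + c' t - (f t i + g t i)) = (\<lambda>t. (c t - f t i) + (c' t - g t i))"
    by (auto simp: fun_eq_iff)
  moreover have "(A + A') / 2 \<le> (B + B') / 2 + (C + C') / 2" if "A \<le> B + C" "A' \<le> B' + C'" for A A' B B' C C' :: real
    using that by (simp add: field_simps)
  ultimately show ?case by (simp only: rad.simps)
qed

lemma rad_uminus: "rad T (\<lambda>t i. - f t i) is c = rad T f is c"
  by (induction "is" arbitrary: c) (simp_all add: add.commute)

text \<open>The Ledoux-Talagrand contraction principle, one index at a time.\<close>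

lemma rad_contraction_step:
  assumes T: "finite T" "T \<noteq> {}" and L: "\<And>s t. s \<in> T \<Longrightarrow> t \<in> T \<Longrightarrow> p t - p s \<le> \<bar>a t - a s\<bar>"
  shows "rad T f is (\<lambda>t. c t + p t) + rad T f is (\<lambda>t. c t - p t)
    \<le> rad T f is (\<lambda>t. c t + a t) + rad T f is (\<lambda>t. c t - a t)"
proof (induction "is" arbitrary: c)
  case Nil
  \<comment> \<open>With maximisers t and s of the two terms, the left-hand side is
    \<open>c t + c s + (p t - p s)\<close>, at most \<open>c t + c s + |a t - a s|\<close>.
    Whichever sign the modulus has, this is a value of the right-hand side at t and s in one of the
    two orders.\<close>
  have "Max ((\<lambda>t. c t + p t) ` T) \<in> (\<lambda>t. c t + p t) ` T" "Max ((\<lambda>t. c t - p t) ` T) \<in> (\<lambda>t. c t - p t) ` T"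
    using T by (auto intro!: Max_in)
  then obtain s t where st: "s \<in> T" "t \<in> T" "Max ((\<lambda>t. c t + p t) ` T) = c t + p t"
    "Max ((\<lambda>t. c t - p t) ` T) = c s - p s" by auto
  have ge: "c u + a u \<le> Max ((\<lambda>t. c t + a t) ` T)" "c u - a u \<le> Max ((\<lambda>t. c t - a t) ` T)" if "u \<in> T" for u
    using T that by auto
  show ?case
    using L[OF st(1,2)] ge[OF st(1)] ge[OF st(2)] by (simp add: st abs_if split: if_splits)
next
  case (Cons i "is")
  \<comment> \<open>The sign at index i is absorbed into the offset, so the induction hypothesis
    applies to each sign separately.\<close>
  have eq: "(\<lambda>t. c t + q t + f t i) = (\<lambda>t. (c t + f t i) + q t)" "(\<lambda>t. c t + q t - f t i) = (\<lambda>t. (c t - f t i) + q t)"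
    "(\<lambda>t. c t - q t + f t i) = (\<lambda>t. (c t + f t i) - q t)" "(\<lambda>t. c t - q t - f t i) = (\<lambda>t. (c t - f t i) - q t)" for q
    by (auto simp: fun_eq_iff)
  have half: "(A + A') / 2 + (B + B') / 2 \<le> (C + C') / 2 + (D + D') / 2"
    if "A + B \<le> C + D" "A' + B' \<le> C' + D'" for A A' B B' C C' D D' :: real
    using that by (simp add: field_simps)
  show ?case unfolding rad.simps eq by (intro half Cons.IH)
qed

lemma rad_contraction:
  assumes T: "finite T" "T \<noteq> {}"
    and L: "\<And>i s t. i \<in> set is \<Longrightarrow> s \<in> T \<Longrightarrow> t \<in> T \<Longrightarrow> p t i - p s i \<le> \<bar>a t i - a s i\<bar>"
  shows "rad T p is c \<le> rad T a is c"
  using L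
proof (induction "is" arbitrary: c)
  case (Cons i "is")
  have "rad T p is (\<lambda>t. c t + p t i) + rad T p is (\<lambda>t. c t - p t i)
      \<le> rad T a is (\<lambda>t. c t + p t i) + rad T a is (\<lambda>t. c t - p t i)"
    using Cons.prems by (intro add_mono Cons.IH) auto
  also have "\<dots> \<le> rad T a is (\<lambda>t. c t + a t i) + rad T a is (\<lambda>t. c t - a t i)"
    using Cons.prems by (intro rad_contraction_step T) auto
  finally show ?case by simp
qed simp

section \<open>Symmetrization by an independent copy\<close>

lemma integrable_Max:
  fixes f :: "'t \<Rightarrow> 'b \<Rightarrow> real"
  assumes "finite T" "T \<noteq> {}" "\<And>t. t \<in> T \<Longrightarrow> integrable M (f t)"
  shows "integrable M (\<lambda>x. Max ((\<lambda>t. f t x) ` T))"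
  using assms
proof (induction T rule: finite_ne_induct)
  case (insert t T)
  then show ?case by (simp add: integrable_max)
qed simp

lemma integrable_rad:
  assumes T: "finite T" "T \<noteq> {}"
    and f: "\<And>t i. t \<in> T \<Longrightarrow> i \<in> set is \<Longrightarrow> integrable M (\<lambda>x. f x t i)"
    and c: "\<And>t. t \<in> T \<Longrightarrow> integrable M (\<lambda>x. c x t)"
  shows "integrable M (\<lambda>x. rad T (f x) is (c x))"
  using f c
proof (induction "is" arbitrary: c)
  case Nil
  then show ?case using T by (simp add: integrable_Max)
next
  case (Cons i "is")
  have "integrable M (\<lambda>x. rad T (f x) is (\<lambda>t. c x t + f x t i))"
    "integrable M (\<lambda>x. rad T (f x) is (\<lambda>t. c x t - f x t i))"
    using Cons.prems by (auto intro!: Cons.IH)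
  then show ?case by simp
qed

lemma integral_PiM_component:
  fixes g :: "'b \<Rightarrow> real"
  assumes Q: "\<And>i. prob_space (Q i)" and i: "i \<in> I" and g: "g \<in> borel_measurable (Q i)"
  shows "(\<integral>x. g (x i) \<partial>PiM I Q) = (\<integral>y. g y \<partial>Q i)"
    and "integrable (PiM I Q) (\<lambda>x. g (x i)) \<longleftrightarrow> integrable (Q i) g"
proof -
  have "(\<integral>y. g y \<partial>Q i) = (\<integral>y. g y \<partial>distr (PiM I Q) (Q i) (\<lambda>x. x i))"
    by (simp only: distr_PiM_component[where M = Q, OF Q i])
  also have "\<dots> = (\<integral>x. g (x i) \<partial>PiM I Q)" using i g by (intro integral_distr) auto
  finally show "(\<integral>x. g (x i) \<partial>PiM I Q) = (\<integral>y. g y \<partial>Q i)" ..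
  have "integrable (Q i) g \<longleftrightarrow> integrable (distr (PiM I Q) (Q i) (\<lambda>x. x i)) g"
    by (simp only: distr_PiM_component[where M = Q, OF Q i])
  also have "\<dots> \<longleftrightarrow> integrable (PiM I Q) (\<lambda>x. g (x i))" using i g by (intro integrable_distr_eq) auto
  finally show "integrable (PiM I Q) (\<lambda>x. g (x i)) \<longleftrightarrow> integrable (Q i) g" ..
qed

text \<open>An independent copy replaces the mean, since a maximum of means is at most the mean of
  the maximum. Exchanging the two samples at index i preserves the joint law and flips the sign of
  the i-th difference, so random signs can be averaged in, one index at a time. Splitting each
  difference into its two samples gives the factor 2.\<close>

lemma symmetrization:
  fixes h :: "'t \<Rightarrow> 'b \<Rightarrow> real"
  assumes Q: "prob_space Q" and T: "finite T" "T \<noteq> {}"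
    and h: "\<And>t. t \<in> T \<Longrightarrow> integrable Q (h t)"
    and dist: "distinct is"
  defines "I \<equiv> set is"
  shows "(\<integral>x. Max ((\<lambda>t. \<Sum>i\<in>I. (\<integral>y. h t y \<partial>Q) - h t (x i)) ` T) \<partial>PiM I (\<lambda>_. Q))
    \<le> 2 * (\<integral>x. rad T (\<lambda>t i. h t (x i)) is (\<lambda>_. 0) \<partial>PiM I (\<lambda>_. Q))"
proof -
  interpret Q: prob_space Q by (rule Q)
  interpret QQ: pair_prob_space Q Q ..
  let ?P = "PiM I (\<lambda>_. Q)" and ?PP = "PiM I (\<lambda>_. Q \<Otimes>\<^sub>M Q)"
  interpret P: prob_space ?P by (rule prob_space_PiM) (rule Q)
  interpret R: pair_prob_space ?P ?P ..
  have fin: "finite I" by (simp add: I_def)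
  have hm: "h t \<in> borel_measurable Q" if "t \<in> T" for t using h[OF that] by auto
  have hi: "integrable ?P (\<lambda>x. h t (x i))" "(\<integral>x. h t (x i) \<partial>?P) = (\<integral>y. h t y \<partial>Q)"
    if "t \<in> T" "i \<in> I" for t i
    using integral_PiM_component[where Q = "\<lambda>_. Q", OF Q that(2) hm[OF that(1)]] h[OF that(1)] by auto
  define d where "d = (\<lambda>t p. h t (snd p) - h t (fst p))"
  have h_fst: "integrable (Q \<Otimes>\<^sub>M Q) (\<lambda>p. h t (fst p))" if "t \<in> T" for t
  proof -
    have "integrable (distr (Q \<Otimes>\<^sub>M Q) Q fst) (h t)" unfolding Q.distr_pair_fst by (rule h) fact
    then show ?thesis by (subst (asm) integrable_distr_eq) (use hm[OF that] in auto)
  qed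
  have h_snd: "integrable (Q \<Otimes>\<^sub>M Q) (\<lambda>p. h t (snd p))" if "t \<in> T" for t
    using QQ.integrable_product_swap[OF h_fst[OF that]] by (simp add: case_prod_unfold)
  have dint: "integrable (Q \<Otimes>\<^sub>M Q) (d t)" if "t \<in> T" for t
    unfolding d_def using h_fst h_snd that by simp
  have PPc: "integrable ?PP (\<lambda>z. g (z i))" if "integrable (Q \<Otimes>\<^sub>M Q) g" "i \<in> I" for g :: "'b \<times> 'b \<Rightarrow> real" and i
    using integral_PiM_component(2)[where Q = "\<lambda>_. Q \<Otimes>\<^sub>M Q" and g = g, OF QQ.prob_space_axioms that(2)] that(1) by auto
  define pm where "pm = (\<lambda>z :: 'a \<Rightarrow> 'b \<times> 'b. (\<lambda>i\<in>I. fst (z i), \<lambda>i\<in>I. snd (z i)))"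
  have pm: "pm \<in> measurable ?PP (?P \<Otimes>\<^sub>M ?P)" unfolding pm_def by measurable
  have pmR: "distr ?PP (?P \<Otimes>\<^sub>M ?P) pm = ?P \<Otimes>\<^sub>M ?P"
    unfolding pm_def by (rule distr_PiM_pair[OF fin Q Q])
  define V where "V = (\<lambda>p. Max ((\<lambda>t. \<Sum>i\<in>I. h t (snd p i) - h t (fst p i)) ` T))"
  have hR: "integrable (?P \<Otimes>\<^sub>M ?P) (\<lambda>p. h t (fst p i))" "integrable (?P \<Otimes>\<^sub>M ?P) (\<lambda>p. h t (snd p i))"
    if "t \<in> T" "i \<in> I" for t i
  proof -
    have m: "(\<lambda>x. h t (x i)) \<in> borel_measurable ?P" using hi(1)[OF that] by auto
    have "integrable (distr (?P \<Otimes>\<^sub>M ?P) ?P fst) (\<lambda>x. h t (x i))" unfolding P.distr_pair_fst by (rule hi) fact+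
    then show 1: "integrable (?P \<Otimes>\<^sub>M ?P) (\<lambda>p. h t (fst p i))"
      by (subst (asm) integrable_distr_eq) (use m in auto)
    show "integrable (?P \<Otimes>\<^sub>M ?P) (\<lambda>p. h t (snd p i))"
      using R.integrable_product_swap[OF 1] by (simp add: case_prod_unfold)
  qed
  have intV: "integrable (?P \<Otimes>\<^sub>M ?P) V"
    unfolding V_def using T hR by (intro integrable_Max integrable_sum Bochner_Integration.integrable_diff) auto
  have Vm: "V \<in> borel_measurable (?P \<Otimes>\<^sub>M ?P)" using intV by auto
  have step1: "(\<integral>x. Max ((\<lambda>t. \<Sum>i\<in>I. (\<integral>y. h t y \<partial>Q) - h t (x i)) ` T) \<partial>?P) \<le> (\<integral>p. V p \<partial>(?P \<Otimes>\<^sub>M ?P))"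
  proof -
    have "(\<integral>x. Max ((\<lambda>t. \<Sum>i\<in>I. (\<integral>y. h t y \<partial>Q) - h t (x i)) ` T) \<partial>?P) \<le> (\<integral>x. (\<integral>y. V (x, y) \<partial>?P) \<partial>?P)"
    proof (rule integral_mono)
      show "integrable ?P (\<lambda>x. Max ((\<lambda>t. \<Sum>i\<in>I. (\<integral>y. h t y \<partial>Q) - h t (x i)) ` T))"
        using T hi by (intro integrable_Max integrable_sum Bochner_Integration.integrable_diff) auto
      show "integrable ?P (\<lambda>x. \<integral>y. V (x, y) \<partial>?P)" by (rule R.integrable_fst'[OF intV])
      fix x
      have "(\<Sum>i\<in>I. (\<integral>y. h t y \<partial>Q) - h t (x i)) \<le> (\<integral>y. V (x, y) \<partial>?P)" if t: "t \<in> T" for t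
      proof -
        have "(\<Sum>i\<in>I. (\<integral>y. h t y \<partial>Q) - h t (x i)) = (\<integral>y. (\<Sum>i\<in>I. h t (y i) - h t (x i)) \<partial>?P)"
          using hi t by (simp add: P.prob_space)
        also have "\<dots> \<le> (\<integral>y. V (x, y) \<partial>?P)"
        proof (rule integral_mono)
          show "integrable ?P (\<lambda>y. \<Sum>i\<in>I. h t (y i) - h t (x i))" using hi t by simp
          show "integrable ?P (\<lambda>y. V (x, y))"
            unfolding V_def fst_conv snd_conv using T hi
            by (intro integrable_Max integrable_sum Bochner_Integration.integrable_diff) auto
          show "(\<Sum>i\<in>I. h t (y i) - h t (x i)) \<le> V (x, y)" for y
            using T t by (auto simp: V_def)
        qed
        finally show ?thesis .
      qed
      then show "Max ((\<lambda>t. \<Sum>i\<in>I. (\<integral>y. h t y \<partial>Q) - h t (x i)) ` T) \<le> (\<integral>y. V (x, y) \<partial>?P)"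
        using T by (auto intro!: Max.boundedI)
    qed
    also have "\<dots> = (\<integral>p. V p \<partial>(?P \<Otimes>\<^sub>M ?P))" by (rule R.integral_fst'[OF intV])
    finally show ?thesis .
  qed
  have step2: "(\<integral>p. V p \<partial>(?P \<Otimes>\<^sub>M ?P)) = (\<integral>z. Max ((\<lambda>t. \<Sum>i\<in>I. d t (z i)) ` T) \<partial>?PP)"
  proof -
    have "(\<integral>p. V p \<partial>(?P \<Otimes>\<^sub>M ?P)) = (\<integral>z. V (pm z) \<partial>?PP)"
      by (subst pmR[symmetric]) (rule integral_distr[OF pm Vm])
    then show ?thesis by (simp add: V_def pm_def d_def)
  qed
  \<comment> \<open>\<open>J\<close> holds the indices carrying a plus sign, \<open>js\<close> those
    carrying a random one. The mean is the same for every division of \<open>I\<close> between them;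
    \<open>js = []\<close> is the unsigned maximum.\<close>
  have step3: "(\<integral>z. rad T (\<lambda>t i. d t (z i)) js (\<lambda>t. \<Sum>i\<in>J. d t (z i)) \<partial>?PP)
      = (\<integral>z. Max ((\<lambda>t. \<Sum>i\<in>I. d t (z i)) ` T) \<partial>?PP)"
    if "distinct js" "set js \<inter> J = {}" "set js \<union> J = I" for js J
    using that
  proof (induction js arbitrary: J)
    case (Cons i js)
    have i: "i \<in> I" "i \<notin> J" "i \<notin> set js" and J: "J \<subseteq> I" "set js \<subseteq> I" and finJ: "finite J"
      using Cons.prems fin by (auto intro: finite_subset)
    have IH: "(\<integral>z. rad T (\<lambda>t i. d t (z i)) js (\<lambda>t. \<Sum>i\<in>insert i J. d t (z i)) \<partial>?PP)
      = (\<integral>z. Max ((\<lambda>t. \<Sum>i\<in>I. d t (z i)) ` T) \<partial>?PP)"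
      using Cons.prems by (intro Cons.IH) auto
    define A where "A = (\<lambda>z. rad T (\<lambda>t i. d t (z i)) js (\<lambda>t. (\<Sum>i\<in>J. d t (z i)) + d t (z i)))"
    define B where "B = (\<lambda>z. rad T (\<lambda>t i. d t (z i)) js (\<lambda>t. (\<Sum>i\<in>J. d t (z i)) - d t (z i)))"
    have sJ: "integrable ?PP (\<lambda>z. \<Sum>i\<in>J. d t (z i))" if "t \<in> T" for t
    proof (rule Bochner_Integration.integrable_sum)
      fix k assume "k \<in> J"
      then show "integrable ?PP (\<lambda>z. d t (z k))" using J by (intro PPc[OF dint[OF that]]) auto
    qed
    have intA: "integrable ?PP A" and intB: "integrable ?PP B"
      unfolding A_def B_def using i J dint PPc T
      by (auto intro!: integrable_rad sJ Bochner_Integration.integrable_diff Bochner_Integration.integrable_add)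
    \<comment> \<open>Exchanges the two samples at index i alone. This preserves the product law and
      turns \<open>A\<close> into \<open>B\<close>.\<close>
    define fl where "fl = (\<lambda>z. \<lambda>k\<in>I. (if k = i then \<lambda>(x, y). (y, x) else (\<lambda>p. p)) (z k :: 'b \<times> 'b))"
    have swap: "distr (Q \<Otimes>\<^sub>M Q) (Q \<Otimes>\<^sub>M Q) (\<lambda>(x, y). (y, x)) = Q \<Otimes>\<^sub>M Q"
      by (rule QQ.distr_pair_swap[symmetric])
    have fm: "(if k = i then \<lambda>(x, y). (y, x) else (\<lambda>p. p)) \<in> measurable (Q \<Otimes>\<^sub>M Q) (Q \<Otimes>\<^sub>M Q)" for k
      by (cases "k = i") (simp_all add: measurable_pair_swap')
    have flPP: "distr ?PP ?PP fl = ?PP"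
      unfolding fl_def
    proof (subst distr_PiM_map[OF fin _ fm])
      show "PiM I (\<lambda>k. distr (Q \<Otimes>\<^sub>M Q) (Q \<Otimes>\<^sub>M Q) (if k = i then \<lambda>(x, y). (y, x) else (\<lambda>p. p))) = ?PP"
        by (rule PiM_cong) (auto simp: swap distr_id2)
    qed (rule QQ.prob_space_axioms)
    have flm: "fl \<in> measurable ?PP ?PP"
      unfolding fl_def
    proof (rule measurable_restrict)
      fix k assume "k \<in> I"
      then have "(\<lambda>z. z k) \<in> measurable ?PP (Q \<Otimes>\<^sub>M Q)" by measurable
      from measurable_compose[OF this fm[of k]]
      show "(\<lambda>z. (if k = i then \<lambda>(x, y). (y, x) else (\<lambda>p. p)) (z k)) \<in> measurable ?PP (Q \<Otimes>\<^sub>M Q)" .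
    qed
    have "(\<integral>z. A z \<partial>?PP) = (\<integral>z. A (fl z) \<partial>?PP)"
      by (subst (1) flPP[symmetric]) (rule integral_distr[OF flm], use intA in auto)
    also have "\<dots> = (\<integral>z. B z \<partial>?PP)"
    proof (rule Bochner_Integration.integral_cong[OF refl])
      fix z
      have "d t (fl z k) = d t (z k)" if "k \<in> I" "k \<noteq> i" for t k using that by (simp add: fl_def)
      moreover have "d t (fl z i) = - d t (z i)" for t using i by (simp add: fl_def d_def split_beta)
      moreover have "(\<Sum>k\<in>J. d t (fl z k)) = (\<Sum>k\<in>J. d t (z k))" for t
        using calculation(1) i J by (intro sum.cong) auto
      ultimately show "A (fl z) = B z"
        unfolding A_def B_def using i J by (intro rad_cong) (auto, metis subsetD)
    qed
    finally have AB: "(\<integral>z. A z \<partial>?PP) = (\<integral>z. B z \<partial>?PP)" .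
    have "(\<integral>z. rad T (\<lambda>t i. d t (z i)) (i # js) (\<lambda>t. \<Sum>i\<in>J. d t (z i)) \<partial>?PP)
        = (\<integral>z. (A z + B z) / 2 \<partial>?PP)"
      by (simp add: A_def B_def)
    also have "\<dots> = (\<integral>z. A z \<partial>?PP)" using intA intB AB by simp
    also have "\<dots> = (\<integral>z. Max ((\<lambda>t. \<Sum>i\<in>I. d t (z i)) ` T) \<partial>?PP)"
      using IH i finJ by (simp add: A_def add.commute)
    finally show ?case .
  qed simp
  have "(\<integral>z. Max ((\<lambda>t. \<Sum>i\<in>I. d t (z i)) ` T) \<partial>?PP)
      = (\<integral>z. rad T (\<lambda>t i. d t (z i)) is (\<lambda>_. 0) \<partial>?PP)"
    using step3[of "is" "{}"] dist by (simp add: I_def)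
  also have "\<dots> \<le> (\<integral>z. rad T (\<lambda>t i. h t (snd (z i))) is (\<lambda>_. 0) + rad T (\<lambda>t i. h t (fst (z i))) is (\<lambda>_. 0) \<partial>?PP)"
  proof (rule integral_mono)
    show "integrable ?PP (\<lambda>z. rad T (\<lambda>t i. d t (z i)) is (\<lambda>_. 0))"
      using T dint PPc by (intro integrable_rad) (auto simp: I_def)
    show "integrable ?PP (\<lambda>z. rad T (\<lambda>t i. h t (snd (z i))) is (\<lambda>_. 0) + rad T (\<lambda>t i. h t (fst (z i))) is (\<lambda>_. 0))"
      using T PPc[OF h_snd] PPc[OF h_fst] by (intro integrable_rad Bochner_Integration.integrable_add) (auto simp: I_def)
    fix z
    have "rad T (\<lambda>t i. d t (z i)) is (\<lambda>_. 0)
        \<le> rad T (\<lambda>t i. h t (snd (z i))) is (\<lambda>_. 0) + rad T (\<lambda>t i. - h t (fst (z i))) is (\<lambda>_. 0)"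
      using rad_add[OF T, of "\<lambda>t i. h t (snd (z i))" "\<lambda>t i. - h t (fst (z i))" "is" "\<lambda>_. 0" "\<lambda>_. 0"]
      by (simp add: d_def)
    then show "rad T (\<lambda>t i. d t (z i)) is (\<lambda>_. 0)
        \<le> rad T (\<lambda>t i. h t (snd (z i))) is (\<lambda>_. 0) + rad T (\<lambda>t i. h t (fst (z i))) is (\<lambda>_. 0)"
      by (simp only: rad_uminus)
  qed
  also have "\<dots> = 2 * (\<integral>x. rad T (\<lambda>t i. h t (x i)) is (\<lambda>_. 0) \<partial>?P)"
  proof -
    define r where "r = (\<lambda>x. rad T (\<lambda>t i. h t (x i)) is (\<lambda>_. 0))"
    have r_int: "integrable ?P r"
      unfolding r_def using T hi by (intro integrable_rad) (auto simp: I_def)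
    then have rm: "r \<in> borel_measurable ?P" by auto
    have rf: "integrable (?P \<Otimes>\<^sub>M ?P) (\<lambda>p. r (fst p))"
    proof -
      have "integrable (distr (?P \<Otimes>\<^sub>M ?P) ?P fst) r" unfolding P.distr_pair_fst by (rule r_int)
      then show ?thesis by (subst (asm) integrable_distr_eq) (use rm in auto)
    qed
    have rs: "integrable (?P \<Otimes>\<^sub>M ?P) (\<lambda>p. r (snd p))"
      using R.integrable_product_swap[OF rf] by (simp add: case_prod_unfold)
    have "(\<integral>z. r (snd (pm z)) + r (fst (pm z)) \<partial>?PP) = (\<integral>p. r (snd p) + r (fst p) \<partial>(?P \<Otimes>\<^sub>M ?P))"
      by (subst pmR[symmetric]) (rule integral_distr[OF pm, symmetric], use rm in measurable)
    also have "\<dots> = (\<integral>p. r (snd p) \<partial>(?P \<Otimes>\<^sub>M ?P)) + (\<integral>p. r (fst p) \<partial>(?P \<Otimes>\<^sub>M ?P))"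
      using rf rs by simp
    also have "(\<integral>p. r (snd p) \<partial>(?P \<Otimes>\<^sub>M ?P)) = (\<integral>x. r x \<partial>?P)"
      using R.integral_fst'[OF rs] by (simp add: P.prob_space)
    also have "(\<integral>p. r (fst p) \<partial>(?P \<Otimes>\<^sub>M ?P)) = (\<integral>x. r x \<partial>?P)"
      using R.integral_fst'[OF rf] by (simp add: P.prob_space)
    finally have "(\<integral>z. r (snd (pm z)) + r (fst (pm z)) \<partial>?PP) = 2 * (\<integral>x. r x \<partial>?P)" by simp
    moreover have "r (snd (pm z)) = rad T (\<lambda>t i. h t (snd (z i))) is (\<lambda>_. 0)"
      "r (fst (pm z)) = rad T (\<lambda>t i. h t (fst (z i))) is (\<lambda>_. 0)" for z
      unfolding r_def pm_def by (rule rad_cong; simp add: I_def)+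
    ultimately show ?thesis by (simp add: r_def)
  qed
  finally show ?thesis using step1 step2 by linarith
qed

section \<open>Gaussian matrices acting on a cone\<close>

text \<open>The contraction argument handles finite index sets; all of \<open>augmented_ball\<close>
  is reached through finite pieces of such a set, followed by closure.\<close>

lemma countable_dense_subset:
  fixes S :: "'a :: second_countable_topology set"
  obtains D where "countable D" "D \<subseteq> S" "S \<subseteq> closure D"
proof -
  obtain B :: "'a set set" where B: "countable B" "topological_basis B"
    using ex_countable_basis by blast
  define D where "D = (\<lambda>U. SOME x. x \<in> U \<inter> S) ` {U \<in> B. U \<inter> S \<noteq> {}}"
  have pick: "(SOME x. x \<in> U \<inter> S) \<in> U \<inter> S" if "U \<inter> S \<noteq> {}" for U
  proof -
    have "\<exists>x. x \<in> U \<inter> S" using that by blast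
    then show ?thesis by (rule someI_ex)
  qed
  show ?thesis
  proof
    show "countable D" unfolding D_def using B(1) by (intro countable_image) auto
    show "D \<subseteq> S" unfolding D_def using pick by blast
    show "S \<subseteq> closure D"
    proof
      fix x assume x: "x \<in> S"
      show "x \<in> closure D"
        unfolding closure_iff_nhds_not_empty
      proof (intro allI impI)
        fix A V assume V: "V \<subseteq> A" "open V" "x \<in> V"
        obtain U where U: "U \<in> B" "x \<in> U" "U \<subseteq> V"
          using topological_basisE[OF B(2) V(2,3)] by blast
        then have "(SOME y. y \<in> U \<inter> S) \<in> D" "(SOME y. y \<in> U \<inter> S) \<in> U"
          using x pick[of U] by (auto simp: D_def)
        then show "D \<inter> A \<noteq> {}" using U V by blast
      qed
    qed
  qed
qed

text \<open>Jensen's inequality, read off from the nonnegativity of the variance of the square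
  root.\<close>

lemma (in prob_space) integral_sqrt_le:
  assumes f: "integrable M f" and nn: "\<And>x. 0 \<le> f x"
  shows "integrable M (\<lambda>x. sqrt (f x))" and "(\<integral>x. sqrt (f x) \<partial>M) \<le> sqrt (\<integral>x. f x \<partial>M)"
proof -
  have [measurable]: "f \<in> borel_measurable M" using f by auto
  have sq: "(\<lambda>x. (sqrt (f x))\<^sup>2) = f" using nn by auto
  have int2: "integrable M (\<lambda>x. (sqrt (f x))\<^sup>2)" unfolding sq by (rule f)
  show int: "integrable M (\<lambda>x. sqrt (f x))"
    by (rule square_integrable_imp_integrable[OF _ int2]) measurable
  have "0 \<le> variance (\<lambda>x. sqrt (f x))" by (rule variance_positive)
  also have "\<dots> = expectation f - (expectation (\<lambda>x. sqrt (f x)))\<^sup>2"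
    using variance_eq[OF int int2] unfolding sq .
  finally show "(\<integral>x. sqrt (f x) \<partial>M) \<le> sqrt (\<integral>x. f x \<partial>M)"
    by (intro real_le_rsqrt) simp
qed

text \<open>The square is not Lipschitz, so contraction cannot be applied to it. This function is
  \<open>2 * \<tau>\<close>-Lipschitz and lies below the square, and a lower bound for it passes to
  the square for free.\<close>

definition trunc_sq :: "real \<Rightarrow> real \<Rightarrow> real"
  where "trunc_sq \<tau> x = (min \<bar>x\<bar> \<tau>)\<^sup>2"

lemma trunc_sq_props:
  assumes \<tau>: "0 < \<tau>"
  shows trunc_sq_nonneg: "0 \<le> trunc_sq \<tau> x"
    and trunc_sq_le_sq: "trunc_sq \<tau> x \<le> x\<^sup>2"
    and trunc_sq_bounded: "trunc_sq \<tau> x \<le> \<tau>\<^sup>2"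
    and trunc_sq_lipschitz: "trunc_sq \<tau> x - trunc_sq \<tau> y \<le> \<bar>2 * \<tau> * x - 2 * \<tau> * y\<bar>"
    and trunc_sq_ge: "x\<^sup>2 - x ^ 4 / \<tau>\<^sup>2 \<le> trunc_sq \<tau> x"
proof -
  show "0 \<le> trunc_sq \<tau> x" by (simp add: trunc_sq_def)
  have "(min \<bar>x\<bar> \<tau>)\<^sup>2 \<le> \<bar>x\<bar>\<^sup>2" using \<tau> by (intro power_mono) auto
  then show "trunc_sq \<tau> x \<le> x\<^sup>2" by (simp add: trunc_sq_def)
  show "trunc_sq \<tau> x \<le> \<tau>\<^sup>2" unfolding trunc_sq_def using \<tau> by (intro power_mono) auto
  define u where "u = min \<bar>x\<bar> \<tau>"
  define v where "v = min \<bar>y\<bar> \<tau>"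
  have uv: "0 \<le> u" "u \<le> \<tau>" "0 \<le> v" "v \<le> \<tau>" using \<tau> by (auto simp: u_def v_def)
  have "\<bar>u - v\<bar> \<le> \<bar>x - y\<bar>" by (auto simp: u_def v_def min_def abs_if)
  have "trunc_sq \<tau> x - trunc_sq \<tau> y = (u + v) * (u - v)"
    by (simp add: trunc_sq_def u_def v_def power2_eq_square algebra_simps)
  also have "\<dots> \<le> (u + v) * \<bar>u - v\<bar>" using uv by (intro mult_left_mono) auto
  also have "\<dots> \<le> (2 * \<tau>) * \<bar>x - y\<bar>"
    using uv \<open>\<bar>u - v\<bar> \<le> \<bar>x - y\<bar>\<close> by (intro mult_mono) auto
  also have "\<dots> = \<bar>2 * \<tau> * x - 2 * \<tau> * y\<bar>"
    using \<tau> by (simp flip: right_diff_distrib add: abs_mult)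
  finally show "trunc_sq \<tau> x - trunc_sq \<tau> y \<le> \<bar>2 * \<tau> * x - 2 * \<tau> * y\<bar>" .
  show "x\<^sup>2 - x ^ 4 / \<tau>\<^sup>2 \<le> trunc_sq \<tau> x"
  proof (cases "\<bar>x\<bar> \<le> \<tau>")
    case True
    then show ?thesis by (simp add: trunc_sq_def min_absorb1)
  next
    case False
    then have "\<tau>\<^sup>2 \<le> \<bar>x\<bar>\<^sup>2" using \<tau> by (intro power_mono) auto
    then have "x\<^sup>2 * \<tau>\<^sup>2 \<le> x\<^sup>2 * x\<^sup>2" by (intro mult_left_mono) auto
    then have "x\<^sup>2 \<le> x ^ 4 / \<tau>\<^sup>2" using \<tau> by (simp add: pos_le_divide_eq power2_eq_square power4_eq_xxxx mult.assoc)
    moreover have "0 \<le> trunc_sq \<tau> x" by (simp add: trunc_sq_def)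
    ultimately show ?thesis by linarith
  qed
qed

lemma measurable_trunc_sq [measurable]: "trunc_sq \<tau> \<in> borel_measurable borel"
  unfolding trunc_sq_def by measurable

text \<open>Truncation costs at most \<open>x ^ 4 / \<tau>\<^sup>2\<close> pointwise. The 48 is
  \<open>2 ^ 4 * 3\<close>: the fourth Gaussian moment is 3, and the vectors of
  \<open>augmented_ball\<close> have norm at most 2.\<close>

lemma gauss1_trunc_sq:
  assumes \<tau>: "0 < \<tau>" and s: "0 \<le> s" "s \<le> 2"
  shows "s\<^sup>2 - 48 / \<tau>\<^sup>2 \<le> (\<integral>x. trunc_sq \<tau> (s * x) \<partial>gauss1)"
proof -
  interpret G: prob_space gauss1 by (rule prob_space_gauss1)
  have i2: "integrable gauss1 (\<lambda>x. x\<^sup>2)" and i4: "integrable gauss1 (\<lambda>x. x ^ 4)" by (rule gauss1_moments)+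
  have e4: "(\<integral>x. x ^ 4 \<partial>gauss1) = 3"
    using integral_std_normal_moment_even[of 2] unfolding gauss1_def
    by (subst integral_density) (auto simp: fact_numeral)
  have [measurable]: "(\<lambda>x. trunc_sq \<tau> (s * x)) \<in> borel_measurable gauss1" by measurable
  have it: "integrable gauss1 (\<lambda>x. trunc_sq \<tau> (s * x))"
    by (rule G.integrable_const_bound[where B = "\<tau>\<^sup>2"]) (use trunc_sq_nonneg[OF \<tau>] trunc_sq_bounded[OF \<tau>] in auto)
  have "s ^ 4 \<le> 2 ^ 4" using s by (intro power_mono) auto
  then have "s ^ 4 * 3 / \<tau>\<^sup>2 \<le> 48 / \<tau>\<^sup>2" by (intro divide_right_mono) auto
  moreover have "s\<^sup>2 - s ^ 4 * 3 / \<tau>\<^sup>2 = (\<integral>x. s\<^sup>2 * x\<^sup>2 - (s ^ 4 / \<tau>\<^sup>2) * x ^ 4 \<partial>gauss1)"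
    using i2 i4 by (simp add: gauss1_moments(3) e4)
  moreover have "\<dots> \<le> (\<integral>x. trunc_sq \<tau> (s * x) \<partial>gauss1)"
  proof (rule integral_mono[OF _ it])
    show "integrable gauss1 (\<lambda>x. s\<^sup>2 * x\<^sup>2 - (s ^ 4 / \<tau>\<^sup>2) * x ^ 4)" using i2 i4 by simp
    show "s\<^sup>2 * x\<^sup>2 - (s ^ 4 / \<tau>\<^sup>2) * x ^ 4 \<le> trunc_sq \<tau> (s * x)" for x
      using trunc_sq_ge[OF \<tau>, of "s * x"] by (simp add: power_mult_distrib)
  qed
  ultimately show ?thesis by linarith
qed

section \<open>Gaussian matrices: rows, columns and linear images\<close>

locale gaussian_matrix = prob_space M for M :: "'a measure" +
  fixes I J :: "nat set" and Z :: "'a \<Rightarrow> nat \<Rightarrow> nat \<Rightarrow> real"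
  assumes finI: "finite I" and neI: "I \<noteq> {}" and finJ: "finite J" and neJ: "J \<noteq> {}"
    and indep: "indep_vars (\<lambda>_. borel) (\<lambda>(i, j) \<omega>. Z \<omega> i j) (I \<times> J)"
    and dist: "\<And>i j. i \<in> I \<Longrightarrow> j \<in> J \<Longrightarrow> distr M borel (\<lambda>\<omega>. Z \<omega> i j) = gauss1"
begin

lemma entry_measurable: "i \<in> I \<Longrightarrow> j \<in> J \<Longrightarrow> (\<lambda>\<omega>. Z \<omega> i j) \<in> borel_measurable M"
  using indep by (auto simp: indep_vars_def)

text \<open>Functions of disjoint sets of entries are independent. Rows, columns and single entries
  of a row or column are all obtained by a choice of \<open>K\<close>.\<close>

lemma indep_blocks:
  assumes K: "\<And>k. k \<in> L \<Longrightarrow> K k \<subseteq> I \<times> J" "disjoint_family_on K L"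
    and Y: "\<And>k. k \<in> L \<Longrightarrow> Y k \<in> measurable (PiM (K k) (\<lambda>_. borel)) (N k)"
    and eq: "\<And>k \<omega>. k \<in> L \<Longrightarrow> V k \<omega> = Y k (\<lambda>p\<in>K k. Z \<omega> (fst p) (snd p))"
  shows "indep_vars N V L"
proof -
  have "indep_vars (\<lambda>k. PiM (K k) (\<lambda>_. borel)) (\<lambda>k \<omega>. restrict (\<lambda>p. (case p of (i, j) \<Rightarrow> \<lambda>\<omega>. Z \<omega> i j) \<omega>) (K k)) L"
    by (rule indep_vars_restrict[OF indep K])
  then have "indep_vars N (\<lambda>k \<omega>. Y k (restrict (\<lambda>p. (case p of (i, j) \<Rightarrow> \<lambda>\<omega>. Z \<omega> i j) \<omega>) (K k))) L"
    by (rule indep_vars_compose2) (rule Y)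
  then show ?thesis
    by (subst indep_vars_cong[OF refl _ refl, where Y = "\<lambda>k \<omega>. Y k (restrict (\<lambda>p. (case p of (i, j) \<Rightarrow> \<lambda>\<omega>. Z \<omega> i j) \<omega>) (K k))"])
       (auto simp: eq case_prod_unfold fun_eq_iff)
qed

text \<open>The entries of one column combine to a normal with standard deviation
  \<open>L2_set u I\<close>, and distinct columns use disjoint entries. Stating the law as an image
  of \<open>std_gaussian J\<close> includes \<open>u = 0\<close>. It is applied to sign vectors and
  to frozen noise.\<close>

lemma distr_left:
  "distr M (std_gaussian J) (\<lambda>\<omega>. \<lambda>j\<in>J. \<Sum>i\<in>I. u i * Z \<omega> i j)
    = distr (std_gaussian J) (std_gaussian J) (\<lambda>g. \<lambda>j\<in>J. L2_set u I * g j)"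
proof -
  have meas: "(\<lambda>\<omega>. \<Sum>i\<in>I. u i * Z \<omega> i j) \<in> borel_measurable M" if "j \<in> J" for j
    using entry_measurable that by measurable
  have ind: "indep_vars (\<lambda>_. gauss1) (\<lambda>j \<omega>. \<Sum>i\<in>I. u i * Z \<omega> i j) J"
  proof (rule indep_blocks[where K = "\<lambda>j. I \<times> {j}" and Y = "\<lambda>j f. \<Sum>i\<in>I. u i * f (i, j)"])
    show "disjoint_family_on (\<lambda>j. I \<times> {j}) J" by (auto simp: disjoint_family_on_def)
    fix j assume j: "j \<in> J"
    show "(\<lambda>f. \<Sum>i\<in>I. u i * f (i, j)) \<in> measurable (PiM (I \<times> {j}) (\<lambda>_. borel)) gauss1"
      by (simp cong: measurable_cong_sets)
    show "(\<Sum>i\<in>I. u i * Z \<omega> i j) = (\<Sum>i\<in>I. u i * (\<lambda>p\<in>I \<times> {j}. Z \<omega> (fst p) (snd p)) (i, j))" for \<omega>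
      by simp
  qed auto
  have col: "distr M gauss1 (\<lambda>\<omega>. \<Sum>i\<in>I. u i * Z \<omega> i j) = distr gauss1 gauss1 (\<lambda>x. L2_set u I * x)"
    if j: "j \<in> J" for j
  proof -
    have "indep_vars (\<lambda>_. borel) (\<lambda>i \<omega>. Z \<omega> i j) I"
    proof (rule indep_blocks[where K = "\<lambda>i. {(i, j)}" and Y = "\<lambda>i f. f (i, j)"])
      show "disjoint_family_on (\<lambda>i. {(i, j)}) I" by (auto simp: disjoint_family_on_def)
    qed (use j in auto)
    moreover have "distr M borel (\<lambda>\<omega>. Z \<omega> i j) = distr gauss1 borel (\<lambda>x. 1 * x)" if "i \<in> I" for i
      using dist[OF that j] by (simp add: distr_id2)
    ultimately have "distr M borel (\<lambda>\<omega>. \<Sum>i\<in>I. u i * Z \<omega> i j) = distr gauss1 borel (\<lambda>x. 1 * L2_set u I * x)"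
      by (intro distr_normal_linear_comb[OF finI]) auto
    moreover have "distr M gauss1 (\<lambda>\<omega>. \<Sum>i\<in>I. u i * Z \<omega> i j) = distr M borel (\<lambda>\<omega>. \<Sum>i\<in>I. u i * Z \<omega> i j)"
      "distr gauss1 gauss1 (\<lambda>x. L2_set u I * x) = distr gauss1 borel (\<lambda>x. L2_set u I * x)"
      by (rule distr_cong; simp)+
    ultimately show ?thesis by simp
  qed
  have "distr M (std_gaussian J) (\<lambda>\<omega>. \<lambda>j\<in>J. \<Sum>i\<in>I. u i * Z \<omega> i j)
      = PiM J (\<lambda>j. distr M gauss1 (\<lambda>\<omega>. \<Sum>i\<in>I. u i * Z \<omega> i j))"
    unfolding std_gaussian_eq
    by (subst indep_vars_iff_distr_eq_PiM'[THEN iffD1, OF neJ _ ind])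
       (use meas in \<open>auto cong: measurable_cong_sets\<close>)
  also have "\<dots> = PiM J (\<lambda>j. distr gauss1 gauss1 (\<lambda>x. L2_set u I * x))"
    by (rule PiM_cong) (simp_all add: col)
  also have "\<dots> = distr (std_gaussian J) (std_gaussian J) (\<lambda>g. \<lambda>j\<in>J. L2_set u I * g j)"
    unfolding std_gaussian_eq
    by (rule distr_PiM_map[symmetric]) (auto simp: finJ prob_space_gauss1 cong: measurable_cong_sets)
  finally show ?thesis .
qed

lemma measurable_left: "(\<lambda>\<omega>. \<lambda>j\<in>J. \<Sum>i\<in>I. u i * Z \<omega> i j) \<in> measurable M (std_gaussian J)"
  unfolding std_gaussian_eq
proof (rule measurable_restrict)
  fix j assume "j \<in> J"
  then have "(\<lambda>\<omega>. \<Sum>i\<in>I. u i * Z \<omega> i j) \<in> borel_measurable M" using entry_measurable by measurable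
  then show "(\<lambda>\<omega>. \<Sum>i\<in>I. u i * Z \<omega> i j) \<in> measurable M gauss1" by (simp cong: measurable_cong_sets)
qed

lemma measurable_rows: "(\<lambda>\<omega>. \<lambda>i\<in>I. \<lambda>j\<in>J. Z \<omega> i j) \<in> measurable M (PiM I (\<lambda>_. std_gaussian J))"
  unfolding std_gaussian_eq
proof (intro measurable_restrict)
  fix i j assume "i \<in> I" "j \<in> J"
  then show "(\<lambda>\<omega>. Z \<omega> i j) \<in> measurable M gauss1"
    using entry_measurable by (simp cong: measurable_cong_sets)
qed

text \<open>Puts the matrix into the form used by \<open>symmetrization\<close>: an i.i.d. sample of
  standard Gaussian vectors indexed by \<open>I\<close>.\<close>

lemma distr_rows: "distr M (PiM I (\<lambda>_. std_gaussian J)) (\<lambda>\<omega>. \<lambda>i\<in>I. \<lambda>j\<in>J. Z \<omega> i j) = PiM I (\<lambda>_. std_gaussian J)"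
proof -
  have row_meas: "(\<lambda>\<omega>. \<lambda>j\<in>J. Z \<omega> i j) \<in> measurable M (std_gaussian J)" if "i \<in> I" for i
    unfolding std_gaussian_eq
  proof (intro measurable_restrict)
    fix j assume "j \<in> J"
    then show "(\<lambda>\<omega>. Z \<omega> i j) \<in> measurable M gauss1"
      using entry_measurable that by (simp cong: measurable_cong_sets)
  qed
  have ind: "indep_vars (\<lambda>_. std_gaussian J) (\<lambda>i \<omega>. \<lambda>j\<in>J. Z \<omega> i j) I"
  proof (rule indep_blocks[where K = "\<lambda>i. {i} \<times> J" and Y = "\<lambda>i f. \<lambda>j\<in>J. f (i, j)"])
    show "disjoint_family_on (\<lambda>i. {i} \<times> J) I" by (auto simp: disjoint_family_on_def)
    fix i assume i: "i \<in> I"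
    show "(\<lambda>f. \<lambda>j\<in>J. f (i, j)) \<in> measurable (PiM ({i} \<times> J) (\<lambda>_. borel)) (std_gaussian J)"
      unfolding std_gaussian_eq
    proof (intro measurable_restrict)
      fix j assume "j \<in> J"
      then have "(\<lambda>f. f (i, j)) \<in> borel_measurable (PiM ({i} \<times> J) (\<lambda>_. borel))"
        by (intro measurable_component_singleton) auto
      then show "(\<lambda>f. f (i, j)) \<in> measurable (PiM ({i} \<times> J) (\<lambda>_. borel)) gauss1"
        by (simp cong: measurable_cong_sets)
    qed
    show "(\<lambda>j\<in>J. Z \<omega> i j) = (\<lambda>j\<in>J. (\<lambda>p\<in>{i} \<times> J. Z \<omega> (fst p) (snd p)) (i, j))" for \<omega>
      by (auto simp: fun_eq_iff)
  qed auto
  have row: "distr M (std_gaussian J) (\<lambda>\<omega>. \<lambda>j\<in>J. Z \<omega> i j) = std_gaussian J" if i: "i \<in> I" for i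
  proof -
    have "indep_vars (\<lambda>_. gauss1) (\<lambda>j \<omega>. Z \<omega> i j) J"
    proof (rule indep_blocks[where K = "\<lambda>j. {(i, j)}" and Y = "\<lambda>j f. f (i, j)"])
      show "disjoint_family_on (\<lambda>j. {(i, j)}) J" by (auto simp: disjoint_family_on_def)
      show "(\<lambda>f. f (i, j)) \<in> measurable (PiM {(i, j)} (\<lambda>_. borel)) gauss1" for j
        by (simp cong: measurable_cong_sets)
    qed (use i in auto)
    then have "distr M (PiM J (\<lambda>_. gauss1)) (\<lambda>\<omega>. \<lambda>j\<in>J. Z \<omega> i j) = PiM J (\<lambda>j. distr M gauss1 (\<lambda>\<omega>. Z \<omega> i j))"
      by (subst indep_vars_iff_distr_eq_PiM'[THEN iffD1, OF neJ])
         (use i entry_measurable in \<open>auto cong: measurable_cong_sets\<close>)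
    also have "\<dots> = PiM J (\<lambda>_. gauss1)"
    proof (rule PiM_cong[OF refl])
      fix j assume "j \<in> J"
      have "distr M gauss1 (\<lambda>\<omega>. Z \<omega> i j) = distr M borel (\<lambda>\<omega>. Z \<omega> i j)" by (rule distr_cong) simp_all
      then show "distr M gauss1 (\<lambda>\<omega>. Z \<omega> i j) = gauss1" using dist[OF i \<open>j \<in> J\<close>] by simp
    qed
    finally show ?thesis by (simp add: std_gaussian_eq)
  qed
  have "distr M (PiM I (\<lambda>_. std_gaussian J)) (\<lambda>\<omega>. \<lambda>i\<in>I. \<lambda>j\<in>J. Z \<omega> i j)
      = PiM I (\<lambda>i. distr M (std_gaussian J) (\<lambda>\<omega>. \<lambda>j\<in>J. Z \<omega> i j))"
    by (subst indep_vars_iff_distr_eq_PiM'[THEN iffD1, OF neI row_meas ind]) auto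
  also have "\<dots> = PiM I (\<lambda>_. std_gaussian J)" by (rule PiM_cong) (simp_all add: row)
  finally show ?thesis .
qed

lemma measurable_row_inner: "i \<in> I \<Longrightarrow> (\<lambda>\<omega>. inner_on J t (Z \<omega> i)) \<in> borel_measurable M"
  by (rule measurable_inner_on) (auto intro: entry_measurable)

lemma integral_left:
  fixes F :: "(nat \<Rightarrow> real) \<Rightarrow> real"
  assumes "F \<in> borel_measurable (std_gaussian J)"
  shows "(\<integral>\<omega>. F (\<lambda>j\<in>J. \<Sum>i\<in>I. u i * Z \<omega> i j) \<partial>M) = (\<integral>g. F (\<lambda>j\<in>J. L2_set u I * g j) \<partial>std_gaussian J)"
    and "integrable M (\<lambda>\<omega>. F (\<lambda>j\<in>J. \<Sum>i\<in>I. u i * Z \<omega> i j))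
      \<longleftrightarrow> integrable (std_gaussian J) (\<lambda>g. F (\<lambda>j\<in>J. L2_set u I * g j))"
proof -
  have sm: "(\<lambda>g. \<lambda>j\<in>J. L2_set u I * g j) \<in> measurable (std_gaussian J) (std_gaussian J)"
    unfolding std_gaussian_eq
  proof (rule measurable_restrict)
    fix j assume j: "j \<in> J"
    have "(\<lambda>g. L2_set u I * g j) \<in> borel_measurable (std_gaussian J)"
      by (intro borel_measurable_times measurable_std_gaussian_coord j) simp
    then show "(\<lambda>g. L2_set u I * g j) \<in> measurable (PiM J (\<lambda>_. gauss1)) gauss1"
      by (simp add: std_gaussian_eq cong: measurable_cong_sets)
  qed
  show "(\<integral>\<omega>. F (\<lambda>j\<in>J. \<Sum>i\<in>I. u i * Z \<omega> i j) \<partial>M) = (\<integral>g. F (\<lambda>j\<in>J. L2_set u I * g j) \<partial>std_gaussian J)"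
    using integral_distr[OF measurable_left assms, of u] integral_distr[OF sm assms]
    by (simp add: distr_left)
  show "integrable M (\<lambda>\<omega>. F (\<lambda>j\<in>J. \<Sum>i\<in>I. u i * Z \<omega> i j))
      \<longleftrightarrow> integrable (std_gaussian J) (\<lambda>g. F (\<lambda>j\<in>J. L2_set u I * g j))"
    using integrable_distr_eq[OF measurable_left assms, of u] integrable_distr_eq[OF sm assms]
    by (simp add: distr_left)
qed

text \<open>
  The index set of the empirical process controlled below: directions of the cone, perturbed
  by a multiple of one fixed vector. Its Gaussian width exceeds that of the cone by at most one,
  whereas the linear span of the two could have a far larger width.
\<close>

definition augmented_ball :: "(nat \<Rightarrow> real) set \<Rightarrow> (nat \<Rightarrow> real) \<Rightarrow> (nat \<Rightarrow> real) set"
  where "augmented_ball C e = {s *\<^sub>R e + v | s v. \<bar>s\<bar> \<le> 1 \<and> v \<in> C \<and> L2_set v J \<le> 1}"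

section \<open>Width of the augmented ball and a uniform lower isometry\<close>

context
  fixes C :: "(nat \<Rightarrow> real) set" and e :: "nat \<Rightarrow> real"
  assumes C: "closed_cone_on J C" and e: "L2_set e J \<le> 1"
begin

interpretation C: closed_cone_on J C by (rule C)
interpretation S: prob_space "std_gaussian J" by (rule prob_space_std_gaussian)

text \<open>An upper bound for the support function of \<open>augmented_ball C e\<close> at g: one
  term for the multiples of \<open>e\<close>, one for the unit ball of the cone. Being positively
  homogeneous in g, it scales with the norm of the sign vector.\<close>

abbreviation (input) "width g \<equiv> \<bar>inner_on J g e\<bar> + sqrt (C.proj_sq g)"

lemma inner_augmented_le:
  assumes "t \<in> augmented_ball C e" shows "inner_on J g t \<le> width g"
proof -
  obtain s v where t: "t = s *\<^sub>R e + v" "\<bar>s\<bar> \<le> 1" "v \<in> C" "L2_set v J \<le> 1"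
    using assms by (auto simp: augmented_ball_def)
  have "s * inner_on J g e \<le> \<bar>s\<bar> * \<bar>inner_on J g e\<bar>" by (metis abs_ge_self abs_mult)
  also have "\<dots> \<le> 1 * \<bar>inner_on J g e\<bar>" using t by (intro mult_right_mono) auto
  finally have "s * inner_on J g e \<le> \<bar>inner_on J g e\<bar>" by simp
  moreover have "inner_on J g v \<le> sqrt (C.proj_sq g) * L2_set v J" by (rule C.inner_le_sqrt_proj_sq) fact
  moreover have "sqrt (C.proj_sq g) * L2_set v J \<le> sqrt (C.proj_sq g) * 1" using t by (intro mult_left_mono) auto
  ultimately show ?thesis by (simp add: t(1) inner_on_simps)
qed

lemma augmented_L2_le: "t \<in> augmented_ball C e \<Longrightarrow> L2_set t J \<le> 2"
proof -
  assume "t \<in> augmented_ball C e"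
  then obtain s v where t: "t = s *\<^sub>R e + v" "\<bar>s\<bar> \<le> 1" "v \<in> C" "L2_set v J \<le> 1"
    by (auto simp: augmented_ball_def)
  have "L2_set t J \<le> \<bar>s\<bar> * L2_set e J + L2_set v J"
    unfolding t(1) using L2_set_triangle_add[of "s *\<^sub>R e" v J] by (simp add: L2_set_scaleR)
  also have "\<dots> \<le> 1 * 1 + 1" using t e by (intro add_mono mult_mono) auto
  finally show ?thesis by simp
qed

lemma width_integral:
  shows "integrable (std_gaussian J) (\<lambda>g. width g)"
    and "(\<integral>g. width g \<partial>std_gaussian J) \<le> 1 + sqrt (stat_dim J C)"
proof -
  have i1: "integrable (std_gaussian J) (\<lambda>g. (inner_on J e g)\<^sup>2)"
    using integral_std_gaussian_inner(2)[OF finJ, of "\<lambda>z. z\<^sup>2" e] gauss1_moments(1)[of 2]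
    by (simp add: power_mult_distrib)
  have a: "integrable (std_gaussian J) (\<lambda>g. \<bar>inner_on J g e\<bar>)"
    "(\<integral>g. \<bar>inner_on J g e\<bar> \<partial>std_gaussian J) \<le> sqrt (inner_on J e e)"
  proof -
    have comm: "(\<lambda>g. \<bar>inner_on J g e\<bar>) = (\<lambda>g. \<bar>inner_on J e g\<bar>)" by (simp add: inner_on_commute)
    show "integrable (std_gaussian J) (\<lambda>g. \<bar>inner_on J g e\<bar>)"
      "(\<integral>g. \<bar>inner_on J g e\<bar> \<partial>std_gaussian J) \<le> sqrt (inner_on J e e)"
      unfolding comm using S.integral_sqrt_le[OF i1] by (simp_all add: integral_std_gaussian_inner_sq[OF finJ])
  qed
  have b: "integrable (std_gaussian J) (\<lambda>g. sqrt (C.proj_sq g))"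
    "(\<integral>g. sqrt (C.proj_sq g) \<partial>std_gaussian J) \<le> sqrt (stat_dim J C)"
    using S.integral_sqrt_le[OF C.integrable_proj_sq] by (simp_all add: C.stat_dim_eq)
  show "integrable (std_gaussian J) (\<lambda>g. width g)" using a b by simp
  have "sqrt (inner_on J e e) \<le> 1" using e by (simp only: L2_set_eq_sqrt_inner)
  moreover have "(\<integral>g. width g \<partial>std_gaussian J)
      = (\<integral>g. \<bar>inner_on J g e\<bar> \<partial>std_gaussian J) + (\<integral>g. sqrt (C.proj_sq g) \<partial>std_gaussian J)"
    by (rule Bochner_Integration.integral_add) (rule a b)+
  ultimately show "(\<integral>g. width g \<partial>std_gaussian J) \<le> 1 + sqrt (stat_dim J C)"
    using a(2) b(2) by linarith
qed

text \<open>Every sign vector has norm \<open>sqrt (card I)\<close>, so the law of the signed sum of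
  rows does not depend on the signs. This is the bound at each leaf of the recursion of
  \<open>rad\<close>.\<close>

lemma width_left:
  assumes u: "\<And>i. i \<in> I \<Longrightarrow> \<bar>u i\<bar> = 1"
  shows "integrable M (\<lambda>\<omega>. width (\<lambda>j\<in>J. \<Sum>i\<in>I. u i * Z \<omega> i j))"
    and "(\<integral>\<omega>. width (\<lambda>j\<in>J. \<Sum>i\<in>I. u i * Z \<omega> i j) \<partial>M) \<le> sqrt (real (card I)) * (1 + sqrt (stat_dim J C))"
proof -
  have "(\<Sum>i\<in>I. (u i)\<^sup>2) = (\<Sum>i\<in>I. 1)"
  proof (rule sum.cong[OF refl])
    fix i assume "i \<in> I"
    then have "\<bar>u i\<bar>\<^sup>2 = 1" using u by simp
    then show "(u i)\<^sup>2 = 1" by simp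
  qed
  then have L: "L2_set u I = sqrt (real (card I))" by (simp add: L2_set_def)
  define c where "c = sqrt (real (card I))"
  have c: "0 \<le> c" by (simp add: c_def)
  have hom: "width (\<lambda>j\<in>J. c * g j) = c * width g" for g
  proof -
    have "inner_on J (\<lambda>j\<in>J. c * g j) e = inner_on J (c *\<^sub>R g) e" by (simp add: inner_on_def)
    moreover have "C.proj_sq (\<lambda>j\<in>J. c * g j) = C.proj_sq (c *\<^sub>R g)" by (rule C.proj_sq_cong) simp
    ultimately show ?thesis using c
      by (simp add: inner_on_simps abs_mult C.proj_sq_scaleR real_sqrt_mult algebra_simps)
  qed
  have m: "(\<lambda>g. width g) \<in> borel_measurable (std_gaussian J)" using width_integral(1) by auto
  show "integrable M (\<lambda>\<omega>. width (\<lambda>j\<in>J. \<Sum>i\<in>I. u i * Z \<omega> i j))"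
    unfolding integral_left(2)[OF m] L c_def[symmetric] hom using width_integral(1) by (rule integrable_mult_right)
  have "(\<integral>\<omega>. width (\<lambda>j\<in>J. \<Sum>i\<in>I. u i * Z \<omega> i j) \<partial>M) = c * (\<integral>g. width g \<partial>std_gaussian J)"
    unfolding integral_left(1)[OF m] L c_def[symmetric] hom by (rule integral_mult_right_zero)
  also have "\<dots> \<le> c * (1 + sqrt (stat_dim J C))" by (intro mult_left_mono width_integral c)
  finally show "(\<integral>\<omega>. width (\<lambda>j\<in>J. \<Sum>i\<in>I. u i * Z \<omega> i j) \<partial>M) \<le> sqrt (real (card I)) * (1 + sqrt (stat_dim J C))"
    by (simp add: c_def)
qed

text \<open>The signs are frozen before the matrix is integrated. \<open>K\<close> and
  \<open>u\<close> record the indices already given a sign and these signs. Once no index remains,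
  the signed sum is linear in t and \<open>width_left\<close> gives the same bound for every sign
  pattern, hence for the average.\<close>

lemma rad_linear_bound:
  assumes T: "finite T" "T \<noteq> {}" "T \<subseteq> augmented_ball C e" and a: "0 \<le> a"
    and js: "distinct js" "set js \<inter> K = {}" "set js \<union> K = I" and u: "\<And>i. i \<in> K \<Longrightarrow> \<bar>u i\<bar> = 1"
  shows "(\<integral>\<omega>. rad T (\<lambda>t i. a * inner_on J t (Z \<omega> i)) js (\<lambda>t. \<Sum>i\<in>K. u i * (a * inner_on J t (Z \<omega> i))) \<partial>M)
    \<le> a * (sqrt (real (card I)) * (1 + sqrt (stat_dim J C)))"
  using js u
proof (induction js arbitrary: K u)
  case Nil
  then have K: "K = I" by simp
  define z where "z = (\<lambda>\<omega>. \<lambda>j\<in>J. \<Sum>i\<in>I. u i * Z \<omega> i j)"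
  have eq: "(\<Sum>i\<in>I. u i * (a * inner_on J t (Z \<omega> i))) = a * inner_on J (z \<omega>) t" for t \<omega>
  proof -
    have "inner_on J (z \<omega>) t = (\<Sum>j\<in>J. \<Sum>i\<in>I. u i * Z \<omega> i j * t j)"
      by (simp add: inner_on_def z_def sum_distrib_right)
    also have "\<dots> = (\<Sum>i\<in>I. \<Sum>j\<in>J. u i * Z \<omega> i j * t j)" by (rule sum.swap)
    also have "\<dots> = (\<Sum>i\<in>I. u i * inner_on J t (Z \<omega> i))"
      by (simp add: inner_on_def sum_distrib_left mult_ac)
    finally show ?thesis by (simp add: sum_distrib_left mult_ac)
  qed
  have zm: "(\<lambda>\<omega>. z \<omega> j) \<in> borel_measurable M" if "j \<in> J" for j
    using entry_measurable that by (simp add: z_def)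
  have lin: "integrable M (\<lambda>\<omega>. a * inner_on J (z \<omega>) t)" if "t \<in> T" for t
  proof -
    have "(\<lambda>g. (inner_on J t g)) \<in> borel_measurable (std_gaussian J)"
      by (rule measurable_inner_on) (auto intro: measurable_std_gaussian_coord)
    moreover have "integrable (std_gaussian J) (\<lambda>g. inner_on J t g)"
      using integral_std_gaussian_inner(2)[OF finJ, of "\<lambda>z. z" t] gauss1_moments(1)[of 1] by simp
    then have "integrable (std_gaussian J) (\<lambda>g. L2_set u I * inner_on J t g)" by simp
    then have "integrable (std_gaussian J) (\<lambda>g. inner_on J t (\<lambda>j\<in>J. L2_set u I * g j))"
      by (simp add: inner_on_def sum_distrib_left mult_ac)
    ultimately have "integrable M (\<lambda>\<omega>. inner_on J t (z \<omega>))"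
      unfolding z_def by (subst integral_left(2))
    then show ?thesis by (simp add: inner_on_commute)
  qed
  have "(\<integral>\<omega>. Max ((\<lambda>t. a * inner_on J (z \<omega>) t) ` T) \<partial>M) \<le> (\<integral>\<omega>. a * width (z \<omega>) \<partial>M)"
  proof (rule integral_mono)
    show "integrable M (\<lambda>\<omega>. Max ((\<lambda>t. a * inner_on J (z \<omega>) t) ` T))" by (rule integrable_Max[OF T(1,2) lin])
    show "integrable M (\<lambda>\<omega>. a * width (z \<omega>))"
      unfolding z_def by (rule integrable_mult_right, rule width_left(1)) (use Nil K in auto)
    show "Max ((\<lambda>t. a * inner_on J (z \<omega>) t) ` T) \<le> a * width (z \<omega>)" for \<omega>
      using T a inner_augmented_le by (auto intro!: Max.boundedI mult_left_mono)
  qed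
  also have "\<dots> = a * (\<integral>\<omega>. width (z \<omega>) \<partial>M)" by (rule integral_mult_right_zero)
  also have "\<dots> \<le> a * (sqrt (real (card I)) * (1 + sqrt (stat_dim J C)))"
    unfolding z_def using Nil K by (intro mult_left_mono width_left a) auto
  finally show ?case by (simp add: K eq)
next
  case (Cons i js)
  have i: "i \<in> I" "i \<notin> K" "i \<notin> set js" and finK: "finite K" and sub: "set js \<subseteq> I" "K \<subseteq> I"
    using Cons.prems finI by (auto intro: finite_subset)
  let ?r = "\<lambda>s \<omega>. rad T (\<lambda>t i. a * inner_on J t (Z \<omega> i)) js
      (\<lambda>t. \<Sum>k\<in>insert i K. (u(i := s)) k * (a * inner_on J t (Z \<omega> k)))"
  have step: "(\<integral>\<omega>. ?r s \<omega> \<partial>M) \<le> a * (sqrt (real (card I)) * (1 + sqrt (stat_dim J C)))" if "\<bar>s\<bar> = 1" for s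
    using Cons.prems that by (intro Cons.IH) auto
  have lin: "integrable M (\<lambda>\<omega>. a * inner_on J t (Z \<omega> k))" if k: "k \<in> I" for t k
  proof -
    have "integrable M (\<lambda>\<omega>. Z \<omega> k j)" if j: "j \<in> J" for j
    proof -
      have "integrable (distr M borel (\<lambda>\<omega>. Z \<omega> k j)) (\<lambda>x. x)"
        using gauss1_moments(1)[of 1] by (simp add: dist[OF k j])
      then show ?thesis by (subst (asm) integrable_distr_eq) (use entry_measurable k j in auto)
    qed
    then show ?thesis unfolding inner_on_def by simp
  qed
  have rint: "integrable M (?r s)" for s
    using T sub i lin by (intro integrable_rad) (auto intro!: Bochner_Integration.integrable_sum Bochner_Integration.integrable_add integrable_mult_right)
  have e: "(\<Sum>k\<in>insert i K. (u(i := s)) k * (a * inner_on J t (Z \<omega> k)))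
      = (\<Sum>k\<in>K. u k * (a * inner_on J t (Z \<omega> k))) + s * (a * inner_on J t (Z \<omega> i))" for s t \<omega>
  proof -
    have "(\<Sum>k\<in>K. (u(i := s)) k * (a * inner_on J t (Z \<omega> k))) = (\<Sum>k\<in>K. u k * (a * inner_on J t (Z \<omega> k)))"
      using i by (intro sum.cong) auto
    then show ?thesis using i finK by simp
  qed
  have "(\<integral>\<omega>. rad T (\<lambda>t i. a * inner_on J t (Z \<omega> i)) (i # js) (\<lambda>t. \<Sum>i\<in>K. u i * (a * inner_on J t (Z \<omega> i))) \<partial>M)
      = (\<integral>\<omega>. (?r 1 \<omega> + ?r (-1) \<omega>) / 2 \<partial>M)"
    unfolding rad.simps e by simp
  also have "\<dots> = ((\<integral>\<omega>. ?r 1 \<omega> \<partial>M) + (\<integral>\<omega>. ?r (-1) \<omega> \<partial>M)) / 2"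
    by (simp only: integral_divide_zero Bochner_Integration.integral_add[OF rint rint])
  also have "\<dots> \<le> a * (sqrt (real (card I)) * (1 + sqrt (stat_dim J C)))"
    using step[of 1] step[of "-1"] by simp
  finally show ?case .
qed

text \<open>The factor \<open>4 * \<tau>\<close> is 2 from symmetrization times the Lipschitz
  constant \<open>2 * \<tau>\<close> of \<open>trunc_sq\<close>, which contraction moves onto the
  linear process.\<close>

lemma empirical_process_bound:
  assumes \<tau>: "0 < \<tau>" and T: "finite T" "T \<noteq> {}" "T \<subseteq> augmented_ball C e"
  defines "V \<equiv> \<lambda>\<omega>. Max ((\<lambda>t. \<Sum>i\<in>I. (\<integral>y. trunc_sq \<tau> (inner_on J t y) \<partial>std_gaussian J)
      - trunc_sq \<tau> (inner_on J t (Z \<omega> i))) ` T)"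
  shows "integrable M V" and "(\<integral>\<omega>. V \<omega> \<partial>M) \<le> 4 * \<tau> * (sqrt (real (card I)) * (1 + sqrt (stat_dim J C)))"
proof -
  let ?P = "PiM I (\<lambda>_. std_gaussian J)"
  define rows where "rows = (\<lambda>\<omega>. \<lambda>i\<in>I. \<lambda>j\<in>J. Z \<omega> i j)"
  have rows: "rows \<in> measurable M ?P" "distr M ?P rows = ?P"
    using measurable_rows distr_rows by (simp_all add: rows_def)
  obtain js where js: "distinct js" "set js = I" using finite_distinct_list[OF finI] by blast
  define h where "h = (\<lambda>t y. trunc_sq \<tau> (inner_on J t y))"
  have im: "inner_on J t \<in> borel_measurable (std_gaussian J)" for t
    by (rule measurable_inner_on) (auto intro: measurable_std_gaussian_coord)
  have hm: "h t \<in> borel_measurable (std_gaussian J)" for t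
    unfolding h_def using im by measurable
  have hint: "integrable (std_gaussian J) (h t)" for t
    by (rule S.integrable_const_bound[where B = "\<tau>\<^sup>2", OF _ hm])
       (use trunc_sq_nonneg[OF \<tau>] trunc_sq_bounded[OF \<tau>] in \<open>auto simp: h_def\<close>)
  have hrow: "h t (rows \<omega> i) = trunc_sq \<tau> (inner_on J t (Z \<omega> i))" if "i \<in> I" for t \<omega> i
    using that by (simp add: h_def rows_def inner_on_def)
  have hP: "integrable ?P (\<lambda>x. h t (x i))" if "i \<in> I" for t i
    using integral_PiM_component(2)[where Q = "\<lambda>_. std_gaussian J", OF S.prob_space_axioms that hm] hint by simp
  have iP: "integrable ?P (\<lambda>x. inner_on J t (x i))" if "i \<in> I" for t i
  proof -
    have "integrable (std_gaussian J) (inner_on J t)"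
      using integral_std_gaussian_inner(2)[OF finJ, of "\<lambda>z. z" t] gauss1_moments(1)[of 1] by simp
    then show ?thesis
      using integral_PiM_component(2)[where Q = "\<lambda>_. std_gaussian J", OF S.prob_space_axioms that im] by simp
  qed
  define W where "W = (\<lambda>x. Max ((\<lambda>t. \<Sum>i\<in>I. (\<integral>y. h t y \<partial>std_gaussian J) - h t (x i)) ` T))"
  have PP: "prob_space ?P" by (intro prob_space_PiM prob_space_std_gaussian)
  interpret P: prob_space ?P by (rule PP)
  have Wint: "integrable ?P W"
    unfolding W_def using T hP by (intro integrable_Max Bochner_Integration.integrable_sum Bochner_Integration.integrable_diff) auto
  have VW: "V = (\<lambda>\<omega>. W (rows \<omega>))"
    unfolding V_def W_def by (simp add: hrow h_def[symmetric] cong: sum.cong) (simp add: h_def)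
  have "integrable (distr M ?P rows) W" using Wint by (simp only: rows(2))
  then show "integrable M V"
    unfolding VW using Wint rows(1) by (subst (asm) integrable_distr_eq) auto
  have "(\<integral>\<omega>. V \<omega> \<partial>M) = (\<integral>x. W x \<partial>?P)"
    unfolding VW using integral_distr[OF rows(1), of W] Wint by (simp add: rows(2) borel_measurable_integrable)
  also have "\<dots> \<le> 2 * (\<integral>x. rad T (\<lambda>t i. h t (x i)) js (\<lambda>_. 0) \<partial>?P)"
    unfolding W_def js(2)[symmetric]
    by (rule symmetrization) (use T js hint S.prob_space_axioms in auto)
  also have "\<dots> \<le> 2 * (\<integral>x. rad T (\<lambda>t i. (2 * \<tau>) * inner_on J t (x i)) js (\<lambda>_. 0) \<partial>?P)"
  proof (intro mult_left_mono integral_mono)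
    show "integrable ?P (\<lambda>x. rad T (\<lambda>t i. h t (x i)) js (\<lambda>_. 0))"
      using T hP js by (intro integrable_rad) auto
    show "integrable ?P (\<lambda>x. rad T (\<lambda>t i. (2 * \<tau>) * inner_on J t (x i)) js (\<lambda>_. 0))"
      using T iP js by (intro integrable_rad) auto
    show "rad T (\<lambda>t i. h t (x i)) js (\<lambda>_. 0) \<le> rad T (\<lambda>t i. (2 * \<tau>) * inner_on J t (x i)) js (\<lambda>_. 0)" for x
      unfolding h_def by (rule rad_contraction[OF T(1,2)]) (rule trunc_sq_lipschitz[OF \<tau>])
  qed simp
  also have "(\<integral>x. rad T (\<lambda>t i. (2 * \<tau>) * inner_on J t (x i)) js (\<lambda>_. 0) \<partial>?P)
      = (\<integral>\<omega>. rad T (\<lambda>t i. (2 * \<tau>) * inner_on J t (rows \<omega> i)) js (\<lambda>_. 0) \<partial>M)"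
  proof -
    have "integrable ?P (\<lambda>x. rad T (\<lambda>t i. (2 * \<tau>) * inner_on J t (x i)) js (\<lambda>_. 0))"
      using T iP js by (intro integrable_rad) auto
    then show ?thesis
      using integral_distr[OF rows(1), of "\<lambda>x. rad T (\<lambda>t i. (2 * \<tau>) * inner_on J t (x i)) js (\<lambda>_. 0)"]
      by (simp add: rows(2) borel_measurable_integrable)
  qed
  \<comment> \<open>No index has a sign yet: the offset is an empty sum, and the coefficient 1
    inside it is arbitrary.\<close>
  also have "\<dots> = (\<integral>\<omega>. rad T (\<lambda>t i. (2 * \<tau>) * inner_on J t (Z \<omega> i)) js (\<lambda>t. \<Sum>i\<in>{}. 1 * ((2 * \<tau>) * inner_on J t (Z \<omega> i))) \<partial>M)"
    by (intro Bochner_Integration.integral_cong refl rad_cong) (simp_all add: rows_def inner_on_def js)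
  also have "\<dots> \<le> (2 * \<tau>) * (sqrt (real (card I)) * (1 + sqrt (stat_dim J C)))"
    by (rule rad_linear_bound) (use T \<tau> js in auto)
  finally show "(\<integral>\<omega>. V \<omega> \<partial>M) \<le> 4 * \<tau> * (sqrt (real (card I)) * (1 + sqrt (stat_dim J C)))" by simp
qed

text \<open>Truncation only lowers the empirical sum, so a one-sided deviation bound for the
  truncated squares bounds the squares themselves from below without any control of their upper
  tails. Markov's inequality suffices: the mean of \<open>V\<close> is of order
  \<open>sqrt m * (1 + sqrt d)\<close>, the level is \<open>m * \<eta> / 2\<close>.\<close>

lemma lower_isometry_augmented:
  assumes \<eta>: "0 < \<eta>"
  obtains A where "A \<in> sets M"
    "measure M A \<le> 8 * sqrt (96 / \<eta>) / \<eta> * ((1 + sqrt (stat_dim J C)) / sqrt (real (card I)))"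
    "\<And>\<omega> t. \<omega> \<in> space M - A \<Longrightarrow> t \<in> augmented_ball C e \<Longrightarrow>
      real (card I) * (inner_on J t t - \<eta>) \<le> (\<Sum>i\<in>I. (inner_on J t (Z \<omega> i))\<^sup>2)"
proof -
  define m where "m = real (card I)"
  have m: "0 < m" using finI neI by (simp add: m_def card_gt_0_iff)
  \<comment> \<open>Splits \<eta> in halves: the truncation bias \<open>48 / \<tau>\<^sup>2\<close>
    equals \<open>\<eta> / 2\<close>, and the deviation is allowed the other half.\<close>
  define \<tau> where "\<tau> = sqrt (96 / \<eta>)"
  have \<tau>: "0 < \<tau>" "48 / \<tau>\<^sup>2 = \<eta> / 2" using \<eta> by (simp_all add: \<tau>_def)
  define E where "E = (\<lambda>t. \<integral>y. trunc_sq \<tau> (inner_on J t y) \<partial>std_gaussian J)"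
  have E: "inner_on J t t - \<eta> / 2 \<le> E t" if "t \<in> augmented_ball C e" for t
  proof -
    have "(L2_set t J)\<^sup>2 - 48 / \<tau>\<^sup>2 \<le> (\<integral>x. trunc_sq \<tau> (L2_set t J * x) \<partial>gauss1)"
      by (rule gauss1_trunc_sq[OF \<tau>(1)]) (use augmented_L2_le[OF that] in auto)
    then show ?thesis by (simp add: \<tau>(2) L2_set_sq E_def integral_std_gaussian_inner(1)[OF finJ])
  qed
  obtain D where D: "countable D" "D \<subseteq> augmented_ball C e" "augmented_ball C e \<subseteq> closure D"
    by (rule countable_dense_subset)
  have zero: "0 \<in> augmented_ball C e"
    by (auto simp: augmented_ball_def intro!: exI[of _ 0])
  \<comment> \<open>Finite pieces exhausting \<open>D\<close>. The point 0 keeps them nonempty and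
    makes the maximum nonnegative, as Markov's inequality requires; the intersection with
    \<open>D\<close> discards the arbitrary values of \<open>from_nat_into\<close> when
    \<open>D\<close> is empty.\<close>
  define T where "T = (\<lambda>k. insert 0 (from_nat_into D ` {..<k} \<inter> D))"
  have T: "finite (T k)" "T k \<noteq> {}" "T k \<subseteq> augmented_ball C e" for k
    using D zero by (auto simp: T_def)
  define V where "V = (\<lambda>k \<omega>. Max ((\<lambda>t. \<Sum>i\<in>I. E t - trunc_sq \<tau> (inner_on J t (Z \<omega> i))) ` T k))"
  have V: "integrable M (V k)" "(\<integral>\<omega>. V k \<omega> \<partial>M) \<le> 4 * \<tau> * (sqrt m * (1 + sqrt (stat_dim J C)))" for k
    using empirical_process_bound[OF \<tau>(1) T] unfolding V_def E_def m_def by auto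
  have V0: "0 \<le> V k \<omega>" for k \<omega>
  proof -
    have "(\<Sum>i\<in>I. E 0 - trunc_sq \<tau> (inner_on J 0 (Z \<omega> i))) = 0"
      using \<tau> by (simp add: E_def inner_on_simps trunc_sq_def)
    moreover have "(\<Sum>i\<in>I. E 0 - trunc_sq \<tau> (inner_on J 0 (Z \<omega> i))) \<le> V k \<omega>"
      unfolding V_def using T by (intro Max_ge) (auto simp: T_def)
    ultimately show ?thesis by simp
  qed
  have Vmono: "V k \<omega> \<le> V l \<omega>" if "k \<le> l" for k l \<omega>
    unfolding V_def using T that by (intro Max_mono) (auto simp: T_def)
  define A where "A = (\<lambda>k. {\<omega> \<in> space M. m * (\<eta> / 2) \<le> V k \<omega>})"
  have Am: "A k \<in> sets M" for k
  proof -
    have "V k \<in> borel_measurable M" using V(1) by auto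
    then show ?thesis unfolding A_def by measurable
  qed
  have PA: "measure M (A k) \<le> 8 * \<tau> / \<eta> * ((1 + sqrt (stat_dim J C)) / sqrt m)" for k
  proof -
    have "measure M (A k) \<le> (\<integral>\<omega>. V k \<omega> \<partial>M) / (m * (\<eta> / 2))"
      unfolding A_def by (rule integral_Markov_inequality_measure[where A = "{}"]) (use V V0 m \<eta> in auto)
    also have "\<dots> \<le> 4 * \<tau> * (sqrt m * (1 + sqrt (stat_dim J C))) / (m * (\<eta> / 2))"
      using V m \<eta> by (intro divide_right_mono) auto
    also have "\<dots> = 8 * \<tau> / \<eta> * ((1 + sqrt (stat_dim J C)) * (sqrt m / m))" using m \<eta> by (simp add: field_simps)
    also have "sqrt m / m = 1 / sqrt m" using m by (simp add: frac_eq_eq)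
    finally show ?thesis by simp
  qed
  show ?thesis
  proof (rule that)
    show "(\<Union>k. A k) \<in> sets M" using Am by auto
    \<comment> \<open>The events increase with k, so a bound proved for finite maxima passes to
      their union.\<close>
    have "A k \<subseteq> A (Suc k)" for k
    proof
      fix \<omega> assume "\<omega> \<in> A k"
      then show "\<omega> \<in> A (Suc k)" using Vmono[of k "Suc k" \<omega>] by (simp add: A_def)
    qed
    then have "incseq A" by (rule incseq_SucI)
    then have "(\<lambda>k. measure M (A k)) \<longlonglongrightarrow> measure M (\<Union>k. A k)"
      using Am by (intro finite_Lim_measure_incseq) auto
    then have "measure M (\<Union>k. A k) \<le> 8 * \<tau> / \<eta> * ((1 + sqrt (stat_dim J C)) / sqrt m)"
      by (rule LIMSEQ_le_const2) (use PA in blast)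
    then show "measure M (\<Union>k. A k) \<le> 8 * sqrt (96 / \<eta>) / \<eta> * ((1 + sqrt (stat_dim J C)) / sqrt (real (card I)))"
      by (simp add: \<tau>_def m_def)
    fix \<omega> t assume w: "\<omega> \<in> space M - (\<Union>k. A k)" and t: "t \<in> augmented_ball C e"
    have onD: "m * (inner_on J t t - \<eta>) \<le> (\<Sum>i\<in>I. (inner_on J t (Z \<omega> i))\<^sup>2)" if tD: "t \<in> D" for t
    proof -
      obtain k where "t = from_nat_into D k" using from_nat_into_surj[OF D(1) tD] by metis
      then have tT: "t \<in> T (Suc k)" using tD by (auto simp: T_def)
      have "(\<Sum>i\<in>I. E t - trunc_sq \<tau> (inner_on J t (Z \<omega> i))) \<le> V (Suc k) \<omega>"
        unfolding V_def using T tT by (intro Max_ge) auto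
      also have "\<dots> < m * (\<eta> / 2)" using w by (auto simp: A_def not_le)
      finally have "m * E t - m * (\<eta> / 2) \<le> (\<Sum>i\<in>I. trunc_sq \<tau> (inner_on J t (Z \<omega> i)))"
        by (simp add: sum_subtractf m_def)
      also have "\<dots> \<le> (\<Sum>i\<in>I. (inner_on J t (Z \<omega> i))\<^sup>2)"
        by (intro sum_mono trunc_sq_le_sq[OF \<tau>(1)])
      finally have "m * E t - m * (\<eta> / 2) \<le> (\<Sum>i\<in>I. (inner_on J t (Z \<omega> i))\<^sup>2)" .
      moreover have "m * (inner_on J t t - \<eta> / 2) \<le> m * E t"
        using E[of t] D tD m by (intro mult_left_mono) auto
      ultimately show ?thesis by (simp add: algebra_simps)
    qed
    \<comment> \<open>For a fixed matrix both sides are continuous in t, so the inequality extends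
      from \<open>D\<close> to its closure.\<close>
    have cont: "continuous_on UNIV (\<lambda>t. inner_on J t x)" "continuous_on UNIV (\<lambda>t. inner_on J t t)" for x
      unfolding inner_on_def by (intro continuous_intros continuous_on_product_coordinates)+
    have "closed {t. m * (inner_on J t t - \<eta>) \<le> (\<Sum>i\<in>I. (inner_on J t (Z \<omega> i))\<^sup>2)}"
      by (intro closed_Collect_le continuous_intros cont)
    then have "closure D \<subseteq> {t. m * (inner_on J t t - \<eta>) \<le> (\<Sum>i\<in>I. (inner_on J t (Z \<omega> i))\<^sup>2)}"
      using onD by (intro closure_minimal) auto
    then show "real (card I) * (inner_on J t t - \<eta>) \<le> (\<Sum>i\<in>I. (inner_on J t (Z \<omega> i))\<^sup>2)"
      using D(3) t by (auto simp: m_def)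
  qed
qed

end

text \<open>By homogeneity from the augmented ball around the direction of b. One exceptional event,
  chosen before v, serves every v in the cone and both estimates.\<close>

lemma lower_isometry:
  assumes C: "closed_cone_on J C" and b: "b \<in> coord_space J" and \<eta>: "0 < \<eta>"
  obtains A where "A \<in> sets M"
    "measure M A \<le> 8 * sqrt (96 / \<eta>) / \<eta> * ((1 + sqrt (stat_dim J C)) / sqrt (real (card I)))"
    "\<And>\<omega> v. \<omega> \<in> space M - A \<Longrightarrow> v \<in> C \<Longrightarrow>
      real (card I) * ((1 - \<eta>) * inner_on J v v) \<le> (\<Sum>i\<in>I. (inner_on J v (Z \<omega> i))\<^sup>2)"
    "\<And>\<omega> v. \<omega> \<in> space M - A \<Longrightarrow> v \<in> C \<Longrightarrow>
      real (card I) * (inner_on J (b + v) (b + v) - \<eta> * (inner_on J b b + inner_on J v v))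
        \<le> (\<Sum>i\<in>I. (inner_on J (b + v) (Z \<omega> i))\<^sup>2)"
proof -
  interpret C: closed_cone_on J C by (rule C)
  \<comment> \<open>If \<open>L2_set b J = 0\<close>, division by zero makes \<open>e\<close> the
    zero vector, which still has norm at most 1.\<close>
  define e where "e = (1 / L2_set b J) *\<^sub>R b"
  have e: "L2_set e J \<le> 1" by (cases "L2_set b J = 0") (simp_all add: e_def L2_set_scaleR)
  have be: "b = L2_set b J *\<^sub>R e"
  proof (cases "L2_set b J = 0")
    case True
    then have "b = 0" using b finJ by (intro coord_space_eqI[where I = J]) (auto simp: coord_space_convex)
    then show ?thesis by (auto simp: e_def)
  qed (simp add: e_def fun_eq_iff)
  from lower_isometry_augmented[OF C e \<eta>] obtain A where A: "A \<in> sets M"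
    "measure M A \<le> 8 * sqrt (96 / \<eta>) / \<eta> * ((1 + sqrt (stat_dim J C)) / sqrt (real (card I)))"
    "\<And>\<omega> t. \<omega> \<in> space M - A \<Longrightarrow> t \<in> augmented_ball C e \<Longrightarrow>
      real (card I) * (inner_on J t t - \<eta>) \<le> (\<Sum>i\<in>I. (inner_on J t (Z \<omega> i))\<^sup>2)" by blast
  have scaled: "real (card I) * (inner_on J w w - \<eta> * N\<^sup>2) \<le> (\<Sum>i\<in>I. (inner_on J w (Z \<omega> i))\<^sup>2)"
    if w: "\<omega> \<in> space M - A" and N: "0 < N" and t: "(1 / N) *\<^sub>R w \<in> augmented_ball C e" for \<omega> w N
  proof -
    have "real (card I) * (inner_on J w w / N\<^sup>2 - \<eta>) \<le> (\<Sum>i\<in>I. (inner_on J w (Z \<omega> i) / N)\<^sup>2)"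
      using A(3)[OF w t] by (simp add: inner_on_simps power2_eq_square)
    also have "\<dots> = (\<Sum>i\<in>I. (inner_on J w (Z \<omega> i))\<^sup>2) / N\<^sup>2"
      by (simp add: power_divide sum_divide_distrib)
    finally have "real (card I) * (inner_on J w w / N\<^sup>2 - \<eta>) * N\<^sup>2 \<le> (\<Sum>i\<in>I. (inner_on J w (Z \<omega> i))\<^sup>2)"
      using N by (simp only: pos_le_divide_eq zero_less_power)
    moreover have "real (card I) * (inner_on J w w / N\<^sup>2 - \<eta>) * N\<^sup>2 = real (card I) * (inner_on J w w - \<eta> * N\<^sup>2)"
      using N by (simp add: field_simps)
    ultimately show ?thesis by simp
  qed
  show ?thesis
  proof (rule that[OF A(1,2)])
    fix \<omega> v assume w: "\<omega> \<in> space M - A" and v: "v \<in> C"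
    show "real (card I) * ((1 - \<eta>) * inner_on J v v) \<le> (\<Sum>i\<in>I. (inner_on J v (Z \<omega> i))\<^sup>2)"
    proof (cases "L2_set v J = 0")
      case True
      then have "inner_on J v v = 0" by (simp add: L2_set_eq_sqrt_inner)
      then show ?thesis by (simp add: sum_nonneg)
    next
      case False
      then have N: "0 < L2_set v J" using L2_set_nonneg[of v J] by linarith
      have "(1 / L2_set v J) *\<^sub>R v \<in> augmented_ball C e"
        unfolding augmented_ball_def
      proof (intro CollectI exI conjI)
        show "(1 / L2_set v J) *\<^sub>R v = 0 *\<^sub>R e + (1 / L2_set v J) *\<^sub>R v" by (rule ext) simp
        show "(1 / L2_set v J) *\<^sub>R v \<in> C" using C.coneC v by (intro convex_cone_scaleR) auto
        show "L2_set ((1 / L2_set v J) *\<^sub>R v) J \<le> 1" using N by (simp add: L2_set_scaleR)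
      qed simp
      from scaled[OF w N this] show ?thesis by (simp add: L2_set_sq algebra_simps)
    qed
    \<comment> \<open>Normalising by this N rather than by the norm of \<open>b + v\<close> keeps
      both coefficients at most one even when b and v nearly cancel; this is why the error term
      carries \<open>|b|^2 + |v|^2\<close>.\<close>
    define N where "N = sqrt (inner_on J b b + inner_on J v v)"
    have N2: "N\<^sup>2 = inner_on J b b + inner_on J v v" by (simp add: N_def)
    have bN: "L2_set b J \<le> N" "L2_set v J \<le> N" by (simp_all add: N_def L2_set_eq_sqrt_inner)
    show "real (card I) * (inner_on J (b + v) (b + v) - \<eta> * (inner_on J b b + inner_on J v v))
        \<le> (\<Sum>i\<in>I. (inner_on J (b + v) (Z \<omega> i))\<^sup>2)"
    proof (cases "N = 0")
      case True
      then have "L2_set (b + v) J \<le> 0" using L2_set_triangle_add[of b v J] bN by simp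
      then have "L2_set (b + v) J = 0" using L2_set_nonneg[of "b + v" J] by linarith
      then have "inner_on J (b + v) (b + v) = 0" by (simp only: L2_set_sq[symmetric]) simp
      then show ?thesis using True N2 by (simp add: sum_nonneg)
    next
      case False
      then have N: "0 < N" by (simp add: N_def order_le_neq_trans)
      have "(1 / N) *\<^sub>R (b + v) \<in> augmented_ball C e"
        unfolding augmented_ball_def
      proof (intro CollectI exI conjI)
        show "(1 / N) *\<^sub>R (b + v) = (L2_set b J / N) *\<^sub>R e + (1 / N) *\<^sub>R v"
          by (subst be) (rule ext, simp add: algebra_simps)
        show "\<bar>L2_set b J / N\<bar> \<le> 1" using N bN by simp
        show "(1 / N) *\<^sub>R v \<in> C" using C.coneC v N by (intro convex_cone_scaleR) auto
        show "L2_set ((1 / N) *\<^sub>R v) J \<le> 1" using N bN by (simp add: L2_set_scaleR)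
      qed
      from scaled[OF w N this] show ?thesis by (simp add: N2)
    qed
  qed
qed

end

section \<open>A weak law of large numbers\<close>

lemma integral_PiM_sum_sq:
  fixes g :: "'b \<Rightarrow> real"
  assumes Q: "prob_space Q" and fin: "finite I" and g: "integrable Q g" "integrable Q (\<lambda>x. (g x)\<^sup>2)"
    and mean: "(\<integral>x. g x \<partial>Q) = 0"
  shows "integrable (PiM I (\<lambda>_. Q)) (\<lambda>x. (\<Sum>i\<in>I. g (x i))\<^sup>2)"
    and "(\<integral>x. (\<Sum>i\<in>I. g (x i))\<^sup>2 \<partial>PiM I (\<lambda>_. Q)) = real (card I) * (\<integral>x. (g x)\<^sup>2 \<partial>Q)"
proof -
  interpret Q: prob_space Q by fact
  interpret P: product_prob_space "\<lambda>_. Q" I by (rule product_prob_spaceI) (rule Q)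
  let ?P = "PiM I (\<lambda>_. Q)"
  have [measurable]: "g \<in> borel_measurable Q" using g by auto
  have diag: "integrable ?P (\<lambda>x. g (x i) * g (x i))" "(\<integral>x. g (x i) * g (x i) \<partial>?P) = (\<integral>x. (g x)\<^sup>2 \<partial>Q)"
    if "i \<in> I" for i
    using integral_PiM_component[where Q = "\<lambda>_. Q" and g = "\<lambda>x. (g x)\<^sup>2", OF Q that] g(2)
    by (auto simp: power2_eq_square)
  have off: "integrable ?P (\<lambda>x. g (x i) * g (x j)) \<and> (\<integral>x. g (x i) * g (x j) \<partial>?P) = 0"
    if ij: "i \<in> I" "j \<in> I" "i \<noteq> j" for i j
  proof -
    \<comment> \<open>The product of these factors over \<open>I\<close> is
      \<open>g (x i) * g (x j)\<close>, so its mean is a product containing the mean of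
      \<open>g\<close>, which is 0.\<close>
    define f where "f = (\<lambda>k. if k = i \<or> k = j then g else (\<lambda>_. 1))"
    have f: "\<And>k. k \<in> I \<Longrightarrow> integrable Q (f k)" by (auto simp: f_def g)
    have eq: "(\<Prod>k\<in>I. f k (x k)) = g (x i) * g (x j)" for x
    proof -
      have "(\<Prod>k\<in>I. f k (x k)) = (\<Prod>k\<in>{i, j}. f k (x k))"
        by (rule prod.mono_neutral_right) (use fin ij in \<open>auto simp: f_def\<close>)
      then show ?thesis using ij by (simp add: f_def)
    qed
    have "(\<Prod>k\<in>I. \<integral>x. f k x \<partial>Q) = 0"
      using fin ij mean by (intro prod_zero) (auto simp: f_def)
    then show ?thesis
      using P.product_integrable_prod[OF fin, of f] P.product_integral_prod[OF fin, of f] f by (simp add: eq)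
  qed
  have all: "integrable ?P (\<lambda>x. g (x i) * g (x j))" if "i \<in> I" "j \<in> I" for i j
    using diag off that by (cases "i = j") auto
  have sq: "(\<Sum>i\<in>I. g (x i))\<^sup>2 = (\<Sum>i\<in>I. \<Sum>j\<in>I. g (x i) * g (x j))" for x
    by (simp add: power2_eq_square sum_product)
  show "integrable ?P (\<lambda>x. (\<Sum>i\<in>I. g (x i))\<^sup>2)"
    unfolding sq using all by (intro Bochner_Integration.integrable_sum) auto
  have "(\<integral>x. (\<Sum>i\<in>I. g (x i))\<^sup>2 \<partial>?P) = (\<Sum>i\<in>I. \<Sum>j\<in>I. (\<integral>x. g (x i) * g (x j) \<partial>?P))"
    unfolding sq using all by simp
  also have "\<dots> = (\<Sum>i\<in>I. \<Sum>j\<in>I. if i = j then (\<integral>x. (g x)\<^sup>2 \<partial>Q) else 0)"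
    using diag off by (intro sum.cong refl) auto
  also have "\<dots> = real (card I) * (\<integral>x. (g x)\<^sup>2 \<partial>Q)" using fin by simp
  finally show "(\<integral>x. (\<Sum>i\<in>I. g (x i))\<^sup>2 \<partial>?P) = real (card I) * (\<integral>x. (g x)\<^sup>2 \<partial>Q)" .
qed

text \<open>Truncation reduces the weak law for a mean to Chebyshev's inequality.\<close>

lemma weak_law_upper:
  fixes f :: "'b \<Rightarrow> real"
  assumes Q: "prob_space Q" and f: "integrable Q f" "\<And>x. 0 \<le> f x" and \<eta>: "0 < \<eta>" and \<delta>: "0 < \<delta>"
  obtains N :: nat where "\<And>I :: nat set. finite I \<Longrightarrow> N \<le> card I \<Longrightarrow>
    measure (PiM I (\<lambda>_. Q)) {x \<in> space (PiM I (\<lambda>_. Q)). ((\<integral>x. f x \<partial>Q) + \<eta>) * real (card I) < (\<Sum>i\<in>I. f (x i))} \<le> \<delta>"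
proof -
  interpret Q: prob_space Q by fact
  have [measurable]: "f \<in> borel_measurable Q" using f by auto
  define \<mu> where "\<mu> = (\<integral>x. f x \<partial>Q)"
  have "(\<lambda>k. \<integral>x. f x - min (f x) (real k) \<partial>Q) \<longlonglongrightarrow> (\<integral>x. 0 \<partial>Q)"
  proof (rule integral_dominated_convergence[where w = f])
    show "AE x in Q. (\<lambda>k. f x - min (f x) (real k)) \<longlonglongrightarrow> 0"
    proof (rule AE_I2, rule tendsto_eventually)
      fix x
      obtain k0 where "f x \<le> real k0" using real_arch_simple by blast
      then have "f x - min (f x) (real k) = 0" if "k0 \<le> k" for k using that by (simp add: min_def)
      then show "\<forall>\<^sub>F k in sequentially. f x - min (f x) (real k) = 0"
        unfolding eventually_sequentially by blast
    qed
    show "AE x in Q. norm (f x - min (f x) (real k)) \<le> f x" for k using f(2) by (auto simp: min_def)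
  qed (use f in auto)
  then have "(\<lambda>k. \<integral>x. f x - min (f x) (real k) \<partial>Q) \<longlonglongrightarrow> 0" by simp
  then have "\<forall>\<^sub>F k in sequentially. (\<integral>x. f x - min (f x) (real k) \<partial>Q) < \<eta> * \<delta> / 4"
    by (rule order_tendstoD) (use \<eta> \<delta> in simp)
  \<comment> \<open>The part of f above level k has mean below \<open>\<eta> * \<delta> / 4\<close>,
    so Markov's inequality at level \<open>\<eta> / 2 * m\<close> costs at most
    \<open>\<delta> / 2\<close>.\<close>
  then obtain k where k: "(\<integral>x. f x - min (f x) (real k) \<partial>Q) < \<eta> * \<delta> / 4"
    unfolding eventually_sequentially by blast
  define f1 where "f1 = (\<lambda>x. min (f x) (real k))"
  define f2 where "f2 = (\<lambda>x. f x - min (f x) (real k))"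
  have [measurable]: "f1 \<in> borel_measurable Q" "f2 \<in> borel_measurable Q" unfolding f1_def f2_def by measurable
  have f1: "0 \<le> f1 x" "f1 x \<le> real k" "f1 x \<le> f x" for x using f(2) by (auto simp: f1_def)
  have f2: "0 \<le> f2 x" for x by (simp add: f2_def)
  have i1: "integrable Q f1" by (rule Q.integrable_const_bound[where B = "real k"]) (use f1 in auto)
  have i2: "integrable Q f2" unfolding f2_def f1_def[symmetric] using f(1) i1 by (simp add: f1_def)
  define \<mu>1 where "\<mu>1 = (\<integral>x. f1 x \<partial>Q)"
  have mu: "\<mu>1 \<le> \<mu>" unfolding \<mu>1_def \<mu>_def using f1 by (intro integral_mono i1 f) auto
  define g where "g = (\<lambda>x. f1 x - \<mu>1)"
  have gi: "integrable Q g" "(\<integral>x. g x \<partial>Q) = 0" using i1 by (auto simp: g_def \<mu>1_def Q.prob_space)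
  have mu1: "0 \<le> \<mu>1" "\<mu>1 \<le> real k"
    unfolding \<mu>1_def using f1 by (auto intro!: integral_nonneg_AE Q.integral_le_const i1)
  have gb: "(g x)\<^sup>2 \<le> (real k)\<^sup>2" for x
    using f1[of x] mu1 by (intro abs_le_square_iff[THEN iffD1]) (auto simp: g_def abs_le_iff)
  have [measurable]: "g \<in> borel_measurable Q" unfolding g_def by measurable
  have gi2: "integrable Q (\<lambda>x. (g x)\<^sup>2)" by (rule Q.integrable_const_bound[where B = "(real k)\<^sup>2"]) (use gb in auto)
  have Eg2: "(\<integral>x. (g x)\<^sup>2 \<partial>Q) \<le> (real k)\<^sup>2" using gb by (intro Q.integral_le_const gi2) auto
  \<comment> \<open>The truncated part has variance at most \<open>(real k)\<^sup>2\<close> per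
    term. From this sample size on, Chebyshev's inequality at level \<open>\<eta> / 2 * m\<close>
    costs at most \<open>\<delta> / 2\<close>.\<close>
  obtain N :: nat where N: "8 * (real k)\<^sup>2 / (\<eta>\<^sup>2 * \<delta>) < real N" using reals_Archimedean2 by blast
  show ?thesis
  proof (rule that[of "max 1 N"])
    fix I :: "nat set" assume fin: "finite I" and card: "max 1 N \<le> card I"
    let ?P = "PiM I (\<lambda>_. Q)"
    interpret P: prob_space ?P by (rule prob_space_PiM) (rule Q)
    define m where "m = real (card I)"
    have m: "0 < m" "real N \<le> m" using card by (auto simp: m_def)
    define A1 where "A1 = {x \<in> space ?P. (\<eta> / 2 * m)\<^sup>2 \<le> (\<Sum>i\<in>I. g (x i))\<^sup>2}"
    define A2 where "A2 = {x \<in> space ?P. \<eta> / 2 * m \<le> (\<Sum>i\<in>I. f2 (x i))}"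
    have A: "A1 \<in> sets ?P" "A2 \<in> sets ?P" unfolding A1_def A2_def by measurable
    have sub: "{x \<in> space ?P. (\<mu> + \<eta>) * m < (\<Sum>i\<in>I. f (x i))} \<subseteq> A1 \<union> A2"
    proof safe
      fix x assume x: "x \<in> space ?P" "(\<mu> + \<eta>) * m < (\<Sum>i\<in>I. f (x i))" "x \<notin> A2"
      have "(\<Sum>i\<in>I. f (x i)) = (\<Sum>i\<in>I. g (x i)) + \<mu>1 * m + (\<Sum>i\<in>I. f2 (x i))"
        by (simp add: g_def f1_def f2_def sum_subtractf m_def)
      moreover have "(\<Sum>i\<in>I. f2 (x i)) < \<eta> / 2 * m" using x by (simp add: A2_def)
      moreover have "\<mu>1 * m \<le> \<mu> * m" using mu m by simp
      ultimately have "\<eta> / 2 * m \<le> (\<Sum>i\<in>I. g (x i))" using x(2) by (simp add: algebra_simps)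
      then have "(\<eta> / 2 * m)\<^sup>2 \<le> (\<Sum>i\<in>I. g (x i))\<^sup>2" using \<eta> m by (intro power_mono) auto
      then show "x \<in> A1" using x by (simp add: A1_def)
    qed
    have P1: "measure ?P A1 \<le> \<delta> / 2"
    proof -
      note I2 = integral_PiM_sum_sq[OF Q fin gi(1) gi2 gi(2)]
      have "measure ?P A1 \<le> (\<integral>x. (\<Sum>i\<in>I. g (x i))\<^sup>2 \<partial>?P) / (\<eta> / 2 * m)\<^sup>2"
        unfolding A1_def by (rule integral_Markov_inequality_measure[where A = "{}"]) (use I2(1) \<eta> m in auto)
      also have "\<dots> \<le> (m * (real k)\<^sup>2) / (\<eta> / 2 * m)\<^sup>2"
        unfolding I2(2) m_def[symmetric] using Eg2 m by (intro divide_right_mono mult_left_mono) auto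
      also have "\<dots> = 4 * (real k)\<^sup>2 / (\<eta>\<^sup>2 * m)" using m \<eta> by (simp add: power2_eq_square field_simps)
      also have "\<dots> \<le> \<delta> / 2"
      proof -
        have "8 * (real k)\<^sup>2 < m * (\<eta>\<^sup>2 * \<delta>)"
        proof -
          have p: "0 < \<eta>\<^sup>2 * \<delta>" using \<eta> \<delta> by simp
          then have "8 * (real k)\<^sup>2 < real N * (\<eta>\<^sup>2 * \<delta>)" using N by (simp only: pos_divide_less_eq)
          also have "\<dots> \<le> m * (\<eta>\<^sup>2 * \<delta>)" using m p by (intro mult_right_mono) auto
          finally show ?thesis .
        qed
        then show ?thesis using m \<eta> \<delta> by (simp add: divide_simps) (simp add: algebra_simps)
      qed
      finally show ?thesis .
    qed
    have P2: "measure ?P A2 \<le> \<delta> / 2"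
    proof -
      have ic: "integrable ?P (\<lambda>x. f2 (x i))" "(\<integral>x. f2 (x i) \<partial>?P) = (\<integral>x. f2 x \<partial>Q)" if "i \<in> I" for i
        using integral_PiM_component[where Q = "\<lambda>_. Q" and g = f2, OF Q that] i2 by auto
      have "measure ?P A2 \<le> (\<integral>x. (\<Sum>i\<in>I. f2 (x i)) \<partial>?P) / (\<eta> / 2 * m)"
        unfolding A2_def by (rule integral_Markov_inequality_measure[where A = "{}"])
          (use ic \<eta> m f2 in \<open>auto intro!: sum_nonneg\<close>)
      also have "(\<integral>x. (\<Sum>i\<in>I. f2 (x i)) \<partial>?P) = m * (\<integral>x. f2 x \<partial>Q)" using ic by (simp add: m_def)
      also have "m * (\<integral>x. f2 x \<partial>Q) / (\<eta> / 2 * m) = 2 * (\<integral>x. f2 x \<partial>Q) / \<eta>" using m \<eta> by (simp add: field_simps)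
      also have "\<dots> \<le> \<delta> / 2" using k \<eta> unfolding f2_def by (simp add: divide_simps) (simp add: algebra_simps)
      finally show ?thesis .
    qed
    have "measure ?P {x \<in> space ?P. (\<mu> + \<eta>) * m < (\<Sum>i\<in>I. f (x i))} \<le> measure ?P (A1 \<union> A2)"
      using A by (intro P.finite_measure_mono sub) auto
    also have "\<dots> \<le> measure ?P A1 + measure ?P A2" by (rule measure_Un_le) (rule A)+
    also have "\<dots> \<le> \<delta>" using P1 P2 by simp
    finally show "measure ?P {x \<in> space ?P. ((\<integral>x. f x \<partial>Q) + \<eta>) * real (card I) < (\<Sum>i\<in>I. f (x i))} \<le> \<delta>"
      by (simp add: \<mu>_def m_def)
  qed
qed

text \<open>Turns independence of the generated sigma-algebras, the form in which
  \<open>linear_model\<close> states it, into a product law, to which Fubini applies.\<close>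

lemma (in prob_space) distr_pair_of_indep_set:
  assumes f: "f \<in> measurable M N1" and g: "g \<in> measurable M N2"
    and ind: "indep_set (sets (vimage_algebra (space M) f N1)) (sets (vimage_algebra (space M) g N2))"
  shows "distr M (N1 \<Otimes>\<^sub>M N2) (\<lambda>\<omega>. (f \<omega>, g \<omega>)) = distr M N1 f \<Otimes>\<^sub>M distr M N2 g"
proof -
  interpret F: prob_space "distr M N1 f" by (rule prob_space_distr) (rule f)
  interpret G: prob_space "distr M N2 g" by (rule prob_space_distr) (rule g)
  have fg: "(\<lambda>\<omega>. (f \<omega>, g \<omega>)) \<in> measurable M (N1 \<Otimes>\<^sub>M N2)" using f g by (rule measurable_Pair)
  show ?thesis
  proof (rule pair_measure_eqI[symmetric])
    show "sigma_finite_measure (distr M N1 f)" "sigma_finite_measure (distr M N2 g)" ..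
    show "sets (distr M N1 f \<Otimes>\<^sub>M distr M N2 g) = sets (distr M (N1 \<Otimes>\<^sub>M N2) (\<lambda>\<omega>. (f \<omega>, g \<omega>)))"
      by simp
    fix A B assume "A \<in> sets (distr M N1 f)" "B \<in> sets (distr M N2 g)"
    then have A: "A \<in> sets N1" and B: "B \<in> sets N2" by auto
    have "emeasure (distr M (N1 \<Otimes>\<^sub>M N2) (\<lambda>\<omega>. (f \<omega>, g \<omega>))) (A \<times> B)
        = emeasure M ((\<lambda>\<omega>. (f \<omega>, g \<omega>)) -` (A \<times> B) \<inter> space M)"
      using A B by (intro emeasure_distr[OF fg]) auto
    also have "(\<lambda>\<omega>. (f \<omega>, g \<omega>)) -` (A \<times> B) \<inter> space M = (f -` A \<inter> space M) \<inter> (g -` B \<inter> space M)" by auto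
    also have "emeasure M \<dots> = emeasure M (f -` A \<inter> space M) * emeasure M (g -` B \<inter> space M)"
    proof -
      have "prob ((f -` A \<inter> space M) \<inter> (g -` B \<inter> space M)) = prob (f -` A \<inter> space M) * prob (g -` B \<inter> space M)"
        by (rule indep_setD[OF ind]) (intro in_vimage_algebra A B)+
      then show ?thesis by (simp add: emeasure_eq_measure ennreal_mult)
    qed
    also have "\<dots> = emeasure (distr M N1 f) A * emeasure (distr M N2 g) B"
      using A B f g by (simp add: emeasure_distr)
    finally show "emeasure (distr M N1 f) A * emeasure (distr M N2 g) B
        = emeasure (distr M (N1 \<Otimes>\<^sub>M N2) (\<lambda>\<omega>. (f \<omega>, g \<omega>))) (A \<times> B)" ..
  qed
qed

context gaussian_matrix
begin

text \<open>
  Conditionally on the noise, \<open>Z\<^sup>T \<xi>\<close> is a Gaussian vector scaled by the norm of \<open>\<xi>\<close>, so the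
  concentration of the projection norm applies fibrewise.
\<close>

lemma noise_projection_tail:
  fixes Xr :: "'a \<Rightarrow> 'b" and \<xi>r :: "'a \<Rightarrow> 'c"
  assumes C: "closed_cone_on J C" and \<eta>: "0 < \<eta>" "0 < \<tau>"
    and Xr: "Xr \<in> measurable M PX" and \<xi>r: "\<xi>r \<in> measurable M P\<xi>"
    and pair: "distr M (PX \<Otimes>\<^sub>M P\<xi>) (\<lambda>\<omega>. (Xr \<omega>, \<xi>r \<omega>)) = distr M PX Xr \<Otimes>\<^sub>M distr M P\<xi> \<xi>r"
    and \<zeta>: "\<And>i j. i \<in> I \<Longrightarrow> j \<in> J \<Longrightarrow> \<zeta> i j \<in> borel_measurable PX"
      "\<And>i j \<omega>. i \<in> I \<Longrightarrow> j \<in> J \<Longrightarrow> \<omega> \<in> space M \<Longrightarrow> Z \<omega> i j = \<zeta> i j (Xr \<omega>)"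
    and \<theta>: "\<And>i. i \<in> I \<Longrightarrow> \<theta> i \<in> borel_measurable P\<xi>"
      "\<And>i \<omega>. i \<in> I \<Longrightarrow> \<omega> \<in> space M \<Longrightarrow> \<xi> \<omega> i = \<theta> i (\<xi>r \<omega>)"
  defines "Bad \<equiv> {\<omega> \<in> space M. inner_on I (\<xi> \<omega>) (\<xi> \<omega>) * ((1 + \<eta>) * stat_dim J C + \<tau>)
      < closed_cone_on.proj_sq J C (\<lambda>j. \<Sum>i\<in>I. \<xi> \<omega> i * Z \<omega> i j)}"
  shows "Bad \<in> sets M" and "measure M Bad \<le> pi\<^sup>2 / (2 * \<eta> * \<tau>)"
proof -
  interpret C: closed_cone_on J C by (rule C)
  interpret S: prob_space "std_gaussian J" by (rule prob_space_std_gaussian)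
  interpret DX: prob_space "distr M PX Xr" by (rule prob_space_distr) (rule Xr)
  interpret D\<xi>: prob_space "distr M P\<xi> \<xi>r" by (rule prob_space_distr) (rule \<xi>r)
  interpret DD: pair_prob_space "distr M PX Xr" "distr M P\<xi> \<xi>r" ..
  define c where "c = (1 + \<eta>) * stat_dim J C + \<tau>"
  \<comment> \<open>The bad event as a set in the product of the value spaces of \<open>Xr\<close>
    and \<open>\<xi>r\<close>, where Fubini can freeze the noise.\<close>
  define B where "B = {p \<in> space (PX \<Otimes>\<^sub>M P\<xi>). (\<Sum>i\<in>I. \<theta> i (snd p) * \<theta> i (snd p)) * c
      < C.proj_sq (\<lambda>j. \<Sum>i\<in>I. \<theta> i (snd p) * \<zeta> i j (fst p))}"
  have th: "(\<lambda>p. \<theta> i (snd p)) \<in> borel_measurable (PX \<Otimes>\<^sub>M P\<xi>)" if "i \<in> I" for i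
    by (rule measurable_compose[OF measurable_snd \<theta>(1)[OF that]])
  have ze: "(\<lambda>p. \<zeta> i j (fst p)) \<in> borel_measurable (PX \<Otimes>\<^sub>M P\<xi>)" if "i \<in> I" "j \<in> J" for i j
    by (rule measurable_compose[OF measurable_fst \<zeta>(1)[OF that]])
  have "(\<lambda>p. C.proj_sq (\<lambda>j. \<Sum>i\<in>I. \<theta> i (snd p) * \<zeta> i j (fst p))) \<in> borel_measurable (PX \<Otimes>\<^sub>M P\<xi>)"
    by (rule C.measurable_proj_sq) (intro borel_measurable_sum borel_measurable_times th ze)
  moreover have "(\<lambda>p. (\<Sum>i\<in>I. \<theta> i (snd p) * \<theta> i (snd p)) * c) \<in> borel_measurable (PX \<Otimes>\<^sub>M P\<xi>)"
    by (intro borel_measurable_sum borel_measurable_times th borel_measurable_const)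
  ultimately have Bm: "B \<in> sets (PX \<Otimes>\<^sub>M P\<xi>)"
    unfolding B_def by measurable
  have joint: "(\<lambda>\<omega>. (Xr \<omega>, \<xi>r \<omega>)) \<in> measurable M (PX \<Otimes>\<^sub>M P\<xi>)" using Xr \<xi>r by (rule measurable_Pair)
  have sp: "Xr \<omega> \<in> space PX" "\<xi>r \<omega> \<in> space P\<xi>" if "\<omega> \<in> space M" for \<omega>
    using that Xr \<xi>r by (auto dest: measurable_space)
  have BadB: "Bad = (\<lambda>\<omega>. (Xr \<omega>, \<xi>r \<omega>)) -` B \<inter> space M"
  proof -
    have "inner_on I (\<xi> \<omega>) (\<xi> \<omega>) = (\<Sum>i\<in>I. \<theta> i (\<xi>r \<omega>) * \<theta> i (\<xi>r \<omega>))" if "\<omega> \<in> space M" for \<omega>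
      using \<theta>(2) that by (simp add: inner_on_def)
    moreover have "C.proj_sq (\<lambda>j. \<Sum>i\<in>I. \<xi> \<omega> i * Z \<omega> i j) = C.proj_sq (\<lambda>j. \<Sum>i\<in>I. \<theta> i (\<xi>r \<omega>) * \<zeta> i j (Xr \<omega>))"
      if "\<omega> \<in> space M" for \<omega>
      by (rule C.proj_sq_cong) (use \<theta>(2) \<zeta>(2) that in \<open>auto intro!: sum.cong\<close>)
    ultimately show ?thesis
      unfolding Bad_def B_def c_def[symmetric] using sp by (auto simp: space_pair_measure)
  qed
  show BadM: "Bad \<in> sets M" unfolding BadB by (rule measurable_sets[OF joint Bm])
  \<comment> \<open>For frozen noise \<open>u\<close> the vector \<open>z\<close> is
    \<open>L2_set u I\<close> times a standard Gaussian vector. \<open>proj_sq\<close> scales by the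
    square of that factor, which is the factor \<open>inner_on I u u\<close> on the other
    side.\<close>
  have fibre: "emeasure (distr M PX Xr) ((\<lambda>x. (x, y)) -` B \<inter> space PX) \<le> ennreal (pi\<^sup>2 / (2 * \<eta> * \<tau>))"
    if y: "y \<in> space P\<xi>" for y
  proof -
    define u where "u = (\<lambda>i. \<theta> i y)"
    define z where "z = (\<lambda>\<omega>. \<lambda>j\<in>J. \<Sum>i\<in>I. u i * Z \<omega> i j)"
    have fm: "(\<lambda>x. (x, y)) -` B \<inter> space PX \<in> sets PX"
      using measurable_sets[OF measurable_Pair2'[OF y] Bm] .
    have zz: "C.proj_sq (\<lambda>j. \<Sum>i\<in>I. \<theta> i y * \<zeta> i j (Xr \<omega>)) = C.proj_sq (z \<omega>)" if "\<omega> \<in> space M" for \<omega>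
      by (rule C.proj_sq_cong) (use \<zeta>(2) that in \<open>auto simp: z_def u_def intro!: sum.cong\<close>)
    have "emeasure (distr M PX Xr) ((\<lambda>x. (x, y)) -` B \<inter> space PX)
        = emeasure M (Xr -` ((\<lambda>x. (x, y)) -` B \<inter> space PX) \<inter> space M)"
      by (rule emeasure_distr[OF Xr fm])
    also have "Xr -` ((\<lambda>x. (x, y)) -` B \<inter> space PX) \<inter> space M
        = z -` {g \<in> space (std_gaussian J). inner_on I u u * c < C.proj_sq g} \<inter> space M"
      using measurable_left[of u, THEN measurable_space] sp y
      by (auto simp: B_def space_pair_measure zz inner_on_def u_def z_def)
    also have "emeasure M \<dots> = emeasure (distr M (std_gaussian J) z) {g \<in> space (std_gaussian J). inner_on I u u * c < C.proj_sq g}"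
      unfolding z_def by (rule emeasure_distr[symmetric, OF measurable_left]) measurable
    also have "\<dots> = emeasure (distr (std_gaussian J) (std_gaussian J) (\<lambda>g. \<lambda>j\<in>J. L2_set u I * g j))
        {g \<in> space (std_gaussian J). inner_on I u u * c < C.proj_sq g}"
      by (simp only: z_def distr_left)
    also have "\<dots> \<le> emeasure (std_gaussian J) {g \<in> space (std_gaussian J). c < C.proj_sq g}"
    proof -
      have scale: "(\<lambda>g. \<lambda>j\<in>J. L2_set u I * g j) \<in> measurable (std_gaussian J) (std_gaussian J)"
        unfolding std_gaussian_eq
      proof (rule measurable_restrict)
        fix j assume j: "j \<in> J"
        have "(\<lambda>g. L2_set u I * g j) \<in> borel_measurable (std_gaussian J)"
          by (intro borel_measurable_times measurable_std_gaussian_coord j) simp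
        then show "(\<lambda>g. L2_set u I * g j) \<in> measurable (PiM J (\<lambda>_. gauss1)) gauss1"
          by (simp add: std_gaussian_eq cong: measurable_cong_sets)
      qed
      have ps: "C.proj_sq (\<lambda>j\<in>J. L2_set u I * g j) = inner_on I u u * C.proj_sq g" for g
      proof -
        have "C.proj_sq (\<lambda>j\<in>J. L2_set u I * g j) = C.proj_sq (L2_set u I *\<^sub>R g)" by (rule C.proj_sq_cong) simp
        then show ?thesis by (simp add: C.proj_sq_scaleR L2_set_sq)
      qed
      have "emeasure (distr (std_gaussian J) (std_gaussian J) (\<lambda>g. \<lambda>j\<in>J. L2_set u I * g j))
          {g \<in> space (std_gaussian J). inner_on I u u * c < C.proj_sq g}
        = emeasure (std_gaussian J) ((\<lambda>g. \<lambda>j\<in>J. L2_set u I * g j) -` {g \<in> space (std_gaussian J). inner_on I u u * c < C.proj_sq g} \<inter> space (std_gaussian J))"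
        by (rule emeasure_distr[OF scale]) measurable
      also have "\<dots> \<le> emeasure (std_gaussian J) {g \<in> space (std_gaussian J). c < C.proj_sq g}"
      \<comment> \<open>For \<open>u = 0\<close> the strict inequality reads \<open>0 < 0\<close>
        and the event is empty; otherwise the common factor cancels.\<close>
      proof (rule emeasure_mono)
        show "(\<lambda>g. \<lambda>j\<in>J. L2_set u I * g j) -` {g \<in> space (std_gaussian J). inner_on I u u * c < C.proj_sq g} \<inter> space (std_gaussian J)
          \<subseteq> {g \<in> space (std_gaussian J). c < C.proj_sq g}"
          using mult_less_cancel_left_pos[of "inner_on I u u" c] inner_on_self_nonneg[of I u]
          by (auto simp: ps mult_less_cancel_left)
      qed measurable
      finally show ?thesis .
    qed
    also have "\<dots> \<le> ennreal (pi\<^sup>2 / (2 * \<eta> * \<tau>))"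
      using C.proj_sq_upper_tail[OF \<eta>] by (simp add: S.emeasure_eq_measure c_def ennreal_leI)
    finally show ?thesis .
  qed
  have "emeasure M Bad = emeasure (distr M PX Xr \<Otimes>\<^sub>M distr M P\<xi> \<xi>r) B"
    unfolding BadB pair[symmetric] by (rule emeasure_distr[symmetric, OF joint Bm])
  also have "\<dots> = (\<integral>\<^sup>+y. emeasure (distr M PX Xr) ((\<lambda>x. (x, y)) -` B) \<partial>distr M P\<xi> \<xi>r)"
    using Bm by (intro DD.emeasure_pair_measure_alt2) simp
  also have "\<dots> \<le> (\<integral>\<^sup>+y. ennreal (pi\<^sup>2 / (2 * \<eta> * \<tau>)) \<partial>distr M P\<xi> \<xi>r)"
  proof (rule nn_integral_mono)
    fix y assume "y \<in> space (distr M P\<xi> \<xi>r)"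
    then have "y \<in> space P\<xi>" by simp
    moreover have "(\<lambda>x. (x, y)) -` B = (\<lambda>x. (x, y)) -` B \<inter> space PX"
      by (auto simp: B_def space_pair_measure)
    ultimately show "emeasure (distr M PX Xr) ((\<lambda>x. (x, y)) -` B) \<le> ennreal (pi\<^sup>2 / (2 * \<eta> * \<tau>))"
      using fibre[of y] by simp
  qed
  also have "\<dots> = ennreal (pi\<^sup>2 / (2 * \<eta> * \<tau>))" using D\<xi>.emeasure_space_1 by simp
  finally show "measure M Bad \<le> pi\<^sup>2 / (2 * \<eta> * \<tau>)"
    using \<eta> by (simp add: emeasure_eq_measure)
qed

end

section \<open>The fixed point radius\<close>

lemma integral_std_gaussian_norm_sq:
  assumes "finite I"
  shows "integrable (std_gaussian I) (\<lambda>h. inner_on I h h)" "(\<integral>h. inner_on I h h \<partial>std_gaussian I) = real (card I)"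
proof -
  have c: "integrable (std_gaussian I) (\<lambda>h. h i * h i) \<and> (\<integral>h. h i * h i \<partial>std_gaussian I) = 1" if i: "i \<in> I" for i
  proof -
    define v where "v = (\<lambda>j. if j = i then 1 else 0 :: real)"
    have v: "inner_on I v h = h i" for h using assms i by (simp add: inner_on_def v_def if_distrib[of "\<lambda>x. x * _"] cong: if_cong)
    have "inner_on I v v = 1" unfolding v by (simp add: v_def)
    then show ?thesis
      using integral_std_gaussian_inner_sq[OF assms, of v] gauss1_moments(1)[of 2]
        integral_std_gaussian_inner(2)[OF assms, of "\<lambda>z. z\<^sup>2" v] L2_set_sq[of v I]
      by (simp add: v power_mult_distrib) (simp add: power2_eq_square)
  qed
  show "integrable (std_gaussian I) (\<lambda>h. inner_on I h h)" unfolding inner_on_def using c by simp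
  show "(\<integral>h. inner_on I h h \<partial>std_gaussian I) = real (card I)" unfolding inner_on_def using c by simp
qed

context closed_convex_on
begin

definition shift :: "(nat \<Rightarrow> real) \<Rightarrow> real \<Rightarrow> (nat \<Rightarrow> real) \<Rightarrow> real"
  where "shift x w h = L2_set (proj (x + w *\<^sub>R h) - x) I"

lemma shift_nonneg [simp]: "0 \<le> shift x w h" by (simp add: shift_def)

lemma proj_id: "x \<in> C \<Longrightarrow> proj x = x"
  by (rule proj_eqI) (auto simp: inner_on_simps)

lemma shift_le: "x \<in> C \<Longrightarrow> shift x w h \<le> \<bar>w\<bar> * L2_set h I"
proof -
  assume x: "x \<in> C"
  have "shift x w h = L2_set (proj (x + w *\<^sub>R h) - proj x) I" by (simp add: shift_def proj_id[OF x])
  also have "\<dots> \<le> L2_set (x + w *\<^sub>R h - x) I" by (rule proj_nonexpansive)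
  finally show ?thesis by (simp add: L2_set_scaleR)
qed

lemma shift_lipschitz: "\<bar>shift x w h - shift x w' h\<bar> \<le> \<bar>w - w'\<bar> * L2_set h I"
proof -
  have "\<bar>shift x w h - shift x w' h\<bar> \<le> L2_set (proj (x + w *\<^sub>R h) - x - (proj (x + w' *\<^sub>R h) - x)) I"
    unfolding shift_def by (rule L2_set_reverse_triangle)
  also have "\<dots> = L2_set (proj (x + w *\<^sub>R h) - proj (x + w' *\<^sub>R h)) I" by simp
  also have "\<dots> \<le> L2_set (x + w *\<^sub>R h - (x + w' *\<^sub>R h)) I" by (rule proj_nonexpansive)
  also have "x + w *\<^sub>R h - (x + w' *\<^sub>R h) = (w - w') *\<^sub>R h" by (rule ext) (simp add: algebra_simps)
  finally show ?thesis by (simp only: L2_set_scaleR)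
qed

text \<open>The classical fact that \<open>|\<Pi>(x + w h) - x| / w\<close> does not increase with
  w. The variational inequalities at the two projections combine to
  \<open>(|q| - |p|) * (|q| - c * |p|) \<le> 0\<close> for the displacements p and q, and
  \<open>c \<ge> 1\<close> leaves \<open>|q| \<le> c * |p|\<close>.\<close>

lemma shift_sublinear:
  assumes x: "x \<in> C" and w: "0 < w" "w \<le> w'"
  shows "shift x w' h \<le> w' / w * shift x w h"
proof -
  define p where "p = proj (x + w *\<^sub>R h) - x"
  define q where "q = proj (x + w' *\<^sub>R h) - x"
  define c where "c = w' / w"
  have c: "1 \<le> c" "w' = c * w" using w by (auto simp: c_def)
  have 1: "inner_on I (w *\<^sub>R h - p) (q - p) \<le> 0"
    using proj_variational[OF proj_in, of "x + w *\<^sub>R h" "x + w' *\<^sub>R h"]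
    unfolding p_def q_def by (simp add: algebra_simps)
  have 2: "inner_on I (w' *\<^sub>R h - q) (p - q) \<le> 0"
    using proj_variational[OF proj_in, of "x + w' *\<^sub>R h" "x + w *\<^sub>R h"]
    unfolding p_def q_def by (simp add: algebra_simps)
  have pp: "inner_on I p p = (L2_set p I)\<^sup>2" "inner_on I q q = (L2_set q I)\<^sup>2" by (simp_all add: L2_set_sq)
  have pq: "inner_on I p q \<le> L2_set p I * L2_set q I" by (rule inner_on_le_L2)
  have a1: "w * (inner_on I h q - inner_on I h p) \<le> inner_on I p q - inner_on I p p"
    using 1 by (simp add: inner_on_simps algebra_simps)
  have a2: "inner_on I q q - inner_on I p q \<le> w' * (inner_on I h q - inner_on I h p)"
    using 2 by (simp add: inner_on_simps inner_on_commute[of I q p] algebra_simps)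
  have "inner_on I q q - inner_on I p q \<le> c * (inner_on I p q - inner_on I p p)"
  proof -
    have "c * (w * (inner_on I h q - inner_on I h p)) \<le> c * (inner_on I p q - inner_on I p p)"
      using a1 c by (intro mult_left_mono) auto
    then show ?thesis using a2 unfolding c(2) mult.assoc by linarith
  qed
  then have "(L2_set q I)\<^sup>2 + c * (L2_set p I)\<^sup>2 \<le> (1 + c) * inner_on I p q" by (simp add: pp algebra_simps)
  also have "\<dots> \<le> (1 + c) * (L2_set p I * L2_set q I)" using pq c by (intro mult_left_mono) auto
  finally have prod: "(L2_set q I - L2_set p I) * (L2_set q I - c * L2_set p I) \<le> 0"
    by (simp add: power2_eq_square algebra_simps)
  have "L2_set q I \<le> c * L2_set p I"
  proof (rule ccontr)
    assume "\<not> L2_set q I \<le> c * L2_set p I"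
    then have g: "c * L2_set p I < L2_set q I" by simp
    have "1 * L2_set p I \<le> c * L2_set p I" using c by (intro mult_right_mono) auto
    then have "0 < (L2_set q I - L2_set p I) * (L2_set q I - c * L2_set p I)"
      using g by (intro mult_pos_pos) auto
    then show False using prod by simp
  qed
  then show ?thesis by (simp add: shift_def p_def q_def c_def)
qed

lemma measurable_shift: "(\<lambda>h. shift x w h) \<in> borel_measurable (std_gaussian I)"
proof -
  have "(\<lambda>h. proj (x + w *\<^sub>R h) i) \<in> borel_measurable (std_gaussian I)" for i
    by (rule measurable_proj) (auto intro!: borel_measurable_add borel_measurable_times measurable_std_gaussian_coord)
  then have "(\<lambda>h. (proj (x + w *\<^sub>R h) - x) i) \<in> borel_measurable (std_gaussian I)" for i by simp
  then show ?thesis unfolding shift_def L2_set_def by measurable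
qed

definition mean_shift :: "(nat \<Rightarrow> real) \<Rightarrow> real \<Rightarrow> real"
  where "mean_shift x w = (\<integral>h. (shift x w h)\<^sup>2 \<partial>std_gaussian I)"

lemma integrable_shift_sq: "x \<in> C \<Longrightarrow> integrable (std_gaussian I) (\<lambda>h. (shift x w h)\<^sup>2)"
proof (rule Bochner_Integration.integrable_bound)
  assume x: "x \<in> C"
  show "integrable (std_gaussian I) (\<lambda>h. w\<^sup>2 * inner_on I h h)"
    using integral_std_gaussian_norm_sq[OF finI] by simp
  show "(\<lambda>h. (shift x w h)\<^sup>2) \<in> borel_measurable (std_gaussian I)"
    by (intro borel_measurable_power measurable_shift)
  have "(shift x w h)\<^sup>2 \<le> w\<^sup>2 * inner_on I h h" for h
  proof -
    have "(shift x w h)\<^sup>2 \<le> (\<bar>w\<bar> * L2_set h I)\<^sup>2" using shift_le[OF x] by (intro power_mono) auto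
    then show ?thesis by (simp add: power_mult_distrib L2_set_sq)
  qed
  then show "AE h in std_gaussian I. norm ((shift x w h)\<^sup>2) \<le> norm (w\<^sup>2 * inner_on I h h)" by simp
qed

lemma mean_shift_sublinear:
  assumes x: "x \<in> C" and w: "0 < w" "w \<le> w'"
  shows "mean_shift x w' / w'\<^sup>2 \<le> mean_shift x w / w\<^sup>2"
proof -
  have "mean_shift x w' \<le> (\<integral>h. (w' / w)\<^sup>2 * (shift x w h)\<^sup>2 \<partial>std_gaussian I)"
    unfolding mean_shift_def
  proof (rule integral_mono)
    show "(shift x w' h)\<^sup>2 \<le> (w' / w)\<^sup>2 * (shift x w h)\<^sup>2" for h
      unfolding power_mult_distrib[symmetric] using shift_sublinear[OF assms] by (intro power_mono) auto
  qed (use integrable_shift_sq[OF x] in auto)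
  also have "\<dots> = (w' / w)\<^sup>2 * mean_shift x w" by (simp add: mean_shift_def)
  finally show ?thesis using w by (simp add: power_divide field_simps)
qed

text \<open>Feeds the intermediate value theorem. Nonexpansiveness bounds the difference of squares
  by \<open>|w' - w| * (|w'| + |w|)\<close> times the squared norm of h, whose mean is
  \<open>card I\<close>.\<close>

lemma continuous_mean_shift:
  assumes x: "x \<in> C" shows "continuous_on UNIV (mean_shift x)"
  unfolding continuous_on_eq_continuous_at[OF open_UNIV]
proof
  fix w :: real
  have bd: "norm (mean_shift x w' - mean_shift x w) \<le> \<bar>w' - w\<bar> * (\<bar>w'\<bar> + \<bar>w\<bar>) * real (card I)" for w'
  proof -
    have "\<bar>(shift x w' h)\<^sup>2 - (shift x w h)\<^sup>2\<bar> \<le> \<bar>w' - w\<bar> * (\<bar>w'\<bar> + \<bar>w\<bar>) * inner_on I h h" for h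
    proof -
      have "\<bar>(shift x w' h)\<^sup>2 - (shift x w h)\<^sup>2\<bar> = \<bar>shift x w' h - shift x w h\<bar> * (shift x w' h + shift x w h)"
        by (simp add: power2_eq_square square_diff_square_factored abs_mult)
      also have "\<dots> \<le> (\<bar>w' - w\<bar> * L2_set h I) * (\<bar>w'\<bar> * L2_set h I + \<bar>w\<bar> * L2_set h I)"
        by (intro mult_mono add_mono shift_lipschitz shift_le x) auto
      also have "\<dots> = \<bar>w' - w\<bar> * (\<bar>w'\<bar> + \<bar>w\<bar>) * (L2_set h I)\<^sup>2" by (simp add: power2_eq_square algebra_simps)
      finally show ?thesis by (simp add: L2_set_sq)
    qed
    then have "(\<integral>h. \<bar>(shift x w' h)\<^sup>2 - (shift x w h)\<^sup>2\<bar> \<partial>std_gaussian I)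
        \<le> (\<integral>h. \<bar>w' - w\<bar> * (\<bar>w'\<bar> + \<bar>w\<bar>) * inner_on I h h \<partial>std_gaussian I)"
      using integrable_shift_sq[OF x] integral_std_gaussian_norm_sq[OF finI]
      by (intro integral_mono) auto
    also have "\<dots> = \<bar>w' - w\<bar> * (\<bar>w'\<bar> + \<bar>w\<bar>) * real (card I)"
      by (simp add: integral_std_gaussian_norm_sq[OF finI])
    finally have "(\<integral>h. \<bar>(shift x w' h)\<^sup>2 - (shift x w h)\<^sup>2\<bar> \<partial>std_gaussian I) \<le> \<bar>w' - w\<bar> * (\<bar>w'\<bar> + \<bar>w\<bar>) * real (card I)" .
    moreover have "mean_shift x w' - mean_shift x w = (\<integral>h. (shift x w' h)\<^sup>2 - (shift x w h)\<^sup>2 \<partial>std_gaussian I)"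
      unfolding mean_shift_def by (rule Bochner_Integration.integral_diff[symmetric]) (rule integrable_shift_sq[OF x])+
    moreover have "norm (\<integral>h. (shift x w' h)\<^sup>2 - (shift x w h)\<^sup>2 \<partial>std_gaussian I)
        \<le> (\<integral>h. norm ((shift x w' h)\<^sup>2 - (shift x w h)\<^sup>2) \<partial>std_gaussian I)"
      by (rule integral_norm_bound)
    ultimately show ?thesis by (simp only: real_norm_def)
  qed
  have "((\<lambda>w'. \<bar>w' - w\<bar> * (\<bar>w'\<bar> + \<bar>w\<bar>) * real (card I)) \<longlongrightarrow> \<bar>w - w\<bar> * (\<bar>w\<bar> + \<bar>w\<bar>) * real (card I)) (at w)"
    by (intro tendsto_intros)
  then have lim: "((\<lambda>w'. \<bar>w' - w\<bar> * (\<bar>w'\<bar> + \<bar>w\<bar>) * real (card I)) \<longlongrightarrow> 0) (at w)" by simp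
  have "((\<lambda>w'. mean_shift x w' - mean_shift x w) \<longlongrightarrow> 0) (at w)"
    by (rule Lim_null_comparison[OF always_eventually lim]) (use bd in blast)
  then show "isCont (mean_shift x) w" unfolding isCont_def by (rule LIM_zero_cancel)
qed

text \<open>If the mean vanished, almost every h would be normal to the set at x, so
  \<open>inner_on I v h \<le> 0\<close> for a feasible direction v. Having mean zero, this variable
  would vanish almost surely, against its variance \<open>inner_on I v v > 0\<close>.\<close>

lemma mean_shift_pos:
  assumes x: "x \<in> C" and ne: "C \<noteq> {x}" and w: "0 < w"
  shows "0 < mean_shift x w"
proof (rule ccontr)
  assume "\<not> 0 < mean_shift x w"
  moreover have "0 \<le> mean_shift x w" unfolding mean_shift_def by (rule integral_nonneg_AE) simp
  ultimately have "mean_shift x w = 0" by simp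
  then have AE0: "AE h in std_gaussian I. (shift x w h)\<^sup>2 = 0"
    unfolding mean_shift_def using integral_nonneg_eq_0_iff_AE[OF integrable_shift_sq[OF x]] by simp
  obtain y where y: "y \<in> C" "y \<noteq> x" using ne x by blast
  define v where "v = y - x"
  have "L2_set v I \<noteq> 0"
    using y x sub finI coord_space_eqI[of y I x] unfolding v_def by blast
  then have vpos: "0 < inner_on I v v" by (simp add: L2_set_eq_sqrt_inner order_le_neq_trans)
  have "0 \<le> - inner_on I v h" if "(shift x w h)\<^sup>2 = 0" for h
  proof -
    have "L2_set (proj (x + w *\<^sub>R h) - x) I = 0" using that by (simp add: shift_def)
    then have "proj (x + w *\<^sub>R h) = x" using x sub finI by (intro coord_space_eqI[where I = I]) auto
    then have "inner_on I (x + w *\<^sub>R h - x) v \<le> 0"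
      using proj_variational[OF y(1), of "x + w *\<^sub>R h"] by (simp add: v_def)
    then have "w * inner_on I v h \<le> 0" by (simp add: inner_on_simps inner_on_commute)
    then show ?thesis using w by (simp add: mult_le_0_iff)
  qed
  then have AEn: "AE h in std_gaussian I. 0 \<le> - inner_on I v h" using AE0 by (auto elim: eventually_mono)
  have int: "integrable (std_gaussian I) (\<lambda>h. - inner_on I v h)"
    using integral_std_gaussian_inner(2)[OF finI, of "\<lambda>z. z" v] gauss1_moments(1)[of 1] by simp
  have "(\<integral>h. - inner_on I v h \<partial>std_gaussian I) = 0"
    using integral_std_gaussian_inner(1)[OF finI, of "\<lambda>z. z" v] gauss1_moments(2) by simp
  then have "AE h in std_gaussian I. - inner_on I v h = 0"
    using integral_nonneg_eq_0_iff_AE[OF int AEn] by simp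
  then have "AE h in std_gaussian I. (inner_on I v h)\<^sup>2 = 0" by (rule eventually_mono) simp
  then have "(\<integral>h. (inner_on I v h)\<^sup>2 \<partial>std_gaussian I) = 0" by (rule integral_eq_zero_AE)
  then show False using vpos by (simp add: integral_std_gaussian_inner_sq[OF finI])
qed

text \<open>The oracle inequality in the sequence model, with constant one for the same reason: the
  variational inequality at y supplies the extra quadratic term, and completing the square consumes
  it.\<close>

lemma mean_shift_oracle:
  assumes x: "x \<in> C" and y: "y \<in> C" and D: "closed_cone_on I D" and CD: "\<And>z. z \<in> C \<Longrightarrow> z - y \<in> D" and w: "0 \<le> w"
  shows "mean_shift x w \<le> inner_on I (y - x) (y - x) + w\<^sup>2 * stat_dim I D"
proof -
  interpret D: closed_cone_on I D by (rule D)
  interpret S: prob_space "std_gaussian I" by (rule prob_space_std_gaussian)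
  have pt: "(shift x w h)\<^sup>2 \<le> inner_on I (y - x) (y - x) + w\<^sup>2 * D.proj_sq h" for h
  proof -
    define v where "v = proj (x + w *\<^sub>R h) - y"
    define b where "b = y - x"
    have "inner_on I (x + w *\<^sub>R h - proj (x + w *\<^sub>R h)) (y - proj (x + w *\<^sub>R h)) \<le> 0"
      by (rule proj_variational) fact
    moreover have "x + w *\<^sub>R h - proj (x + w *\<^sub>R h) = w *\<^sub>R h - (b + v)" "y - proj (x + w *\<^sub>R h) = - v"
      by (auto simp: v_def b_def)
    ultimately have 1: "inner_on I (b + v) v \<le> w * inner_on I h v" by (simp add: inner_on_simps algebra_simps)
    have "inner_on I h v \<le> sqrt (D.proj_sq h) * L2_set v I"
      using CD[OF proj_in] by (intro D.inner_le_sqrt_proj_sq) (simp add: v_def)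
    then have "w * inner_on I h v \<le> w * (sqrt (D.proj_sq h) * L2_set v I)" using w by (intro mult_left_mono)
    moreover have "2 * (w * (sqrt (D.proj_sq h) * L2_set v I)) \<le> w\<^sup>2 * D.proj_sq h + inner_on I v v"
    proof -
      have "0 \<le> (w * sqrt (D.proj_sq h) - L2_set v I)\<^sup>2" by simp
      then show ?thesis by (simp add: power2_diff power_mult_distrib L2_set_sq)
    qed
    ultimately have "2 * inner_on I (b + v) v \<le> w\<^sup>2 * D.proj_sq h + inner_on I v v" using 1 by linarith
    moreover have "(shift x w h)\<^sup>2 = inner_on I (b + v) (b + v)"
      by (simp add: shift_def L2_set_sq b_def v_def)
    moreover have "inner_on I (b + v) (b + v) = 2 * inner_on I (b + v) v - inner_on I v v + inner_on I b b"
      by (simp add: inner_on_simps inner_on_commute)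
    ultimately show ?thesis by (simp add: b_def)
  qed
  have "mean_shift x w \<le> (\<integral>h. inner_on I (y - x) (y - x) + w\<^sup>2 * D.proj_sq h \<partial>std_gaussian I)"
    unfolding mean_shift_def
    by (rule integral_mono) (use integrable_shift_sq[OF x] D.integrable_proj_sq pt in auto)
  also have "\<dots> = inner_on I (y - x) (y - x) + w\<^sup>2 * stat_dim I D"
    using D.integrable_proj_sq by (simp add: S.prob_space D.stat_dim_eq)
  finally show ?thesis .
qed

end

text \<open>The definite description must first be shown to denote. A positive solution exists by
  the intermediate value theorem, since \<open>G 0 > 0\<close> and
  \<open>G r \<le> \<rho> + r\<^sup>2 / 2\<close>; monotonicity of
  \<open>mean_shift / w\<^sup>2\<close> excludes a second one. The half comes from
  \<open>d \<le> m / 2\<close>, and it turns the same estimate into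
  \<open>r\<^sup>2 \<le> 2 * \<rho>\<close>.\<close>

lemma fixed_point_radius_bound:
  assumes K: "closed_convex_on {1..n} K" and x: "x \<in> K" and ne: "K \<noteq> {x}" and y: "y \<in> K"
    and D: "closed_cone_on {1..n} D" and KD: "\<And>z. z \<in> K \<Longrightarrow> z - y \<in> D"
    and \<sigma>: "0 < \<sigma>" and m: "0 < m" and n: "0 < n" and d: "stat_dim {1..n} D \<le> real m / 2"
  shows "(fixed_point_radius m n \<sigma> K x)\<^sup>2
    \<le> 2 * ((L2_set (y - x) {1..n})\<^sup>2 / real n + \<sigma>\<^sup>2 / real m * stat_dim {1..n} D)"
proof -
  interpret K: closed_convex_on "{1..n}" K by (rule K)
  interpret D: closed_cone_on "{1..n}" D by (rule D)
  define d where "d = stat_dim {1..n} D"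
  have d0: "0 \<le> d" unfolding d_def by (rule D.stat_dim_nonneg)
  define \<rho> where "\<rho> = (L2_set (y - x) {1..n})\<^sup>2 / real n + \<sigma>\<^sup>2 / real m * d"
  have \<rho>0: "0 \<le> \<rho>" using d0 by (simp add: \<rho>_def)
  define w where "w = eff_noise \<sigma> (real m / real n)"
  have w2: "(w r)\<^sup>2 = (r\<^sup>2 + \<sigma>\<^sup>2) * real n / real m" for r
    using m n by (simp add: w_def eff_noise_def)
  have wpos: "0 < w r" for r
    using m n \<sigma> by (simp add: w_def eff_noise_def add_nonneg_pos)
  define G where "G = (\<lambda>r. K.mean_shift x (w r) / real n)"
  have Gcont: "continuous_on UNIV G"
  proof -
    have "continuous_on UNIV w" unfolding w_def eff_noise_def by (intro continuous_intros) (use m n in auto)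
    then have "continuous_on UNIV (K.mean_shift x \<circ> w)"
      by (intro continuous_on_compose continuous_on_subset[OF K.continuous_mean_shift[OF x]]) auto
    then show ?thesis unfolding G_def comp_def by (intro continuous_intros) (use n in auto)
  qed
  have Gle: "G r \<le> \<rho> + r\<^sup>2 / 2" for r
  proof -
    have "K.mean_shift x (w r) \<le> inner_on {1..n} (y - x) (y - x) + (w r)\<^sup>2 * d"
      unfolding d_def by (rule K.mean_shift_oracle[OF x y D KD]) (use wpos[of r] in auto)
    then have "G r \<le> (inner_on {1..n} (y - x) (y - x) + (w r)\<^sup>2 * d) / real n"
      unfolding G_def by (rule divide_right_mono) simp
    also have "\<dots> = \<rho> + r\<^sup>2 * (d / real m)"
      using m n by (simp add: \<rho>_def w2 L2_set_sq field_simps)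
    also have "\<dots> \<le> \<rho> + r\<^sup>2 * (1 / 2)"
      using d m by (intro add_left_mono mult_left_mono) (auto simp: d_def field_simps)
    finally show ?thesis by simp
  qed
  define R where "R = sqrt (2 * \<rho> + 1)"
  have R: "0 \<le> R" "R\<^sup>2 = 2 * \<rho> + 1" using \<rho>0 by (auto simp: R_def)
  have G0: "0 < G 0" unfolding G_def using K.mean_shift_pos[OF x ne wpos] n by simp
  have "\<exists>r. 0 \<le> r \<and> r \<le> R \<and> r\<^sup>2 - G r = 0"
  proof (rule IVT')
    show "0\<^sup>2 - G 0 \<le> 0" using G0 by simp
    show "0 \<le> R\<^sup>2 - G R" using Gle[of R] R(2) \<rho>0 by linarith
    show "continuous_on {0..R} (\<lambda>r. r\<^sup>2 - G r)"
      by (intro continuous_intros continuous_on_subset[OF Gcont]) auto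
  qed (rule R)
  then obtain r where r: "0 \<le> r" "G r = r\<^sup>2" by auto
  with G0 have rpos: "0 < r" by (cases "r = 0") auto
  \<comment> \<open>From r to s the ratio \<open>G / w\<^sup>2\<close> cannot increase. At solutions
    it is proportional to \<open>r\<^sup>2 / (r\<^sup>2 + \<sigma>\<^sup>2)\<close>, which strictly
    increases because \<sigma> is positive.\<close>
  have uniq: False if rs: "0 < r" "r < s" "G r = r\<^sup>2" "G s = s\<^sup>2" for r s
  proof -
    have "r\<^sup>2 < s\<^sup>2" using rs by (intro power_strict_mono) auto
    then have "(w r)\<^sup>2 \<le> (w s)\<^sup>2"
      unfolding w2 by (intro divide_right_mono mult_right_mono) auto
    then have "w r \<le> w s" by (rule power2_le_imp_le) (rule less_imp_le[OF wpos])
    then have "K.mean_shift x (w s) / (w s)\<^sup>2 \<le> K.mean_shift x (w r) / (w r)\<^sup>2"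
      by (rule K.mean_shift_sublinear[OF x wpos])
    moreover have "K.mean_shift x (w s) = real n * s\<^sup>2" "K.mean_shift x (w r) = real n * r\<^sup>2"
      using rs n by (simp_all add: G_def nonzero_divide_eq_eq mult.commute)
    moreover have cross: "a * d \<le> c * b" if "a / b \<le> c / d" "0 < b" "0 < d" for a b c d :: real
      using that by (simp add: field_simps)
    ultimately have main: "(real n * s\<^sup>2) * (w r)\<^sup>2 \<le> (real n * r\<^sup>2) * (w s)\<^sup>2"
      by (intro cross) (simp only:, rule zero_less_power[OF wpos], rule zero_less_power[OF wpos])
    have alg: "a \<le> b" if "(N * a) * ((b + q) * N / k) \<le> (N * b) * ((a + q) * N / k)" "0 < N" "0 < k" "0 < q"
      for a b q N k :: real
    proof -
      have "(N * N / k) * (a * (b + q)) \<le> (N * N / k) * (b * (a + q))" using that(1) by (simp add: mult_ac)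
      then have "a * (b + q) \<le> b * (a + q)" using that(2,3) by (simp only: mult_le_cancel_left_pos divide_pos_pos mult_pos_pos)
      then have "a * q \<le> b * q" by (simp add: algebra_simps)
      then show ?thesis using that(4) by simp
    qed
    have "s\<^sup>2 \<le> r\<^sup>2" by (rule alg[OF main[unfolded w2]]) (use m n \<sigma> in auto)
    then show False using \<open>r\<^sup>2 < s\<^sup>2\<close> by simp
  qed
  have Geq: "(\<integral>h. (L2_set (metric_proj {1..n} K (x + eff_noise \<sigma> (real m / real n) r *\<^sub>R h) - x) {1..n})\<^sup>2
          \<partial>std_gaussian {1..n}) / real n = G r" for r
    unfolding G_def K.mean_shift_def K.shift_def w_def ..
  have "fixed_point_radius m n \<sigma> K x = (THE r. 0 < r \<and> G r = r\<^sup>2)"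
    unfolding fixed_point_radius_def Geq ..
  also have "\<dots> = r"
  proof (rule the_equality)
    show "0 < r \<and> G r = r\<^sup>2" using rpos r by simp
    fix s assume "0 < s \<and> G s = s\<^sup>2"
    then show "s = r" using uniq[of r s] uniq[of s r] rpos r by (metis linorder_neq_iff)
  qed
  finally have "(fixed_point_radius m n \<sigma> K x)\<^sup>2 = G r" using r by simp
  moreover have "r\<^sup>2 \<le> 2 * \<rho>" using Gle[of r] r by simp
  ultimately show ?thesis using r by (simp add: \<rho>_def d_def)
qed

section \<open>The regression model\<close>

context gaussian_matrix
begin

text \<open>The rows act on the fixed vector b as \<open>L2_set b J\<close> times independent
  standard normals. The inequality covers \<open>b = 0\<close> on J as well, where the event is
  empty.\<close>

lemma rows_quadratic_tail:
  "{\<omega> \<in> space M. c * inner_on J b b < (\<Sum>i\<in>I. (inner_on J b (Z \<omega> i))\<^sup>2)} \<in> sets M"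
  "measure M {\<omega> \<in> space M. c * inner_on J b b < (\<Sum>i\<in>I. (inner_on J b (Z \<omega> i))\<^sup>2)}
    \<le> measure (PiM I (\<lambda>_. gauss1)) {x \<in> space (PiM I (\<lambda>_. gauss1)). c < (\<Sum>i\<in>I. (x i)\<^sup>2)}"
proof -
  let ?G = "PiM I (\<lambda>_. gauss1)" and ?S = "PiM I (\<lambda>_. std_gaussian J)"
  interpret G: prob_space ?G by (intro prob_space_PiM prob_space_gauss1)
  define a where "a = L2_set b J"
  define f where "f = (\<lambda>\<omega>. \<lambda>i\<in>I. inner_on J b (Z \<omega> i))"
  have im: "inner_on J b \<in> measurable (std_gaussian J) gauss1"
  proof -
    have "(\<lambda>y. inner_on J b y) \<in> borel_measurable (std_gaussian J)"
      by (rule measurable_inner_on) (auto intro: measurable_std_gaussian_coord)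
    then show ?thesis by (simp cong: measurable_cong_sets)
  qed
  have sm: "(\<lambda>x. a * x) \<in> measurable gauss1 gauss1" by (simp cong: measurable_cong_sets)
  have "distr M ?G f = distr (distr M ?S (\<lambda>\<omega>. \<lambda>i\<in>I. \<lambda>j\<in>J. Z \<omega> i j)) ?G (\<lambda>x. \<lambda>i\<in>I. inner_on J b (x i))"
  proof (subst distr_distr)
    show "(\<lambda>x. \<lambda>i\<in>I. inner_on J b (x i)) \<in> measurable ?S ?G" using im by measurable
    show "(\<lambda>\<omega>. \<lambda>i\<in>I. \<lambda>j\<in>J. Z \<omega> i j) \<in> measurable M ?S" by (rule measurable_rows)
    show "distr M ?G f = distr M ?G ((\<lambda>x. \<lambda>i\<in>I. inner_on J b (x i)) \<circ> (\<lambda>\<omega>. \<lambda>i\<in>I. \<lambda>j\<in>J. Z \<omega> i j))"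
      by (rule distr_cong) (auto simp: f_def inner_on_def fun_eq_iff)
  qed
  also have "\<dots> = PiM I (\<lambda>_. distr (std_gaussian J) gauss1 (inner_on J b))"
    unfolding distr_rows by (rule distr_PiM_map[OF finI prob_space_std_gaussian im])
  also have "distr (std_gaussian J) gauss1 (inner_on J b) = distr gauss1 gauss1 (\<lambda>x. a * x)"
  proof -
    have "distr (std_gaussian J) gauss1 (inner_on J b) = distr (std_gaussian J) borel (inner_on J b)"
      "distr gauss1 gauss1 (\<lambda>x. a * x) = distr gauss1 borel (\<lambda>x. a * x)"
      by (rule distr_cong; simp)+
    then show ?thesis using distr_std_gaussian_inner[OF finJ, of b] by (simp add: a_def)
  qed
  also have "PiM I (\<lambda>_. distr gauss1 gauss1 (\<lambda>x. a * x)) = distr ?G ?G (\<lambda>x. \<lambda>i\<in>I. a * x i)"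
    by (rule distr_PiM_map[OF finI prob_space_gauss1 sm, symmetric])
  finally have law: "distr M ?G f = distr ?G ?G (\<lambda>x. \<lambda>i\<in>I. a * x i)" .
  have fm: "f \<in> measurable M ?G"
    unfolding f_def using measurable_row_inner by (intro measurable_restrict) (simp cong: measurable_cong_sets)
  define E where "E = {x \<in> space ?G. c * inner_on J b b < (\<Sum>i\<in>I. (x i)\<^sup>2)}"
  have xm: "(\<lambda>x. \<Sum>i\<in>I. (x i)\<^sup>2) \<in> borel_measurable ?G"
  proof (intro borel_measurable_sum borel_measurable_power)
    fix i assume "i \<in> I"
    then have "(\<lambda>x. x i) \<in> measurable ?G gauss1" by measurable
    then show "(\<lambda>x. x i) \<in> borel_measurable ?G" by (simp cong: measurable_cong_sets)
  qed
  have Em: "E \<in> sets ?G" unfolding E_def using xm by measurable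
  have eq: "{\<omega> \<in> space M. c * inner_on J b b < (\<Sum>i\<in>I. (inner_on J b (Z \<omega> i))\<^sup>2)} = f -` E \<inter> space M"
    using measurable_space[OF fm] by (auto simp: E_def f_def cong: sum.cong)
  show "{\<omega> \<in> space M. c * inner_on J b b < (\<Sum>i\<in>I. (inner_on J b (Z \<omega> i))\<^sup>2)} \<in> sets M"
    unfolding eq by (rule measurable_sets[OF fm Em])
  have scm: "(\<lambda>x. \<lambda>i\<in>I. a * x i) \<in> measurable ?G ?G" using sm by measurable
  have "measure M {\<omega> \<in> space M. c * inner_on J b b < (\<Sum>i\<in>I. (inner_on J b (Z \<omega> i))\<^sup>2)} = measure (distr M ?G f) E"
    unfolding eq by (rule measure_distr[symmetric, OF fm Em])
  also have "\<dots> = measure ?G ((\<lambda>x. \<lambda>i\<in>I. a * x i) -` E \<inter> space ?G)"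
    unfolding law by (rule measure_distr[OF scm Em])
  also have "\<dots> \<le> measure ?G {x \<in> space ?G. c < (\<Sum>i\<in>I. (x i)\<^sup>2)}"
  proof (rule G.finite_measure_mono)
    show "{x \<in> space ?G. c < (\<Sum>i\<in>I. (x i)\<^sup>2)} \<in> sets ?G" using xm by measurable
    show "(\<lambda>x. \<lambda>i\<in>I. a * x i) -` E \<inter> space ?G \<subseteq> {x \<in> space ?G. c < (\<Sum>i\<in>I. (x i)\<^sup>2)}"
    proof safe
      fix x assume "(\<lambda>i\<in>I. a * x i) \<in> E"
      then have "c * a\<^sup>2 < a\<^sup>2 * (\<Sum>i\<in>I. (x i)\<^sup>2)"
        by (simp add: E_def a_def L2_set_sq power_mult_distrib sum_distrib_left cong: sum.cong)
      then have "a\<^sup>2 * c < a\<^sup>2 * (\<Sum>i\<in>I. (x i)\<^sup>2)" by (simp only: mult.commute)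
      then show "c < (\<Sum>i\<in>I. (x i)\<^sup>2)" by (rule mult_left_less_imp_less) simp
    qed
  qed
  finally show "measure M {\<omega> \<in> space M. c * inner_on J b b < (\<Sum>i\<in>I. (inner_on J b (Z \<omega> i))\<^sup>2)}
    \<le> measure ?G {x \<in> space ?G. c < (\<Sum>i\<in>I. (x i)\<^sup>2)}" .
qed

end

lemma linear_model_gaussian_matrix:
  assumes L: "linear_model M m n D X \<xi>" and m: "0 < m" and n: "0 < n"
  shows "gaussian_matrix M {1..m} {1..n} (\<lambda>\<omega> i j. sqrt (real n) * X \<omega> i j)"
proof -
  interpret prob_space M using L by (simp add: linear_model_def)
  have ind: "indep_vars (\<lambda>_. borel) (\<lambda>(i, j) \<omega>. X \<omega> i j) ({1..m} \<times> {1..n})"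
    using L by (simp add: linear_model_def)
  show ?thesis
  proof
    have "indep_vars (\<lambda>_. borel) (\<lambda>p \<omega>. sqrt (real n) * (case p of (i, j) \<Rightarrow> \<lambda>\<omega>. X \<omega> i j) \<omega>) ({1..m} \<times> {1..n})"
      by (rule indep_vars_compose2[OF ind]) measurable
    moreover have "(\<lambda>p \<omega>. sqrt (real n) * (case p of (i, j) \<Rightarrow> \<lambda>\<omega>. X \<omega> i j) \<omega>)
        = (\<lambda>(i, j) \<omega>. sqrt (real n) * X \<omega> i j)"
      by (auto simp: fun_eq_iff)
    ultimately show "indep_vars (\<lambda>_. borel) (\<lambda>(i, j) \<omega>. sqrt (real n) * X \<omega> i j) ({1..m} \<times> {1..n})" by simp
    fix i j assume ij: "i \<in> {1..m}" "j \<in> {1..n}"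
    have "distributed M lborel (\<lambda>\<omega>. X \<omega> i j) (normal_density 0 (sqrt (1 / real n)))"
      using L ij by (simp add: linear_model_def)
    then have X: "(\<lambda>\<omega>. X \<omega> i j) \<in> borel_measurable M"
      "distr M borel (\<lambda>\<omega>. X \<omega> i j) = distr gauss1 borel (\<lambda>x. sqrt (1 / real n) * x)"
      using distributed_normal_iff_distr[OF prob_space_axioms, of "sqrt (1 / real n)"] n by auto
    have "distr M borel (\<lambda>\<omega>. sqrt (real n) * X \<omega> i j)
        = distr (distr M borel (\<lambda>\<omega>. X \<omega> i j)) borel (\<lambda>x. sqrt (real n) * x)"
      using X(1) by (subst distr_distr) (auto simp: comp_def)
    also have "\<dots> = distr gauss1 borel (\<lambda>x. sqrt (real n) * (sqrt (1 / real n) * x))"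
      unfolding X(2) by (subst distr_distr) (auto simp: comp_def)
    also have "(\<lambda>x. sqrt (real n) * (sqrt (1 / real n) * x)) = (\<lambda>x. x)"
      using n by (simp add: fun_eq_iff real_sqrt_divide)
    finally show "distr M borel (\<lambda>\<omega>. sqrt (real n) * X \<omega> i j) = gauss1"
      by (simp add: distr_id2)
  qed (use m n in auto)
qed

text \<open>The law \<open>D\<close> is common to all instances, so the right-hand side depends on
  the instance only through m and c, and one threshold of the weak law serves the whole
  sequence.\<close>

lemma linear_model_noise_tail:
  assumes L: "linear_model M m n D X \<xi>" and m: "0 < m" and D: "real_distribution D"
  shows "{\<omega> \<in> space M. c < inner_on {1..m} (\<xi> \<omega>) (\<xi> \<omega>)} \<in> sets M"
    "measure M {\<omega> \<in> space M. c < inner_on {1..m} (\<xi> \<omega>) (\<xi> \<omega>)}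
      = measure (PiM {1..m} (\<lambda>_. D)) {x \<in> space (PiM {1..m} (\<lambda>_. D)). c < (\<Sum>i\<in>{1..m}. (x i)\<^sup>2)}"
proof -
  interpret prob_space M using L by (simp add: linear_model_def)
  interpret D: real_distribution D by (rule D)
  let ?P = "PiM {1..m} (\<lambda>_. D)"
  have ind: "indep_vars (\<lambda>_. borel) (\<lambda>i \<omega>. \<xi> \<omega> i) {1..m}"
    and dist: "\<And>i. i \<in> {1..m} \<Longrightarrow> distr M borel (\<lambda>\<omega>. \<xi> \<omega> i) = D"
    using L by (auto simp: linear_model_def)
  have meas: "(\<lambda>\<omega>. \<xi> \<omega> i) \<in> borel_measurable M" if "i \<in> {1..m}" for i
    using ind that by (auto simp: indep_vars_def)
  have setsP: "sets ?P = sets (PiM {1..m} (\<lambda>_. borel))" by (rule sets_PiM_cong) auto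
  have "distr M (PiM {1..m} (\<lambda>_. borel)) (\<lambda>\<omega>. \<lambda>i\<in>{1..m}. \<xi> \<omega> i) = PiM {1..m} (\<lambda>i. distr M borel (\<lambda>\<omega>. \<xi> \<omega> i))"
    by (subst indep_vars_iff_distr_eq_PiM'[THEN iffD1, OF _ meas ind]) (use m in auto)
  also have "\<dots> = ?P" by (rule PiM_cong) (simp_all add: dist)
  finally have law: "distr M (PiM {1..m} (\<lambda>_. borel)) (\<lambda>\<omega>. \<lambda>i\<in>{1..m}. \<xi> \<omega> i) = ?P" .
  have fm: "(\<lambda>\<omega>. \<lambda>i\<in>{1..m}. \<xi> \<omega> i) \<in> measurable M (PiM {1..m} (\<lambda>_. borel))"
    using meas by measurable
  define E where "E = {x \<in> space ?P. c < (\<Sum>i\<in>{1..m}. (x i)\<^sup>2)}"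
  have spP: "space ?P = space (PiM {1..m} (\<lambda>_. borel))" by (rule sets_eq_imp_space_eq[OF setsP])
  have "{x \<in> space (PiM {1..m} (\<lambda>_. borel)). c < (\<Sum>i\<in>{1..m}. (x i :: real)\<^sup>2)} \<in> sets (PiM {1..m} (\<lambda>_. borel))"
    by measurable
  then have Em: "E \<in> sets (PiM {1..m} (\<lambda>_. borel))" by (simp only: E_def spP)
  have eq: "{\<omega> \<in> space M. c < inner_on {1..m} (\<xi> \<omega>) (\<xi> \<omega>)} = (\<lambda>\<omega>. \<lambda>i\<in>{1..m}. \<xi> \<omega> i) -` E \<inter> space M"
  proof -
    have "(\<Sum>i\<in>{1..m}. ((\<lambda>i\<in>{1..m}. \<xi> \<omega> i) i)\<^sup>2) = inner_on {1..m} (\<xi> \<omega>) (\<xi> \<omega>)" for \<omega>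
      unfolding inner_on_def by (rule sum.cong) (auto simp: power2_eq_square)
    then have "(\<lambda>i\<in>{1..m}. \<xi> \<omega> i) \<in> E \<longleftrightarrow> c < inner_on {1..m} (\<xi> \<omega>) (\<xi> \<omega>)" if "\<omega> \<in> space M" for \<omega>
      using measurable_space[OF fm that] unfolding E_def spP mem_Collect_eq by (simp only: simp_thms)
    then show ?thesis by blast
  qed
  show "{\<omega> \<in> space M. c < inner_on {1..m} (\<xi> \<omega>) (\<xi> \<omega>)} \<in> sets M"
    unfolding eq by (rule measurable_sets[OF fm Em])
  show "measure M {\<omega> \<in> space M. c < inner_on {1..m} (\<xi> \<omega>) (\<xi> \<omega>)} = measure ?P {x \<in> space ?P. c < (\<Sum>i\<in>{1..m}. (x i)\<^sup>2)}"
    unfolding eq E_def[symmetric] using measure_distr[OF fm Em] by (simp only: law)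
qed

section \<open>Deterministic inequalities for near minimizers\<close>

lemma mat_vec_simps:
  "mat_vec m n A (x + y) = mat_vec m n A x + mat_vec m n A y"
  "mat_vec m n A (x - y) = mat_vec m n A x - mat_vec m n A y"
  "mat_vec m n A (c *\<^sub>R x) = c *\<^sub>R mat_vec m n A x"
  by (auto simp: mat_vec_def fun_eq_iff sum.distrib sum_subtractf sum_distrib_left algebra_simps)

lemma mat_vec_normalized:
  assumes n: "0 < n"
  shows "inner_on {1..m} (mat_vec m n A v) (mat_vec m n A v)
      = (\<Sum>i\<in>{1..m}. (inner_on {1..n} v (\<lambda>j. sqrt (real n) * A i j))\<^sup>2) / real n"
    and "inner_on {1..m} u (mat_vec m n A v)
      = inner_on {1..n} (\<lambda>j. \<Sum>i\<in>{1..m}. u i * (sqrt (real n) * A i j)) v / sqrt (real n)"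
proof -
  have row: "inner_on {1..n} v (\<lambda>j. sqrt (real n) * A i j) = sqrt (real n) * mat_vec m n A v i" if "i \<in> {1..m}" for i
    using that by (simp add: inner_on_def mat_vec_def sum_distrib_left mult_ac)
  have "(\<Sum>i\<in>{1..m}. (inner_on {1..n} v (\<lambda>j. sqrt (real n) * A i j))\<^sup>2) = (\<Sum>i\<in>{1..m}. real n * (mat_vec m n A v i * mat_vec m n A v i))"
  proof (rule sum.cong[OF refl])
    fix i assume "i \<in> {1..m}"
    then show "(inner_on {1..n} v (\<lambda>j. sqrt (real n) * A i j))\<^sup>2 = real n * (mat_vec m n A v i * mat_vec m n A v i)"
      unfolding row[OF \<open>i \<in> {1..m}\<close>] by (simp add: power_mult_distrib power2_eq_square)
  qed
  then show "inner_on {1..m} (mat_vec m n A v) (mat_vec m n A v)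
      = (\<Sum>i\<in>{1..m}. (inner_on {1..n} v (\<lambda>j. sqrt (real n) * A i j))\<^sup>2) / real n"
    using n by (simp add: inner_on_def flip: sum_distrib_left)
  have "inner_on {1..n} (\<lambda>j. \<Sum>i\<in>{1..m}. u i * (sqrt (real n) * A i j)) v
      = (\<Sum>j\<in>{1..n}. \<Sum>i\<in>{1..m}. u i * (sqrt (real n) * A i j) * v j)"
    by (simp add: inner_on_def sum_distrib_right)
  also have "\<dots> = (\<Sum>i\<in>{1..m}. \<Sum>j\<in>{1..n}. u i * (sqrt (real n) * A i j) * v j)" by (rule sum.swap)
  also have "\<dots> = sqrt (real n) * inner_on {1..m} u (mat_vec m n A v)"
    by (simp add: inner_on_def mat_vec_def sum_distrib_left mult_ac)
  finally show "inner_on {1..m} u (mat_vec m n A v)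
      = inner_on {1..n} (\<lambda>j. \<Sum>i\<in>{1..m}. u i * (sqrt (real n) * A i j)) v / sqrt (real n)"
    using n by simp
qed

lemma inner_on_convex_combination:
  "inner_on I ((1 - l) *\<^sub>R p + l *\<^sub>R q) ((1 - l) *\<^sub>R p + l *\<^sub>R q)
    = (1 - l) * inner_on I p p + l * inner_on I q q - l * (1 - l) * inner_on I (p - q) (p - q)"
  by (simp add: inner_on_simps inner_on_commute[of I q p] algebra_simps)

lemma inner_on_diff_sq_diff:
  "inner_on I (z - a) (z - a) - inner_on I (z - c) (z - c)
    = inner_on I a a - inner_on I c c - 2 * inner_on I z (a - c)"
  by (simp add: inner_on_simps inner_on_commute[of I a z] inner_on_commute[of I c z])

text \<open>
  Strong convexity of the loss: comparison with the point \<open>(1 - l) \<nu> + l \<mu>\<close> gains an additional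
  quadratic term, which is what makes the leading constant of the oracle inequality one.
\<close>

lemma near_minimizer_inequality:
  assumes K: "convex K" "\<nu> \<in> K" "\<mu> \<in> K" and m: "0 < m" and l: "0 < l" "l < 1"
    and near: "\<And>\<kappa>. \<kappa> \<in> K \<Longrightarrow> sq_loss m n A y \<nu> \<le> sq_loss m n A y \<kappa> + e"
    and y: "\<And>i. i \<in> {1..m} \<Longrightarrow> y i = mat_vec m n A x i + z i"
  shows "inner_on {1..m} (mat_vec m n A (\<nu> - x)) (mat_vec m n A (\<nu> - x)) / real m
      - inner_on {1..m} (mat_vec m n A (\<mu> - x)) (mat_vec m n A (\<mu> - x)) / real m
      - 2 * inner_on {1..m} z (mat_vec m n A (\<nu> - \<mu>)) / real m
      + (1 - l) * (inner_on {1..m} (mat_vec m n A (\<nu> - \<mu>)) (mat_vec m n A (\<nu> - \<mu>)) / real m) \<le> e / l"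
proof -
  let ?i = "inner_on {1..m}" and ?X = "mat_vec m n A"
  define \<kappa> where "\<kappa> = (1 - l) *\<^sub>R \<nu> + l *\<^sub>R \<mu>"
  have "\<kappa> \<in> K" unfolding \<kappa>_def using l by (intro convexD_alt[OF K]) auto
  define p where "p = y - ?X \<nu>"
  define q where "q = y - ?X \<mu>"
  have loss: "sq_loss m n A y u = ?i (y - ?X u) (y - ?X u) / real m" for u
    by (simp add: sq_loss_def L2_set_sq)
  have "y - ?X \<kappa> = (1 - l) *\<^sub>R p + l *\<^sub>R q"
    unfolding \<kappa>_def p_def q_def mat_vec_simps by (rule ext) (simp add: algebra_simps)
  then have "?i (y - ?X \<kappa>) (y - ?X \<kappa>)
      = (1 - l) * ?i p p + l * ?i q q - l * (1 - l) * ?i (p - q) (p - q)"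
    by (simp only: inner_on_convex_combination)
  moreover have "p - q = - ?X (\<nu> - \<mu>)" unfolding p_def q_def mat_vec_simps by (rule ext) simp
  then have "?i (p - q) (p - q) = ?i (?X (\<nu> - \<mu>)) (?X (\<nu> - \<mu>))"
    by (simp only: inner_on_simps minus_minus)
  ultimately have k: "?i (y - ?X \<kappa>) (y - ?X \<kappa>)
      = (1 - l) * ?i p p + l * ?i q q - l * (1 - l) * ?i (?X (\<nu> - \<mu>)) (?X (\<nu> - \<mu>))"
    by (simp only:)
  have "?i p p / real m \<le> ?i (y - ?X \<kappa>) (y - ?X \<kappa>) / real m + e"
    using near[OF \<open>\<kappa> \<in> K\<close>] by (simp add: loss p_def)
  \<comment> \<open>Comparison at weight l leaves a factor l on everything but the slack. Dividing
    by it yields the gain \<open>1 - l\<close> at the price \<open>e / l\<close>.\<close>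
  then have "l * (?i p p / real m - ?i q q / real m + (1 - l) * (?i (?X (\<nu> - \<mu>)) (?X (\<nu> - \<mu>)) / real m)) \<le> e"
    unfolding k by (simp add: algebra_simps add_divide_distrib diff_divide_distrib)
  then have main: "?i p p / real m - ?i q q / real m + (1 - l) * (?i (?X (\<nu> - \<mu>)) (?X (\<nu> - \<mu>)) / real m) \<le> e / l"
    using l by (simp add: pos_le_divide_eq mult.commute)
  have cong: "?i u u = ?i w w" if "\<And>i. i \<in> {1..m} \<Longrightarrow> u i = w i" for u w
    using that by (simp add: inner_on_def)
  have "?i p p = ?i (z - ?X (\<nu> - x)) (z - ?X (\<nu> - x))"
    by (rule cong) (simp add: p_def y mat_vec_simps)
  moreover have "?i q q = ?i (z - ?X (\<mu> - x)) (z - ?X (\<mu> - x))"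
    by (rule cong) (simp add: q_def y mat_vec_simps)
  moreover have "?X (\<nu> - \<mu>) = ?X (\<nu> - x) - ?X (\<mu> - x)" unfolding mat_vec_simps by simp
  ultimately have "?i p p - ?i q q = ?i (?X (\<nu> - x)) (?X (\<nu> - x)) - ?i (?X (\<mu> - x)) (?X (\<mu> - x))
      - 2 * ?i z (?X (\<nu> - \<mu>))"
    by (simp only: inner_on_diff_sq_diff)
  then have "?i p p / real m - ?i q q / real m = ?i (?X (\<nu> - x)) (?X (\<nu> - x)) / real m
      - ?i (?X (\<mu> - x)) (?X (\<mu> - x)) / real m - 2 * ?i z (?X (\<nu> - \<mu>)) / real m"
    unfolding diff_divide_distrib[symmetric] by (simp only:)
  then show ?thesis using main by simp
qed

text \<open>The noise term is split as \<open>2 * s * sqrt V2 \<le> c * V2 + s\<^sup>2 / c\<close>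
  with \<open>c = 1 - 3 * \<eta>\<close>: of the gain \<open>(1 - \<eta>)\<^sup>2 * V2\<close>, the
  error in the bound on \<open>P\<close> takes \<open>\<eta> * V2\<close>, and at least
  \<open>c * V2\<close> remains. The factor \<open>1 + 2 * \<eta>\<close> collects one \<eta> from
  each of the bounds on \<open>P\<close> and \<open>R\<close>.\<close>

lemma oracle_arithmetic:
  fixes W V2 B2 P R N S \<eta> s r2 :: real
  assumes h: "P - R - 2 * N + (1 - \<eta>) * S \<le> \<eta> * r2"
    and P: "W - \<eta> * (B2 + V2) \<le> P" and S: "(1 - \<eta>) * V2 \<le> S" and R: "R \<le> (1 + \<eta>) * B2"
    and N: "N \<le> s * sqrt V2" and V: "0 \<le> V2" and \<eta>: "0 < \<eta>" "\<eta> < 1 / 3"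
  shows "W \<le> (1 + 2 * \<eta>) * B2 + s\<^sup>2 / (1 - 3 * \<eta>) + \<eta> * r2"
proof -
  define c where "c = 1 - 3 * \<eta>"
  have c: "0 < c" using \<eta> by (simp add: c_def)
  have "0 \<le> (sqrt c * sqrt V2 - s / sqrt c)\<^sup>2" by simp
  also have "\<dots> = c * V2 - 2 * (s * sqrt V2) + s\<^sup>2 / c"
    using c V by (simp add: power2_diff power_mult_distrib power_divide)
  finally have am: "2 * (s * sqrt V2) \<le> c * V2 + s\<^sup>2 / c" by simp
  have "(1 - \<eta>) * ((1 - \<eta>) * V2) \<le> (1 - \<eta>) * S" using S \<eta> by (intro mult_left_mono) auto
  moreover have "(c + \<eta>) * V2 \<le> (1 - \<eta>) * ((1 - \<eta>) * V2)"
  proof -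
    have "(1 - \<eta>) * (1 - \<eta>) - (c + \<eta>) = \<eta> * \<eta>" by (simp add: c_def algebra_simps)
    then have "c + \<eta> \<le> (1 - \<eta>) * (1 - \<eta>)" using zero_le_square[of \<eta>] by linarith
    then show ?thesis unfolding mult.assoc[symmetric] using V by (rule mult_right_mono)
  qed
  ultimately have "(c + \<eta>) * V2 \<le> (1 - \<eta>) * S" by linarith
  then have "c * V2 + \<eta> * V2 \<le> (1 - \<eta>) * S" by (simp add: algebra_simps)
  then show ?thesis using h P R N am unfolding c_def[symmetric] by (simp add: algebra_simps)
qed

text \<open>The bad event is a union of four, each of probability at most \<delta>: failure of the
  lower isometry, \<open>|X b|^2\<close> too large, the noise norm too large, the projection norm
  too large. It is fixed before \<omega>, \<nu>, e and r2 are given, so the last three may depend on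
  \<omega>.\<close>

lemma instance_bound:
  assumes L: "linear_model M m n D X \<xi>" and D: "real_distribution D" and m: "0 < m" and n: "0 < n"
    and K: "closed_convex_on {1..n} K" and x: "x \<in> K" and y: "\<mu> \<in> K"
    and C: "closed_cone_on {1..n} C" and KC: "\<And>\<nu>. \<nu> \<in> K \<Longrightarrow> \<nu> - \<mu> \<in> C"
    and Y: "\<And>\<omega> i. \<omega> \<in> space M \<Longrightarrow> i \<in> {1..m} \<Longrightarrow> Y \<omega> i = mat_vec m n (X \<omega>) x i + \<xi> \<omega> i"
    and \<eta>: "0 < \<eta>" "\<eta> < 1 / 3" and \<tau>: "0 < \<tau>" and \<sigma>: "0 < \<sigma>"
    and N1: "measure (PiM {1..m} (\<lambda>_. D)) {x \<in> space (PiM {1..m} (\<lambda>_. D)). (1 + \<eta>) * \<sigma>\<^sup>2 * real m < (\<Sum>i\<in>{1..m}. (x i)\<^sup>2)} \<le> \<delta>"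
    and N2: "measure (PiM {1..m} (\<lambda>_. gauss1)) {x \<in> space (PiM {1..m} (\<lambda>_. gauss1)). (1 + \<eta>) * real m < (\<Sum>i\<in>{1..m}. (x i)\<^sup>2)} \<le> \<delta>"
    and iso: "8 * sqrt (96 / \<eta>) / \<eta> * ((1 + sqrt (stat_dim {1..n} C)) / sqrt (real m)) \<le> \<delta>"
    and noise: "pi\<^sup>2 / (2 * \<eta> * \<tau>) \<le> \<delta>"
  obtains Bad where "Bad \<in> sets M" "measure M Bad \<le> 4 * \<delta>"
    "\<And>\<omega> \<nu> e r2. \<omega> \<in> space M - Bad \<Longrightarrow> \<nu> \<in> K \<Longrightarrow>
      (\<And>\<kappa>. \<kappa> \<in> K \<Longrightarrow> sq_loss m n (X \<omega>) (Y \<omega>) \<nu> \<le> sq_loss m n (X \<omega>) (Y \<omega>) \<kappa> + e) \<Longrightarrow> e \<le> \<eta>\<^sup>2 * r2 \<Longrightarrow>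
      (L2_set (\<nu> - x) {1..n})\<^sup>2 / real n \<le> (1 + 2 * \<eta>) * ((L2_set (\<mu> - x) {1..n})\<^sup>2 / real n)
        + ((1 + \<eta>) * \<sigma>\<^sup>2 * ((1 + \<eta>) * stat_dim {1..n} C + \<tau>) / real m) / (1 - 3 * \<eta>) + \<eta> * r2"
proof -
  define I where "I = {1..m}"
  define J where "J = {1..n}"
  define Z where "Z = (\<lambda>\<omega> i j. sqrt (real n) * X \<omega> i j)"
  interpret G: gaussian_matrix M I J Z
    unfolding I_def J_def Z_def by (rule linear_model_gaussian_matrix[OF L m n])
  interpret K: closed_convex_on J K using K by (simp only: J_def)
  interpret C: closed_cone_on J C using C by (simp only: J_def)
  have cardI: "real (card I) = real m" by (simp add: I_def)
  define d where "d = stat_dim J C"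
  have d0: "0 \<le> d" unfolding d_def by (rule C.stat_dim_nonneg)
  define b where "b = \<mu> - x"
  have bJ: "b \<in> coord_space J" unfolding b_def using x y K.sub by (intro coord_space_convex) auto
  obtain A1 where A1: "A1 \<in> sets M"
    "measure M A1 \<le> 8 * sqrt (96 / \<eta>) / \<eta> * ((1 + sqrt (stat_dim J C)) / sqrt (real (card I)))"
    "\<And>\<omega> v. \<omega> \<in> space M - A1 \<Longrightarrow> v \<in> C \<Longrightarrow>
      real (card I) * ((1 - \<eta>) * inner_on J v v) \<le> (\<Sum>i\<in>I. (inner_on J v (Z \<omega> i))\<^sup>2)"
    "\<And>\<omega> v. \<omega> \<in> space M - A1 \<Longrightarrow> v \<in> C \<Longrightarrow>
      real (card I) * (inner_on J (b + v) (b + v) - \<eta> * (inner_on J b b + inner_on J v v))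
        \<le> (\<Sum>i\<in>I. (inner_on J (b + v) (Z \<omega> i))\<^sup>2)"
    by (rule G.lower_isometry[OF C.closed_cone_on_axioms bJ \<eta>(1)]) (rule that)
  define A2 where "A2 = {\<omega> \<in> space M. (1 + \<eta>) * real m * inner_on J b b < (\<Sum>i\<in>I. (inner_on J b (Z \<omega> i))\<^sup>2)}"
  have A2: "A2 \<in> sets M" "measure M A2 \<le> \<delta>"
    using G.rows_quadratic_tail[of "(1 + \<eta>) * real m" b] N2 unfolding A2_def I_def by auto
  define A3 where "A3 = {\<omega> \<in> space M. (1 + \<eta>) * \<sigma>\<^sup>2 * real m < inner_on I (\<xi> \<omega>) (\<xi> \<omega>)}"
  have A3: "A3 \<in> sets M" "measure M A3 \<le> \<delta>"
    using linear_model_noise_tail[OF L m D, of "(1 + \<eta>) * \<sigma>\<^sup>2 * real m"] N1 unfolding A3_def I_def by auto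
  define c where "c = (1 + \<eta>) * d + \<tau>"
  have c0: "0 < c" unfolding c_def using \<eta> \<tau> d0 by (intro add_nonneg_pos) auto
  define A4 where "A4 = {\<omega> \<in> space M. inner_on I (\<xi> \<omega>) (\<xi> \<omega>) * ((1 + \<eta>) * stat_dim J C + \<tau>)
      < C.proj_sq (\<lambda>j. \<Sum>i\<in>I. \<xi> \<omega> i * Z \<omega> i j)}"
  have A4: "A4 \<in> sets M" "measure M A4 \<le> pi\<^sup>2 / (2 * \<eta> * \<tau>)"
  proof -
    define f where "f = (\<lambda>\<omega>. \<lambda>(i, j)\<in>{1..m} \<times> {1..n}. X \<omega> i j)"
    define g where "g = (\<lambda>\<omega>. \<lambda>i\<in>{1..m}. \<xi> \<omega> i)"
    define PX where "PX = PiM ({1..m} \<times> {1..n}) (\<lambda>_. borel :: real measure)"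
    define P\<xi> where "P\<xi> = PiM {1..m} (\<lambda>_. borel :: real measure)"
    note L' = L[unfolded linear_model_def]
    have iv: "G.indep_vars (\<lambda>_. borel) (\<lambda>(i, j) \<omega>. X \<omega> i j) ({1..m} \<times> {1..n})"
      "G.indep_vars (\<lambda>_. borel) (\<lambda>i \<omega>. \<xi> \<omega> i) {1..m}"
      and ind: "G.indep_set (sets (vimage_algebra (space M) f PX)) (sets (vimage_algebra (space M) g P\<xi>))"
      unfolding f_def g_def PX_def P\<xi>_def
      by (rule L'[THEN conjunct2, THEN conjunct1], rule L'[THEN conjunct2, THEN conjunct2, THEN conjunct2, THEN conjunct1],
        rule L'[THEN conjunct2, THEN conjunct2, THEN conjunct2, THEN conjunct2, THEN conjunct2])
    have fm: "f \<in> measurable M PX" unfolding f_def PX_def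
    proof (rule measurable_restrict)
      fix p assume "p \<in> {1..m} \<times> {1..n}"
      then show "(\<lambda>\<omega>. case p of (i, j) \<Rightarrow> X \<omega> i j) \<in> borel_measurable M"
        using iv(1) by (auto simp: G.indep_vars_def)
    qed
    have gm: "g \<in> measurable M P\<xi>" unfolding g_def P\<xi>_def
      using iv(2) by (intro measurable_restrict) (auto simp: G.indep_vars_def)
    have pair: "distr M (PX \<Otimes>\<^sub>M P\<xi>) (\<lambda>\<omega>. (f \<omega>, g \<omega>)) = distr M PX f \<Otimes>\<^sub>M distr M P\<xi> g"
      by (rule G.distr_pair_of_indep_set[OF fm gm ind])
    have z1: "(\<lambda>q. sqrt (real n) * q (i, j)) \<in> borel_measurable PX" if "i \<in> I" "j \<in> J" for i j
      using that unfolding PX_def I_def J_def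
      by (intro borel_measurable_times borel_measurable_const measurable_component_singleton) auto
    have z2: "Z \<omega> i j = sqrt (real n) * f \<omega> (i, j)" if "i \<in> I" "j \<in> J" for \<omega> i j
      using that by (simp add: Z_def f_def I_def J_def)
    have t1: "(\<lambda>q. q i) \<in> borel_measurable P\<xi>" if "i \<in> I" for i
      using that unfolding P\<xi>_def I_def by measurable
    have t2: "\<xi> \<omega> i = g \<omega> i" if "i \<in> I" for \<omega> i
      using that by (simp add: g_def I_def)
    note res = G.noise_projection_tail[where PX = PX and P\<xi> = P\<xi> and Xr = f and \<xi>r = g and \<xi> = \<xi>
      and \<zeta> = "\<lambda>i j q. sqrt (real n) * q (i, j)" and \<theta> = "\<lambda>i q. q i" and C = C,
      OF C.closed_cone_on_axioms \<eta>(1) \<tau> fm gm pair]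
    show "A4 \<in> sets M" unfolding A4_def
      by (rule res(1)) (erule (1) z1, erule (1) z2, erule t1, erule t2)
    show "measure M A4 \<le> pi\<^sup>2 / (2 * \<eta> * \<tau>)" unfolding A4_def
      by (rule res(2)) (erule (1) z1, erule (1) z2, erule t1, erule t2)
  qed
  define Bad where "Bad = (A1 \<union> A2) \<union> (A3 \<union> A4)"
  show ?thesis
  proof (rule that[of Bad])
    show "Bad \<in> sets M" using A1 A2 A3 A4 by (simp add: Bad_def)
    have "measure M Bad \<le> (measure M A1 + measure M A2) + (measure M A3 + measure M A4)"
      unfolding Bad_def using A1(1) A2(1) A3(1) A4(1)
      by (intro order_trans[OF measure_Un_le] add_mono measure_Un_le) auto
    moreover have "measure M A1 \<le> \<delta>" using A1(2) iso unfolding cardI J_def by linarith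
    ultimately show "measure M Bad \<le> 4 * \<delta>" using A2(2) A3(2) A4(2) noise by linarith
    fix \<omega> \<nu> e r2
    assume \<omega>: "\<omega> \<in> space M - Bad" and \<nu>: "\<nu> \<in> K" and e: "e \<le> \<eta>\<^sup>2 * r2"
      and near: "\<And>\<kappa>. \<kappa> \<in> K \<Longrightarrow> sq_loss m n (X \<omega>) (Y \<omega>) \<nu> \<le> sq_loss m n (X \<omega>) (Y \<omega>) \<kappa> + e"
    have \<omega>A: "\<omega> \<in> space M" "\<omega> \<in> space M - A1" "\<omega> \<notin> A2" "\<omega> \<notin> A3" "\<omega> \<notin> A4"
      using \<omega> by (simp_all add: Bad_def)
    define v where "v = \<nu> - \<mu>"
    have vC: "v \<in> C" unfolding v_def by (rule KC) fact
    have bv: "\<nu> - x = b + v" by (rule ext) (simp add: b_def v_def)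
    let ?X = "mat_vec m n (X \<omega>)"
    have sq: "inner_on I (?X u) (?X u) / real m = (\<Sum>i\<in>I. (inner_on J u (Z \<omega> i))\<^sup>2) / (real m * real n)" for u
      unfolding I_def J_def Z_def mat_vec_normalized(1)[OF n] by (simp add: mult.commute)
    have mn: "0 < real m" "0 < real n" "0 < real m * real n" using m n by auto
    have W: "(L2_set (\<nu> - x) {1..n})\<^sup>2 / real n = inner_on J (b + v) (b + v) / real n"
      unfolding bv by (simp only: L2_set_sq J_def)
    have B2: "(L2_set (\<mu> - x) {1..n})\<^sup>2 / real n = inner_on J b b / real n"
      unfolding b_def by (simp only: L2_set_sq J_def)
    define V2 where "V2 = inner_on J v v / real n"
    \<comment> \<open>Off the bad event
      \<open>|\<xi>|^2 \<le> (1 + \<eta>) * \<sigma>\<^sup>2 * m\<close> and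
      \<open>proj_sq z \<le> |\<xi>|^2 * c\<close>. Together they make this the factor of
      \<open>sqrt V2\<close> in the noise term.\<close>
    define s where "s = sqrt ((1 + \<eta>) * \<sigma>\<^sup>2 * c / real m)"
    have s2: "s\<^sup>2 = (1 + \<eta>) * \<sigma>\<^sup>2 * c / real m" unfolding s_def using \<eta> c0 by simp
    have "inner_on I (?X (b + v)) (?X (b + v)) / real m - inner_on I (?X b) (?X b) / real m
        - 2 * (inner_on I (\<xi> \<omega>) (?X v) / real m) + (1 - \<eta>) * (inner_on I (?X v) (?X v) / real m) \<le> \<eta> * r2"
    proof -
      have cvx: "\<eta> < 1" using \<eta> by simp
      have Yw: "Y \<omega> i = mat_vec m n (X \<omega>) x i + \<xi> \<omega> i" if "i \<in> {1..m}" for i using Y \<omega> that by blast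
      \<comment> \<open>The interpolation weight is \<eta>; the slack bound carries
        \<open>\<eta>\<^sup>2\<close> so that a factor \<eta> survives the division.\<close>
      have "e / \<eta> \<le> \<eta> * r2" using e \<eta> by (simp add: pos_divide_le_eq power2_eq_square mult_ac)
      with near_minimizer_inequality[OF K.convexC \<nu> y m \<eta>(1) cvx near Yw]
      show ?thesis unfolding I_def bv b_def[symmetric] v_def[symmetric] by simp
    qed
    moreover have "inner_on J (b + v) (b + v) / real n - \<eta> * (inner_on J b b / real n + V2)
        \<le> inner_on I (?X (b + v)) (?X (b + v)) / real m"
    proof -
      have "real m * (inner_on J (b + v) (b + v) - \<eta> * (inner_on J b b + inner_on J v v)) / (real m * real n)
          \<le> inner_on I (?X (b + v)) (?X (b + v)) / real m"
        unfolding sq using A1(4)[OF \<omega>A(2) vC] mn unfolding cardI by (intro divide_right_mono) simp_all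
      moreover have "real m * (inner_on J (b + v) (b + v) - \<eta> * (inner_on J b b + inner_on J v v)) / (real m * real n)
          = inner_on J (b + v) (b + v) / real n - \<eta> * (inner_on J b b / real n + V2)"
      proof -
        have "inner_on J b b / real n + V2 = (inner_on J b b + inner_on J v v) / real n"
          by (simp add: V2_def add_divide_distrib)
        then show ?thesis using mn by (simp add: diff_divide_distrib)
      qed
      ultimately show ?thesis by simp
    qed
    moreover have "(1 - \<eta>) * V2 \<le> inner_on I (?X v) (?X v) / real m"
    proof -
      have "real m * ((1 - \<eta>) * inner_on J v v) / (real m * real n) \<le> inner_on I (?X v) (?X v) / real m"
        unfolding sq using A1(3)[OF \<omega>A(2) vC] mn unfolding cardI by (intro divide_right_mono) simp_all
      then show ?thesis using mn by (simp add: V2_def)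
    qed
    moreover have "inner_on I (?X b) (?X b) / real m \<le> (1 + \<eta>) * (inner_on J b b / real n)"
    proof -
      have "(\<Sum>i\<in>I. (inner_on J b (Z \<omega> i))\<^sup>2) \<le> (1 + \<eta>) * real m * inner_on J b b"
        using \<omega>A(1,3) unfolding A2_def by (simp add: not_less)
      then have "inner_on I (?X b) (?X b) / real m \<le> (1 + \<eta>) * real m * inner_on J b b / (real m * real n)"
        unfolding sq using mn by (intro divide_right_mono) simp_all
      then show ?thesis using mn by simp
    qed
    moreover have "inner_on I (\<xi> \<omega>) (?X v) / real m \<le> s * sqrt V2"
    proof -
      define z where "z = (\<lambda>j. \<Sum>i\<in>I. \<xi> \<omega> i * Z \<omega> i j)"
      have "C.proj_sq z \<le> inner_on I (\<xi> \<omega>) (\<xi> \<omega>) * c"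
        using \<omega>A(1,5) unfolding A4_def z_def c_def d_def by (simp add: not_less)
      also have "\<dots> \<le> ((1 + \<eta>) * \<sigma>\<^sup>2 * real m) * c"
        using \<omega>A(1,4) c0 unfolding A3_def by (intro mult_right_mono) (simp_all add: not_less)
      finally have "sqrt (C.proj_sq z) \<le> sqrt ((1 + \<eta>) * \<sigma>\<^sup>2 * real m * c)" by (rule real_sqrt_le_mono)
      moreover have "sqrt ((1 + \<eta>) * \<sigma>\<^sup>2 * real m * c) = real m * s"
      proof -
        have "(1 + \<eta>) * \<sigma>\<^sup>2 * real m * c = (real m)\<^sup>2 * ((1 + \<eta>) * \<sigma>\<^sup>2 * c / real m)"
          using mn by (simp add: power2_eq_square)
        then show ?thesis using mn unfolding s_def by (simp only: real_sqrt_mult real_sqrt_abs abs_of_nat)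
      qed
      ultimately have "sqrt (C.proj_sq z) * L2_set v J \<le> (real m * s) * L2_set v J"
        by (intro mult_right_mono) auto
      moreover have "inner_on J z v \<le> sqrt (C.proj_sq z) * L2_set v J" by (rule C.inner_le_sqrt_proj_sq[OF vC])
      ultimately have "inner_on J z v \<le> (real m * s) * L2_set v J" by linarith
      moreover have "inner_on I (\<xi> \<omega>) (?X v) = inner_on J z v / sqrt (real n)"
        unfolding I_def J_def z_def Z_def by (rule mat_vec_normalized(2)[OF n])
      ultimately have "inner_on I (\<xi> \<omega>) (?X v) / real m \<le> ((real m * s) * L2_set v J) / sqrt (real n) / real m"
        using mn by (simp only:) (intro divide_right_mono; simp)
      also have "\<dots> = s * sqrt V2"
        using mn by (simp add: V2_def L2_set_eq_sqrt_inner real_sqrt_divide)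
      finally show ?thesis .
    qed
    moreover have "0 \<le> V2" by (simp add: V2_def)
    ultimately have "inner_on J (b + v) (b + v) / real n
        \<le> (1 + 2 * \<eta>) * (inner_on J b b / real n) + s\<^sup>2 / (1 - 3 * \<eta>) + \<eta> * r2"
      using \<eta> by (rule oracle_arithmetic)
    then show "(L2_set (\<nu> - x) {1..n})\<^sup>2 / real n \<le> (1 + 2 * \<eta>) * ((L2_set (\<mu> - x) {1..n})\<^sup>2 / real n)
        + ((1 + \<eta>) * \<sigma>\<^sup>2 * ((1 + \<eta>) * stat_dim {1..n} C + \<tau>) / real m) / (1 - 3 * \<eta>) + \<eta> * r2"
      unfolding W B2 s2 c_def d_def J_def .
  qed
qed

section \<open>The oracle risk and near-optimal members of the class\<close>

lemma partition_on_exists: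
  assumes "1 \<le> k" "k \<le> n"
  shows "\<exists>S. partition_on {1..n :: nat} S \<and> card S = k"
proof (intro exI conjI)
  let ?S = "insert {k..n} ((\<lambda>i. {i}) ` {1..<k})"
  show "partition_on {1..n} ?S"
  proof (rule partition_onI)
    show "\<Union>?S = {1..n}" using assms by auto
    show "{} \<notin> ?S" using assms by auto
    show "disjnt p q" if "p \<in> ?S" "q \<in> ?S" "p \<noteq> q" for p q
      using that by (auto simp: disjnt_def)
  qed
  have "{k..n} \<notin> (\<lambda>i. {i}) ` {1..<k}"
  proof
    assume "{k..n} \<in> (\<lambda>i. {i}) ` {1..<k}"
    then obtain i where "i < k" "{k..n} = {i}" by auto
    moreover have "k \<in> {k..n}" using assms by simp
    ultimately show False by auto
  qed
  moreover have "card ((\<lambda>i. {i}) ` {1..<k}) = k - 1" by (subst card_image) (auto intro: inj_onI)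
  ultimately show "card ?S = k" using assms by (subst card_insert_disjoint) auto
qed

lemma stat_dim_closure: "stat_dim B (closure A) = stat_dim B A"
  by (simp add: stat_dim_def)

lemma stat_dim_nonneg': "0 \<le> stat_dim B A"
  unfolding stat_dim_def by (rule integral_nonneg_AE) simp

text \<open>The projection decouples over the blocks, and the restriction of a standard Gaussian
  vector to a block is again standard Gaussian.\<close>

lemma stat_dim_product_cone:
  assumes fin: "finite I" and S: "partition_on I S" and C: "\<And>B. B \<in> S \<Longrightarrow> closed_cone_on B (C B)"
  shows "stat_dim I (product_cone I S C) = (\<Sum>B\<in>S. stat_dim B (C B))"
proof -
  interpret P: closed_cone_on I "product_cone I S C" by (rule closed_cone_on_product) fact+
  interpret pp: product_prob_space "\<lambda>_. gauss1" I by (rule product_prob_spaceI) (rule prob_space_gauss1)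
  have part: "integrable (std_gaussian I) (closed_cone_on.proj_sq B (C B)) \<and>
      (\<integral>h. closed_cone_on.proj_sq B (C B) h \<partial>std_gaussian I) = stat_dim B (C B)" if B: "B \<in> S" for B
  proof -
    interpret B: closed_cone_on B "C B" by (rule C) fact
    have BI: "finite B" "B \<subseteq> I" using S B fin by (auto simp: partition_on_def intro: finite_subset[OF Union_upper])
    have law: "distr (std_gaussian I) (std_gaussian B) (\<lambda>h. restrict h B) = std_gaussian B"
      unfolding std_gaussian_eq by (rule pp.distr_PiM_restrict_finite) fact+
    have rm: "(\<lambda>h. restrict h B) \<in> measurable (std_gaussian I) (std_gaussian B)"
      unfolding std_gaussian_eq using BI by (intro measurable_restrict_subset)
    have ps: "B.proj_sq (restrict h B) = B.proj_sq h" for h by (rule B.proj_sq_cong) simp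
    have "integrable (distr (std_gaussian I) (std_gaussian B) (\<lambda>h. restrict h B)) B.proj_sq"
      unfolding law by (rule B.integrable_proj_sq)
    then have "integrable (std_gaussian I) (\<lambda>h. B.proj_sq (restrict h B))"
      by (subst (asm) integrable_distr_eq[OF rm]) auto
    moreover have "(\<integral>h. B.proj_sq h \<partial>distr (std_gaussian I) (std_gaussian B) (\<lambda>h. restrict h B))
        = (\<integral>h. B.proj_sq (restrict h B) \<partial>std_gaussian I)"
      by (rule integral_distr[OF rm]) simp
    ultimately show ?thesis unfolding law by (simp add: ps B.stat_dim_eq)
  qed
  have "stat_dim I (product_cone I S C) = (\<integral>h. (\<Sum>B\<in>S. closed_cone_on.proj_sq B (C B) h) \<partial>std_gaussian I)"
    unfolding P.stat_dim_eq by (simp only: proj_sq_product[OF assms, symmetric])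
  also have "\<dots> = (\<Sum>B\<in>S. stat_dim B (C B))" using part by simp
  finally show ?thesis .
qed

lemma convex_cone_zero_set: "convex_cone {0 :: nat \<Rightarrow> real}"
  by (auto simp: convex_cone_iff)

definition oracle_values ::
    "nat \<Rightarrow> nat \<Rightarrow> real \<Rightarrow> (nat \<Rightarrow> real) set \<Rightarrow> (nat \<Rightarrow> real) \<Rightarrow> nat \<Rightarrow> real set"
  where "oracle_values m n \<sigma> K x k =
    {(L2_set (\<mu> - x) {1..n})\<^sup>2 / real n + \<sigma>\<^sup>2 / real m * (\<Sum>B\<in>S. stat_dim B (coord_restrict B ` K)) |\<mu> S F.
      (S, F) \<in> block_class n K k \<and> \<mu> \<in> F}"

text \<open>An infimum over an empty set of reals would carry no information. Zero cones over any
  partition into k blocks, with the point 0, provide a value for every k.\<close>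

lemma oracle_values_nonempty:
  assumes K: "convex_cone K" and k: "k \<in> {1..n}"
  shows "oracle_values m n \<sigma> K x k \<noteq> {}"
proof -
  obtain S where S: "partition_on {1..n} S" "card S = k" using partition_on_exists k by auto
  have 0: "0 \<in> K" using K by (simp add: convex_cone_iff)
  let ?C = "\<lambda>B :: nat set. {0 :: nat \<Rightarrow> real}"
  have "\<forall>B\<in>S. ?C B \<subseteq> coord_space B \<and> closed (?C B) \<and> convex_cone (?C B) \<and>
      {a - b |a b. a \<in> coord_restrict B ` K \<and> b \<in> ?C B} \<subseteq> coord_restrict B ` K"
    by (auto simp: coord_space_convex convex_cone_zero_set)
  then have "(S, block_cone n S ?C \<inter> K) \<in> block_class n K k"
    unfolding block_class_def using S by blast
  moreover have "0 \<in> block_cone n S ?C \<inter> K"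
    using 0 by (simp add: block_cone_def coord_space_convex coord_restrict_simps)
  ultimately show ?thesis unfolding oracle_values_def by blast
qed

lemma oracle_values_nonneg: "t \<in> oracle_values m n \<sigma> K x k \<Longrightarrow> 0 \<le> t"
  unfolding oracle_values_def
  by (auto intro!: add_nonneg_nonneg mult_nonneg_nonneg divide_nonneg_nonneg sum_nonneg stat_dim_nonneg')

lemma oracle_risk_eq: "oracle_risk m n \<sigma> K x = (INF k\<in>{1..n}. Inf (oracle_values m n \<sigma> K x k))"
  by (simp only: oracle_risk_def oracle_values_def)

lemma oracle_risk_nonneg:
  assumes "convex_cone K" "1 \<le> n"
  shows "0 \<le> oracle_risk m n \<sigma> K x"
  unfolding oracle_risk_eq
proof (rule cINF_greatest)
  show "{1..n} \<noteq> {}" using assms by simp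
  fix k assume "k \<in> {1..n}"
  then show "0 \<le> Inf (oracle_values m n \<sigma> K x k)"
    by (intro cInf_greatest oracle_values_nonempty[OF assms(1)] oracle_values_nonneg)
qed

text \<open>
  For \<open>\<mu>\<close> in a member of the class, \<open>K - \<mu>\<close> is contained in the product of the cones \<open>K|\<^sub>B\<close>; this is
  the only way in which the class enters.
\<close>

lemma near_oracle:
  assumes K: "convex_cone K" "K \<subseteq> coord_space {1..n}" and n: "1 \<le> n" and t: "0 < t"
  obtains \<mu> C where "\<mu> \<in> K" "closed_cone_on {1..n} C" "\<And>\<nu>. \<nu> \<in> K \<Longrightarrow> \<nu> - \<mu> \<in> C"
    "(L2_set (\<mu> - x) {1..n})\<^sup>2 / real n + \<sigma>\<^sup>2 / real m * stat_dim {1..n} C < oracle_risk m n \<sigma> K x + t"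
proof -
  have "(INF k\<in>{1..n}. Inf (oracle_values m n \<sigma> K x k)) < oracle_risk m n \<sigma> K x + t"
    using t by (simp only: oracle_risk_eq)
  then obtain k where k: "k \<in> {1..n}" "Inf (oracle_values m n \<sigma> K x k) < oracle_risk m n \<sigma> K x + t"
    using cInf_lessD[of "(\<lambda>k. Inf (oracle_values m n \<sigma> K x k)) ` {1..n}"] n by fastforce
  obtain v where v: "v \<in> oracle_values m n \<sigma> K x k" "v < oracle_risk m n \<sigma> K x + t"
    using cInf_lessD[OF oracle_values_nonempty[OF K(1) k(1)] k(2)] by blast
  then obtain \<mu> S F where F: "v = (L2_set (\<mu> - x) {1..n})\<^sup>2 / real n + \<sigma>\<^sup>2 / real m * (\<Sum>B\<in>S. stat_dim B (coord_restrict B ` K))"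
    "(S, F) \<in> block_class n K k" "\<mu> \<in> F"
    unfolding oracle_values_def by blast
  define adm where "adm = (\<lambda>C B. C B \<subseteq> coord_space B \<and> closed (C B) \<and> convex_cone (C B) \<and>
      {a - b |a b. a \<in> coord_restrict B ` K \<and> b \<in> C B} \<subseteq> coord_restrict B ` K)"
  have "block_class n K k = {(S, block_cone n S C \<inter> K) |S C.
      partition_on {1..n} S \<and> card S = k \<and> (\<forall>B\<in>S. adm C B)}"
    unfolding block_class_def adm_def ..
  with F(2) have "\<exists>S' C. (S, F) = (S', block_cone n S' C \<inter> K) \<and>
      partition_on {1..n} S' \<and> card S' = k \<and> (\<forall>B\<in>S'. adm C B)"
    by (simp only: mem_Collect_eq)
  then obtain C where C0: "F = block_cone n S C \<inter> K" "partition_on {1..n} S" "\<forall>B\<in>S. adm C B"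
    by (elim exE conjE) (simp only: prod.inject)
  then have C: "F = block_cone n S C \<inter> K" "partition_on {1..n} S"
    "\<And>B. B \<in> S \<Longrightarrow> {a - b |a b. a \<in> coord_restrict B ` K \<and> b \<in> C B} \<subseteq> coord_restrict B ` K"
    by (simp_all only: adm_def)
  define P where "P = (\<lambda>B. closure (coord_restrict B ` K))"
  have fB: "finite B" if "B \<in> S" for B
    using C(2) that by (auto simp: partition_on_def intro: finite_subset[OF Union_upper])
  have PB: "closed_cone_on B (P B)" if "B \<in> S" for B
    unfolding P_def by (rule closed_cone_on_restrict_closure[OF fB[OF that] K(1)])
  show ?thesis
  proof (rule that)
    show \<mu>K: "\<mu> \<in> K" using F C by blast
    show "closed_cone_on {1..n} (product_cone {1..n} S P)"
      by (rule closed_cone_on_product[OF _ C(2) PB]) simp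
    show "\<nu> - \<mu> \<in> product_cone {1..n} S P" if \<nu>: "\<nu> \<in> K" for \<nu>
      unfolding product_cone_def
    proof (intro CollectI conjI ballI)
      show "\<nu> - \<mu> \<in> coord_space {1..n}" using \<nu> \<mu>K K(2) by (intro coord_space_convex) auto
      fix B assume B: "B \<in> S"
      \<comment> \<open>Here the condition \<open>K|_B - C_B \<subseteq> K|_B\<close> enters: the
        restriction of \<mu> lies in \<open>C B\<close>, so subtracting it keeps the restriction of
        \<nu> inside that of \<open>K\<close>.\<close>
      have "coord_restrict B \<mu> \<in> C B" using F(3) C(1) B by (auto simp: block_cone_def)
      then have "coord_restrict B (\<nu> - \<mu>) \<in> coord_restrict B ` K"
        using C(3)[OF B] \<nu> unfolding coord_restrict_simps by blast
      then show "coord_restrict B (\<nu> - \<mu>) \<in> P B" unfolding P_def by (rule subsetD[OF closure_subset])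
    qed
    have "stat_dim {1..n} (product_cone {1..n} S P) = (\<Sum>B\<in>S. stat_dim B (P B))"
      by (rule stat_dim_product_cone[OF _ C(2) PB]) simp
    also have "\<dots> = (\<Sum>B\<in>S. stat_dim B (coord_restrict B ` K))" by (simp only: P_def stat_dim_closure)
    finally show "(L2_set (\<mu> - x) {1..n})\<^sup>2 / real n + \<sigma>\<^sup>2 / real m * stat_dim {1..n} (product_cone {1..n} S P)
        < oracle_risk m n \<sigma> K x + t"
      using v(2) F(1) by (simp only:)
  qed
qed

section \<open>The oracle inequality\<close>

text \<open>The two claims amount to \<open>25 * \<eta> \<le> 3\<close> and
  \<open>7 * \<eta> \<le> 1\<close>, both with room to spare at 1/12.\<close>

lemma oracle_constant:
  fixes \<eta> :: real
  assumes "0 < \<eta>" "\<eta> \<le> 1 / 12"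
  shows "(1 + \<eta>)\<^sup>2 / (1 - 3 * \<eta>) \<le> 1 + 8 * \<eta>" and "(1 + \<eta>) / (1 - 3 * \<eta>) \<le> 2"
proof -
  have sq: "\<eta> * \<eta> \<le> \<eta> * (1 / 12)" using assms by (intro mult_left_mono) auto
  have "(1 + \<eta>)\<^sup>2 = 1 + 2 * \<eta> + \<eta> * \<eta>" by (simp add: power2_eq_square algebra_simps)
  also have "\<dots> \<le> 1 + 5 * \<eta> - 24 * (\<eta> * \<eta>)" using sq assms by linarith
  also have "\<dots> = (1 + 8 * \<eta>) * (1 - 3 * \<eta>)" by (simp add: algebra_simps)
  finally show "(1 + \<eta>)\<^sup>2 / (1 - 3 * \<eta>) \<le> 1 + 8 * \<eta>" using assms by (simp add: pos_divide_le_eq)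
  show "(1 + \<eta>) / (1 - 3 * \<eta>) \<le> 2" using assms by (simp add: pos_divide_le_eq)
qed

lemma log_dim_ge: "ln (ln (16 * real n)) \<le> log_dim n K x"
  unfolding log_dim_def using stat_dim_nonneg'[of "{1..n}" "tangent_cone K x"] by simp

lemma log_dim_at_top: "filterlim (\<lambda>n. log_dim n (K n) (x n)) at_top sequentially"
proof (rule filterlim_at_top_mono)
  show "filterlim (\<lambda>n. ln (ln (16 * real n))) at_top sequentially" by real_asymp
  show "\<forall>\<^sub>F n in sequentially. ln (ln (16 * real n)) \<le> log_dim n (K n) (x n)"
    by (simp add: log_dim_ge)
qed

text \<open>Constants stand in for the random factors of the theorem: \<epsilon> for the relative
  error and 1 for the multiple of \<open>log_dim / m\<close>. For each target probability, an \<eta>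
  depending on \<epsilon> and a \<tau> depending also on that probability turn the instance bound
  into this tail.\<close>

lemma sequential_oracle_tail:
  fixes M :: "nat \<Rightarrow> 'a measure" and m :: "nat \<Rightarrow> nat" and \<mu>h Y :: "nat \<Rightarrow> 'a \<Rightarrow> nat \<Rightarrow> real"
  assumes \<sigma>: "\<sigma> > 0" and D: "real_distribution D" and D2: "integrable D (\<lambda>x. x\<^sup>2)"
    and Dm: "prob_space.expectation D (\<lambda>x. x) = 0" and Dv: "prob_space.variance D (\<lambda>x. x) = \<sigma>\<^sup>2"
    and model: "\<And>n. n \<ge> 1 \<Longrightarrow> linear_model (M n) (m n) n D (X n) (\<xi> n)"
    and K: "\<And>n. n \<ge> 1 \<Longrightarrow> K n \<subseteq> coord_space {1..n}" "\<And>n. n \<ge> 1 \<Longrightarrow> closed (K n)"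
      "\<And>n. n \<ge> 1 \<Longrightarrow> convex_cone (K n)" "\<And>n. n \<ge> 1 \<Longrightarrow> \<mu>\<^sub>0 n \<in> K n"
    and Y: "\<And>n \<omega> i. n \<ge> 1 \<Longrightarrow> \<omega> \<in> space (M n) \<Longrightarrow> i \<in> {1..m n} \<Longrightarrow>
           Y n \<omega> i = mat_vec (m n) n (X n \<omega>) (\<mu>\<^sub>0 n) i + \<xi> n \<omega> i"
    and mL: "filterlim (\<lambda>n. real (m n) / log_dim n (K n) (\<mu>\<^sub>0 n)) at_top sequentially"
    and E0: "(\<lambda>n. oracle_risk (m n) n \<sigma> (K n) (\<mu>\<^sub>0 n)) \<longlonglongrightarrow> 0"
    and near: "near_minimizers M m \<sigma> K \<mu>\<^sub>0 X Y \<mu>h"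
    and \<epsilon>: "0 < \<epsilon>"
  shows "(\<lambda>n. measure (M n) {\<omega> \<in> space (M n). (1 + \<epsilon>) * oracle_risk (m n) n \<sigma> (K n) (\<mu>\<^sub>0 n)
      + log_dim n (K n) (\<mu>\<^sub>0 n) / real (m n) < (L2_set (\<mu>h n \<omega> - \<mu>\<^sub>0 n) {1..n})\<^sup>2 / real n}) \<longlonglongrightarrow> 0"
proof -
  define L where "L = (\<lambda>n. log_dim n (K n) (\<mu>\<^sub>0 n))"
  define E where "E = (\<lambda>n. oracle_risk (m n) n \<sigma> (K n) (\<mu>\<^sub>0 n))"
  define W where "W = (\<lambda>n \<omega>. (L2_set (\<mu>h n \<omega> - \<mu>\<^sub>0 n) {1..n})\<^sup>2 / real n)"
  define r where "r = (\<lambda>n. fixed_point_radius (m n) n \<sigma> (K n) (\<mu>\<^sub>0 n))"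
  interpret D: real_distribution D by (rule D)
  have var_D: "(\<integral>x. x\<^sup>2 \<partial>D) = \<sigma>\<^sup>2" using Dv unfolding Dm by simp
  have E_nonneg: "0 \<le> E n" if "1 \<le> n" for n unfolding E_def using K(3)[OF that] that by (rule oracle_risk_nonneg)
  have L_top: "filterlim L at_top sequentially" unfolding L_def by (rule log_dim_at_top)
  have m_top: "filterlim (\<lambda>n. real (m n)) at_top sequentially"
  proof (rule filterlim_at_top_mono)
    show "filterlim (\<lambda>n. real (m n) / L n) at_top sequentially" using mL by (simp only: L_def)
    have "\<forall>\<^sub>F n in sequentially. 1 \<le> L n" using L_top by (simp add: filterlim_at_top)
    then show "\<forall>\<^sub>F n in sequentially. real (m n) / L n \<le> real (m n)"
    proof eventually_elim
      case (elim n)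
      then have "real (m n) / L n \<le> real (m n) / 1" by (intro divide_left_mono) auto
      then show ?case by simp
    qed
  qed
  obtain e where e: "small_o_prob M e (\<lambda>n. (r n)\<^sup>2)"
    "\<And>n \<omega>. n \<ge> 1 \<Longrightarrow> \<omega> \<in> space (M n) \<Longrightarrow> sq_loss (m n) n (X n \<omega>) (Y n \<omega>) (\<mu>h n \<omega>)
            \<le> (INF \<mu>\<in>K n. sq_loss (m n) n (X n \<omega>) (Y n \<omega>) \<mu>) + e n \<omega>"
    and \<mu>hK: "\<And>n \<omega>. n \<ge> 1 \<Longrightarrow> \<omega> \<in> space (M n) \<Longrightarrow> \<mu>h n \<omega> \<in> K n"
    using near unfolding near_minimizers_def r_def by blast
  have em: "e n \<in> borel_measurable (M n)" if "1 \<le> n" for n using e(1) that by (simp add: small_o_prob_def)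
  \<comment> \<open>The final relative error is \<open>10 * \<eta>\<close>:
    \<open>8 * \<eta>\<close> from \<open>oracle_constant\<close>, and \<open>2 * \<eta>\<close>
    from the slack because \<open>(r n)\<^sup>2 \<le> 2 * (B2 + S)\<close>.\<close>
  define \<eta> where "\<eta> = min (1 / 12) (\<epsilon> / 10)"
  have \<eta>: "0 < \<eta>" "\<eta> \<le> 1 / 12" "10 * \<eta> \<le> \<epsilon>" using \<epsilon> by (auto simp: \<eta>_def)
  have "\<forall>\<^sub>F n in sequentially. measure (M n) {\<omega> \<in> space (M n). (1 + \<epsilon>) * E n + L n / real (m n) < W n \<omega>} < \<delta>0"
    if \<delta>0: "0 < \<delta>0" for \<delta>0
  proof -
    \<comment> \<open>\<open>4 * \<delta>\<close> is spent on the bad event of the instance and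
      \<delta> on the slack; the last sixth is spare.\<close>
    define \<delta> where "\<delta> = \<delta>0 / 6"
    have \<delta>: "0 < \<delta>" using \<delta>0 by (simp add: \<delta>_def)
    \<comment> \<open>Makes the Chebyshev bound for the projection norm exactly \<delta>.\<close>
    define \<tau> where "\<tau> = pi\<^sup>2 / (2 * \<eta> * \<delta>)"
    have \<tau>: "0 < \<tau>" using \<eta> \<delta> by (simp add: \<tau>_def)
    have noise: "pi\<^sup>2 / (2 * \<eta> * \<tau>) \<le> \<delta>" using \<eta> \<delta> by (simp add: \<tau>_def)
    obtain N1 where N1: "\<And>I :: nat set. finite I \<Longrightarrow> N1 \<le> card I \<Longrightarrow>
      measure (PiM I (\<lambda>_. D)) {x \<in> space (PiM I (\<lambda>_. D)). ((\<integral>x. x\<^sup>2 \<partial>D) + \<eta> * \<sigma>\<^sup>2) * real (card I) < (\<Sum>i\<in>I. (x i)\<^sup>2)} \<le> \<delta>"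
      using weak_law_upper[OF D.prob_space_axioms D2 zero_le_power2, of "\<eta> * \<sigma>\<^sup>2" \<delta>] \<eta>(1) \<sigma> \<delta> by auto
    obtain N2 where N2: "\<And>I :: nat set. finite I \<Longrightarrow> N2 \<le> card I \<Longrightarrow>
      measure (PiM I (\<lambda>_. gauss1)) {x \<in> space (PiM I (\<lambda>_. gauss1)). ((\<integral>x. x\<^sup>2 \<partial>gauss1) + \<eta>) * real (card I) < (\<Sum>i\<in>I. (x i)\<^sup>2)} \<le> \<delta>"
      using weak_law_upper[OF prob_space_gauss1 gauss1_moments(1)[of 2] zero_le_power2, of \<eta> \<delta>] \<eta>(1) \<delta> by auto
    \<comment> \<open>Bounds \<open>stat_dim / m\<close> for the near-optimal cone chosen below. Its
      convergence to 0 makes both the lower isometry and the bound on the fixed point radius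
      available.\<close>
    define q where "q = (\<lambda>n. (E n + 1 / real (m n)) / \<sigma>\<^sup>2)"
    have inv_m: "(\<lambda>n. 1 / real (m n)) \<longlonglongrightarrow> 0"
      using tendsto_inverse_0_at_top[OF m_top] by (simp add: inverse_eq_divide)
    have q0: "q \<longlonglongrightarrow> 0"
    proof -
      have "q \<longlonglongrightarrow> (0 + 0) / \<sigma>\<^sup>2"
        unfolding q_def using E0 inv_m \<sigma> by (intro tendsto_divide tendsto_add tendsto_const) (auto simp: E_def)
      then show ?thesis by simp
    qed
    define c where "c = 8 * sqrt (96 / \<eta>) / \<eta>"
    have c0: "0 \<le> c" using \<eta> by (simp add: c_def)
    have "(\<lambda>n. c * (sqrt (1 / real (m n)) + sqrt (q n))) \<longlonglongrightarrow> c * (sqrt 0 + sqrt 0)"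
      by (intro tendsto_intros inv_m q0)
    then have ev_iso: "\<forall>\<^sub>F n in sequentially. c * (sqrt (1 / real (m n)) + sqrt (q n)) < \<delta>"
      using \<delta> by (intro order_tendstoD) auto
    have ev_q: "\<forall>\<^sub>F n in sequentially. q n < 1 / 2" using q0 by (rule order_tendstoD) simp
    have ev_m: "\<forall>\<^sub>F n in sequentially. real (max (max N1 N2) 1) \<le> real (m n)"
      using m_top by (simp only: filterlim_at_top)
    \<comment> \<open>Exceeding this constant, L absorbs into \<open>L n / m\<close> both
      \<open>(1 + \<epsilon>) / m\<close>, from the tolerance in choosing the oracle point, and the
      noise excess \<open>2 * \<sigma>\<^sup>2 * \<tau> / m\<close>.\<close>
    have ev_L: "\<forall>\<^sub>F n in sequentially. (1 + \<epsilon>) + 2 * \<sigma>\<^sup>2 * \<tau> \<le> L n" using L_top by (simp only: filterlim_at_top)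
    have "(\<lambda>n. measure (M n) {\<omega> \<in> space (M n). \<bar>e n \<omega>\<bar> > \<eta>\<^sup>2 * (r n)\<^sup>2}) \<longlonglongrightarrow> 0"
      using e(1) \<eta>(1) unfolding small_o_prob_def by simp
    then have ev_e: "\<forall>\<^sub>F n in sequentially. measure (M n) {\<omega> \<in> space (M n). \<bar>e n \<omega>\<bar> > \<eta>\<^sup>2 * (r n)\<^sup>2} < \<delta>"
      by (rule order_tendstoD) (rule \<delta>)
    have ev_1: "\<forall>\<^sub>F n in sequentially. 1 \<le> n" by (rule eventually_ge_at_top)
    show ?thesis
      using ev_iso ev_q ev_m ev_L ev_e ev_1
    proof eventually_elim
      case (elim n)
      note n = elim(6)
      have m: "0 < m n" "N1 \<le> m n" "N2 \<le> m n" using elim(3) by auto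
      have m': "0 < real (m n)" using m by simp
      interpret Mn: prob_space "M n" using model[OF n] by (simp add: linear_model_def)
      define a where "a = L n / real (m n)"
      define T where "T = {\<omega> \<in> space (M n). (1 + \<epsilon>) * E n + a < W n \<omega>}"
      have a0: "0 \<le> a"
        using elim(4) \<epsilon> \<tau> by (simp add: a_def) (rule divide_nonneg_nonneg; simp add: order_trans[rotated])
      show ?case
      proof (cases "K n = {\<mu>\<^sub>0 n}")
        \<comment> \<open>The radius, and with it the size of the slack, is unspecified here, but
          the estimator can only equal \<open>\<mu>\<^sub>0 n\<close>, so its loss is 0.\<close>
        case True
        have "T = {}"
        proof -
          have "W n \<omega> = 0" if "\<omega> \<in> space (M n)" for \<omega>
            using \<mu>hK[OF n that] True by (simp add: W_def)
          moreover have "0 \<le> (1 + \<epsilon>) * E n + a" using E_nonneg[OF n] \<epsilon> a0 by simp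
          ultimately show ?thesis by (auto simp: T_def)
        qed
        then have "measure (M n) T < \<delta>0" using \<delta>0 by simp
        then show ?thesis unfolding T_def a_def .
      next
        case False
        \<comment> \<open>The infimum in the risk may not be attained; the tolerance
          \<open>1 / m\<close> is of an order that \<open>L n / m\<close> absorbs.\<close>
        obtain \<mu> C where \<mu>: "\<mu> \<in> K n" and C: "closed_cone_on {1..n} C" and KC: "\<And>\<nu>. \<nu> \<in> K n \<Longrightarrow> \<nu> - \<mu> \<in> C"
          and val: "(L2_set (\<mu> - \<mu>\<^sub>0 n) {1..n})\<^sup>2 / real n + \<sigma>\<^sup>2 / real (m n) * stat_dim {1..n} C
            < oracle_risk (m n) n \<sigma> (K n) (\<mu>\<^sub>0 n) + 1 / real (m n)"
        proof (rule near_oracle[OF K(3)[OF n] K(1)[OF n] n])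
          show "0 < 1 / real (m n)" using m' by simp
        qed (rule that)
        define d where "d = stat_dim {1..n} C"
        define B2 where "B2 = (L2_set (\<mu> - \<mu>\<^sub>0 n) {1..n})\<^sup>2 / real n"
        define S where "S = \<sigma>\<^sup>2 / real (m n) * d"
        have d0: "0 \<le> d" unfolding d_def by (rule stat_dim_nonneg')
        have B0: "0 \<le> B2" by (simp add: B2_def)
        have S0: "0 \<le> S" using d0 by (simp add: S_def)
        have \<rho>: "B2 + S \<le> E n + 1 / real (m n)" using val by (simp add: B2_def S_def E_def d_def)
        have dq: "d / real (m n) \<le> q n"
        proof -
          have "\<sigma>\<^sup>2 * (d / real (m n)) \<le> E n + 1 / real (m n)" using \<rho> B0 by (simp add: S_def)
          then show ?thesis using \<sigma> by (simp add: q_def pos_le_divide_eq mult.commute)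
        qed
        have d_half: "d \<le> real (m n) / 2"
        proof -
          have "d / real (m n) \<le> 1 / 2" using dq elim(2) by linarith
          then show ?thesis using m' by (simp add: pos_divide_le_eq)
        qed
        have cvx: "closed_convex_on {1..n} (K n)"
          using K[OF n] by (intro closed_cone_on.axioms(1) closed_cone_onI) auto
        have r2: "(r n)\<^sup>2 \<le> 2 * (B2 + S)"
          unfolding r_def B2_def S_def d_def
          by (rule fixed_point_radius_bound[OF cvx K(4)[OF n] False \<mu> C KC \<sigma> m(1)])
             (use n d_half in \<open>auto simp: d_def\<close>)
        have iso: "8 * sqrt (96 / \<eta>) / \<eta> * ((1 + sqrt (stat_dim {1..n} C)) / sqrt (real (m n))) \<le> \<delta>"
        proof -
          have "(1 + sqrt d) / sqrt (real (m n)) = sqrt (1 / real (m n)) + sqrt (d / real (m n))"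
            by (simp add: add_divide_distrib real_sqrt_divide)
          also have "\<dots> \<le> sqrt (1 / real (m n)) + sqrt (q n)" using dq by simp
          finally have "c * ((1 + sqrt d) / sqrt (real (m n))) \<le> c * (sqrt (1 / real (m n)) + sqrt (q n))"
            using c0 by (rule mult_left_mono)
          then show ?thesis using elim(1) by (simp add: c_def d_def)
        qed
        have n1: "measure (PiM {1..m n} (\<lambda>_. D)) {x \<in> space (PiM {1..m n} (\<lambda>_. D)).
            (1 + \<eta>) * \<sigma>\<^sup>2 * real (m n) < (\<Sum>i\<in>{1..m n}. (x i)\<^sup>2)} \<le> \<delta>"
          using N1[of "{1..m n}"] m unfolding var_D by (simp add: distrib_right)
        have n2: "measure (PiM {1..m n} (\<lambda>_. gauss1)) {x \<in> space (PiM {1..m n} (\<lambda>_. gauss1)).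
            (1 + \<eta>) * real (m n) < (\<Sum>i\<in>{1..m n}. (x i)\<^sup>2)} \<le> \<delta>"
          using N2[of "{1..m n}"] m unfolding gauss1_moments(3) by simp
        have \<eta>3: "\<eta> < 1 / 3" using \<eta> by simp
        have n0: "0 < n" using n by simp
        obtain Bad where Bad: "Bad \<in> sets (M n)" "measure (M n) Bad \<le> 4 * \<delta>"
          "\<And>\<omega> \<nu> e r2. \<omega> \<in> space (M n) - Bad \<Longrightarrow> \<nu> \<in> K n \<Longrightarrow>
          (\<And>\<kappa>. \<kappa> \<in> K n \<Longrightarrow> sq_loss (m n) n (X n \<omega>) (Y n \<omega>) \<nu> \<le> sq_loss (m n) n (X n \<omega>) (Y n \<omega>) \<kappa> + e) \<Longrightarrow> e \<le> \<eta>\<^sup>2 * r2 \<Longrightarrow>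
          (L2_set (\<nu> - \<mu>\<^sub>0 n) {1..n})\<^sup>2 / real n \<le> (1 + 2 * \<eta>) * ((L2_set (\<mu> - \<mu>\<^sub>0 n) {1..n})\<^sup>2 / real n)
            + ((1 + \<eta>) * \<sigma>\<^sup>2 * ((1 + \<eta>) * stat_dim {1..n} C + \<tau>) / real (m n)) / (1 - 3 * \<eta>) + \<eta> * r2"
        proof -
          note inst_that = that
          show thesis
          proof (rule instance_bound[OF model[OF n] D m(1) n0 cvx K(4)[OF n] \<mu> C _ _ \<eta>(1) \<eta>3 \<tau> \<sigma> n1 n2 iso noise])
          show "\<nu> - \<mu> \<in> C" if "\<nu> \<in> K n" for \<nu> using that by (rule KC)
          show "Y n \<omega> i = mat_vec (m n) n (X n \<omega>) (\<mu>\<^sub>0 n) i + \<xi> n \<omega> i"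
            if "\<omega> \<in> space (M n)" "i \<in> {1..m n}" for \<omega> i using Y[OF n that] .
          show thesis if "Bad \<in> sets (M n)" "measure (M n) Bad \<le> 4 * \<delta>"
            "\<And>\<omega> \<nu> e r2. \<omega> \<in> space (M n) - Bad \<Longrightarrow> \<nu> \<in> K n \<Longrightarrow>
            (\<And>\<kappa>. \<kappa> \<in> K n \<Longrightarrow> sq_loss (m n) n (X n \<omega>) (Y n \<omega>) \<nu> \<le> sq_loss (m n) n (X n \<omega>) (Y n \<omega>) \<kappa> + e) \<Longrightarrow> e \<le> \<eta>\<^sup>2 * r2 \<Longrightarrow>
            (L2_set (\<nu> - \<mu>\<^sub>0 n) {1..n})\<^sup>2 / real n \<le> (1 + 2 * \<eta>) * ((L2_set (\<mu> - \<mu>\<^sub>0 n) {1..n})\<^sup>2 / real n)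
              + ((1 + \<eta>) * \<sigma>\<^sup>2 * ((1 + \<eta>) * stat_dim {1..n} C + \<tau>) / real (m n)) / (1 - 3 * \<eta>) + \<eta> * r2" for Bad
            by (rule inst_that[OF that])
          qed
        qed
        define B where "B = {\<omega> \<in> space (M n). \<bar>e n \<omega>\<bar> > \<eta>\<^sup>2 * (r n)\<^sup>2}"
        have Bm: "B \<in> sets (M n)" unfolding B_def using em[OF n] by measurable
        have "T \<subseteq> Bad \<union> B"
        proof
          fix \<omega> assume "\<omega> \<in> T"
          then have \<omega>: "\<omega> \<in> space (M n)" and big: "(1 + \<epsilon>) * E n + a < W n \<omega>" by (auto simp: T_def)
          show "\<omega> \<in> Bad \<union> B"
          proof (rule ccontr)
            assume not: "\<omega> \<notin> Bad \<union> B"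
            have eb: "e n \<omega> \<le> \<eta>\<^sup>2 * (r n)\<^sup>2" using not \<omega> by (auto simp: B_def)
            have nearK: "sq_loss (m n) n (X n \<omega>) (Y n \<omega>) (\<mu>h n \<omega>) \<le> sq_loss (m n) n (X n \<omega>) (Y n \<omega>) \<kappa> + e n \<omega>"
              if "\<kappa> \<in> K n" for \<kappa>
            proof -
              have "(INF \<mu>\<in>K n. sq_loss (m n) n (X n \<omega>) (Y n \<omega>) \<mu>) \<le> sq_loss (m n) n (X n \<omega>) (Y n \<omega>) \<kappa>"
                by (rule cINF_lower[OF _ that]) (auto intro!: bdd_belowI[where m = 0] simp: sq_loss_def)
              then show ?thesis using e(2)[OF n \<omega>] by linarith
            qed
            have "W n \<omega> \<le> (1 + 2 * \<eta>) * B2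
                + ((1 + \<eta>) * \<sigma>\<^sup>2 * ((1 + \<eta>) * d + \<tau>) / real (m n)) / (1 - 3 * \<eta>) + \<eta> * (r n)\<^sup>2"
              unfolding W_def B2_def d_def
              by (rule Bad(3)[OF _ \<mu>hK[OF n \<omega>] nearK eb]) (use not \<omega> in auto)
            also have "((1 + \<eta>) * \<sigma>\<^sup>2 * ((1 + \<eta>) * d + \<tau>) / real (m n)) / (1 - 3 * \<eta>)
                = (1 + \<eta>)\<^sup>2 / (1 - 3 * \<eta>) * S + (1 + \<eta>) / (1 - 3 * \<eta>) * (\<sigma>\<^sup>2 * \<tau> / real (m n))"
              by (simp add: S_def power2_eq_square distrib_left add_divide_distrib mult_ac)
            also have "(1 + 2 * \<eta>) * B2 + ((1 + \<eta>)\<^sup>2 / (1 - 3 * \<eta>) * S + (1 + \<eta>) / (1 - 3 * \<eta>) * (\<sigma>\<^sup>2 * \<tau> / real (m n))) + \<eta> * (r n)\<^sup>2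
                \<le> (1 + 8 * \<eta>) * B2 + ((1 + 8 * \<eta>) * S + 2 * (\<sigma>\<^sup>2 * \<tau> / real (m n))) + \<eta> * (2 * (B2 + S))"
              using \<eta> oracle_constant[OF \<eta>(1,2)] B0 S0 \<tau> m' r2
              by (intro add_mono mult_right_mono mult_left_mono) auto
            also have "\<dots> = (1 + 10 * \<eta>) * (B2 + S) + 2 * (\<sigma>\<^sup>2 * \<tau> / real (m n))" by (simp add: algebra_simps)
            also have "\<dots> \<le> (1 + \<epsilon>) * (E n + 1 / real (m n)) + 2 * (\<sigma>\<^sup>2 * \<tau> / real (m n))"
              using \<eta> \<rho> B0 S0 \<epsilon> by (intro add_right_mono mult_mono) auto
            also have "\<dots> = (1 + \<epsilon>) * E n + ((1 + \<epsilon>) + 2 * \<sigma>\<^sup>2 * \<tau>) / real (m n)"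
              by (simp add: distrib_left add_divide_distrib)
            also have "\<dots> \<le> (1 + \<epsilon>) * E n + a"
              unfolding a_def using elim(4) m' by (intro add_left_mono divide_right_mono) auto
            finally show False using big by simp
          qed
        qed
        then have "measure (M n) T \<le> measure (M n) (Bad \<union> B)"
          using Bad(1) Bm by (intro Mn.finite_measure_mono) auto
        also have "\<dots> \<le> measure (M n) Bad + measure (M n) B" by (rule measure_Un_le) (rule Bad(1) Bm)+
        also have "\<dots> < 4 * \<delta> + \<delta>" using Bad(2) elim(5) by (simp add: B_def)
        also have "\<dots> < \<delta>0" using \<delta>0 by (simp add: \<delta>_def)
        finally show ?thesis by (simp add: T_def a_def)
      qed
    qed
  qed
  then have "(\<lambda>n. measure (M n) {\<omega> \<in> space (M n). (1 + \<epsilon>) * E n + L n / real (m n) < W n \<omega>}) \<longlonglongrightarrow> 0"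
    by (intro order_tendstoI) (auto intro: always_eventually less_le_trans[OF _ measure_nonneg])
  then show ?thesis by (simp only: E_def L_def W_def)
qed

theorem theorem3p3:
  fixes M :: "nat \<Rightarrow> 'a measure"
    and m :: "nat \<Rightarrow> nat"
    and \<sigma> :: real
    and D :: "real measure"
    and K :: "nat \<Rightarrow> (nat \<Rightarrow> real) set"
    and \<mu>\<^sub>0 :: "nat \<Rightarrow> nat \<Rightarrow> real"
    and X :: "nat \<Rightarrow> 'a \<Rightarrow> nat \<Rightarrow> nat \<Rightarrow> real"
    and \<xi> Y \<mu>h :: "nat \<Rightarrow> 'a \<Rightarrow> nat \<Rightarrow> real"
  assumes "\<sigma> > 0"
    and "real_distribution D"
    and "integrable D (\<lambda>x. x\<^sup>2)"
    and "prob_space.expectation D (\<lambda>x. x) = 0"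
    and "prob_space.variance D (\<lambda>x. x) = \<sigma>\<^sup>2"
    and "\<And>n. n \<ge> 1 \<Longrightarrow> linear_model (M n) (m n) n D (X n) (\<xi> n)"
    and "\<And>n. n \<ge> 1 \<Longrightarrow> K n \<subseteq> coord_space {1..n}"
    and "\<And>n. n \<ge> 1 \<Longrightarrow> closed (K n)"
    and "\<And>n. n \<ge> 1 \<Longrightarrow> convex_cone (K n)"
    and "\<And>n. n \<ge> 1 \<Longrightarrow> \<mu>\<^sub>0 n \<in> K n"
    and "\<And>n \<omega> i. n \<ge> 1 \<Longrightarrow> \<omega> \<in> space (M n) \<Longrightarrow> i \<in> {1..m n} \<Longrightarrow>
           Y n \<omega> i = mat_vec (m n) n (X n \<omega>) (\<mu>\<^sub>0 n) i + \<xi> n \<omega> i"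
    and "filterlim (\<lambda>n. real (m n) / log_dim n (K n) (\<mu>\<^sub>0 n)) at_top sequentially"
    and "(\<lambda>n. oracle_risk (m n) n \<sigma> (K n) (\<mu>\<^sub>0 n)) \<in> o(\<lambda>_. 1)"
    and "(\<lambda>n. (INF \<nu>\<in>lineality (K n). L2_set (\<mu>\<^sub>0 n - \<nu>) {1..n}) / sqrt (real n)) \<in> O(\<lambda>_. 1)"
    and "near_minimizers M m \<sigma> K \<mu>\<^sub>0 X Y \<mu>h"
  shows "\<exists>A B. small_o_prob M A (\<lambda>_. 1) \<and>
           big_O_prob M B (\<lambda>n. log_dim n (K n) (\<mu>\<^sub>0 n) / real (m n)) \<and>
           (\<forall>\<^sub>F n in sequentially. \<forall>\<omega>\<in>space (M n).
              (L2_set (\<mu>h n \<omega> - \<mu>\<^sub>0 n) {1..n})\<^sup>2 / real n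
                \<le> (1 + A n \<omega>) * oracle_risk (m n) n \<sigma> (K n) (\<mu>\<^sub>0 n) + B n \<omega>)"
proof -
  define a where "a = (\<lambda>n. log_dim n (K n) (\<mu>\<^sub>0 n) / real (m n))"
  define E where "E = (\<lambda>n. oracle_risk (m n) n \<sigma> (K n) (\<mu>\<^sub>0 n))"
  define W where "W = (\<lambda>n \<omega>. (L2_set (\<mu>h n \<omega> - \<mu>\<^sub>0 n) {1..n})\<^sup>2 / real n)"
  have prob: "prob_space (M n)" if "1 \<le> n" for n using assms(6)[OF that] by (simp add: linear_model_def)
  have E0: "(\<lambda>n. oracle_risk (m n) n \<sigma> (K n) (\<mu>\<^sub>0 n)) \<longlonglongrightarrow> 0"
    using smalloD_tendsto[OF assms(13)] by simp
  have tail: "(\<lambda>n. measure (M n) {\<omega> \<in> space (M n). (1 + \<epsilon>) * E n + a n < W n \<omega>}) \<longlonglongrightarrow> 0" if "0 < \<epsilon>" for \<epsilon>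
    unfolding E_def a_def W_def
    by (rule sequential_oracle_tail[OF assms(1-12) E0 assms(15) that])
  have E_nonneg: "0 \<le> E n" if "1 \<le> n" for n unfolding E_def using assms(9)[OF that] that by (rule oracle_risk_nonneg)
  have a_nonneg: "\<forall>\<^sub>F n in sequentially. 0 \<le> a n"
  proof -
    have "\<forall>\<^sub>F n in sequentially. 0 \<le> log_dim n (K n) (\<mu>\<^sub>0 n)"
      using log_dim_at_top[of K \<mu>\<^sub>0] by (simp only: filterlim_at_top)
    then show ?thesis by eventually_elim (simp add: a_def)
  qed
  have Wm: "W n \<in> borel_measurable (M n)" if "1 \<le> n" for n
  proof -
    have "(\<lambda>\<omega>. \<mu>h n \<omega> i) \<in> borel_measurable (M n)" if "i \<in> {1..n}" for i
      using assms(15) \<open>1 \<le> n\<close> that unfolding near_minimizers_def by blast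
    then have "(\<lambda>\<omega>. ((\<mu>h n \<omega> - \<mu>\<^sub>0 n) i)\<^sup>2) \<in> borel_measurable (M n)" if "i \<in> {1..n}" for i
      using that by simp
    then show ?thesis unfolding W_def L2_set_def by measurable
  qed
  \<comment> \<open>The excess over \<open>E n + a n\<close> relative to \<open>E n\<close>; it is
    above \<epsilon> exactly on a tail event. For \<open>E n = 0\<close> division by zero makes it
    0, and \<open>B\<close> carries the excess instead.\<close>
  define A where "A = (\<lambda>n \<omega>. max 0 ((W n \<omega> - E n - a n) / E n))"
  \<comment> \<open>Deterministic unless \<open>E n = 0\<close>; in that case exceeding
    \<open>a n\<close> is the tail event for every \<epsilon>. Hence the constant 1 serves in
    \<open>big_O_prob\<close>.\<close>
  define B where "B = (\<lambda>n \<omega>. a n + (if E n = 0 then max 0 (W n \<omega> - a n) else 0))"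
  have small: "(\<lambda>n. measure (M n) (T n)) \<longlonglongrightarrow> 0"
    if T: "\<forall>\<^sub>F n in sequentially. T n \<subseteq> {\<omega> \<in> space (M n). (1 + \<epsilon>) * E n + a n < W n \<omega>}" and \<epsilon>: "0 < \<epsilon>" for T \<epsilon>
  proof (rule tendsto_sandwich[OF _ _ tendsto_const tail[OF \<epsilon>]])
    show "\<forall>\<^sub>F n in sequentially. measure (M n) (T n) \<le> measure (M n) {\<omega> \<in> space (M n). (1 + \<epsilon>) * E n + a n < W n \<omega>}"
      using T eventually_ge_at_top[of 1]
    proof eventually_elim
      case (elim n)
      have "{\<omega> \<in> space (M n). (1 + \<epsilon>) * E n + a n < W n \<omega>} \<in> sets (M n)" using Wm[OF elim(2)] by measurable
      then show ?case using elim prob[OF elim(2)]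
        by (intro finite_measure.finite_measure_mono prob_space.finite_measure)
    qed
  qed simp
  have "small_o_prob M A (\<lambda>_. 1)"
    unfolding small_o_prob_def
  proof (intro conjI allI impI)
    fix n :: nat assume "1 \<le> n"
    from Wm[OF this] show "A n \<in> borel_measurable (M n)" unfolding A_def by measurable
  next
    fix \<epsilon> :: real assume \<epsilon>: "0 < \<epsilon>"
    show "(\<lambda>n. measure (M n) {\<omega> \<in> space (M n). \<epsilon> * 1 < \<bar>A n \<omega>\<bar>}) \<longlonglongrightarrow> 0"
    proof (rule small[OF _ \<epsilon>])
      show "\<forall>\<^sub>F n in sequentially. {\<omega> \<in> space (M n). \<epsilon> * 1 < \<bar>A n \<omega>\<bar>}
          \<subseteq> {\<omega> \<in> space (M n). (1 + \<epsilon>) * E n + a n < W n \<omega>}"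
        using eventually_ge_at_top[of 1]
      proof eventually_elim
        case (elim n)
        show ?case
        proof (intro subsetI CollectI conjI)
          fix \<omega> assume "\<omega> \<in> {\<omega> \<in> space (M n). \<epsilon> * 1 < \<bar>A n \<omega>\<bar>}"
          then have \<omega>: "\<omega> \<in> space (M n)" and *: "\<epsilon> < (W n \<omega> - E n - a n) / E n"
            using \<epsilon> by (auto simp: A_def max_def split: if_splits)
          show "\<omega> \<in> space (M n)" by (rule \<omega>)
          have "E n \<noteq> 0" using * \<epsilon> by auto
          then have "0 < E n" using E_nonneg[OF elim] by simp
          then have "\<epsilon> * E n < W n \<omega> - E n - a n" using * by (simp add: pos_less_divide_eq)
          then show "(1 + \<epsilon>) * E n + a n < W n \<omega>" by (simp add: algebra_simps)
        qed
      qed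
    qed
  qed
  moreover have "big_O_prob M B a"
    unfolding big_O_prob_def
  proof (intro conjI allI impI)
    fix n :: nat assume "1 \<le> n"
    from Wm[OF this] show "B n \<in> borel_measurable (M n)" unfolding B_def by (cases "E n = 0") simp_all
  next
    fix \<epsilon> :: real assume \<epsilon>: "0 < \<epsilon>"
    have "(\<lambda>n. measure (M n) {\<omega> \<in> space (M n). 1 * a n < \<bar>B n \<omega>\<bar>}) \<longlonglongrightarrow> 0"
    proof (rule small[OF _ zero_less_one])
      show "\<forall>\<^sub>F n in sequentially. {\<omega> \<in> space (M n). 1 * a n < \<bar>B n \<omega>\<bar>}
          \<subseteq> {\<omega> \<in> space (M n). (1 + 1) * E n + a n < W n \<omega>}"
        using a_nonneg by eventually_elim (auto simp: B_def max_def split: if_splits)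
    qed
    then have "\<forall>\<^sub>F n in sequentially. measure (M n) {\<omega> \<in> space (M n). 1 * a n < \<bar>B n \<omega>\<bar>} < \<epsilon>"
      by (rule order_tendstoD) (rule \<epsilon>)
    then have "\<forall>\<^sub>F n in sequentially. measure (M n) {\<omega> \<in> space (M n). 1 * a n < \<bar>B n \<omega>\<bar>} \<le> \<epsilon>"
      by eventually_elim simp
    then show "\<exists>c>0. \<forall>\<^sub>F n in sequentially. measure (M n) {\<omega> \<in> space (M n). c * a n < \<bar>B n \<omega>\<bar>} \<le> \<epsilon>"
      by (intro exI[of _ 1] conjI zero_less_one)
  qed
  moreover have "\<forall>\<^sub>F n in sequentially. \<forall>\<omega>\<in>space (M n). W n \<omega> \<le> (1 + A n \<omega>) * E n + B n \<omega>"
    using eventually_ge_at_top[of 1]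
  proof eventually_elim
    case (elim n)
    show ?case
    proof
      fix \<omega>
      show "W n \<omega> \<le> (1 + A n \<omega>) * E n + B n \<omega>"
      proof (cases "E n = 0")
        case True
        then show ?thesis by (simp add: B_def)
      next
        case False
        then have E: "0 < E n" using E_nonneg[OF elim] by simp
        have "(W n \<omega> - E n - a n) / E n * E n \<le> A n \<omega> * E n"
          using E by (intro mult_right_mono) (auto simp: A_def)
        moreover have "(W n \<omega> - E n - a n) / E n * E n = W n \<omega> - E n - a n" using E by simp
        ultimately show ?thesis using E by (simp add: B_def distrib_right)
      qed
    qed
  qed
  ultimately show ?thesis unfolding a_def E_def W_def by blast
qed

end
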